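(* Let $r\in(0,\infty)$, $s\in(0,\infty]$ with $r<s$. Let $p\in(r,s)$, $q\in[p,s)$, and let $v$ be a weight on $\mathbf{R}^d$ with \[ \sup_Q|Q|^{-(\frac1r-\frac1s-\frac1p+\frac1q)}\|v\mathbf{1}_Q\|_{L^{\frac1{\frac1q-\frac1s}}(\mathbf{R}^d)}\|v^{-1}\mathbf{1}_Q\|_{L^{\frac1{\frac1r-\frac1p}}(\mathbf{R}^d)}<\infty . \] Then, for $X=\mathcal{L}^{p,q}_v(\mathbf{R}^d)$, \[ M:X_{r,s}\to X_{r,s},\qquad M:(X_{r,s})'\to(X_{r,s})' \] are bounded. In particular, this is the case if $v(x)=|x|^{\beta d}$ with $\beta\in\big(-(\frac1q-\frac1s),\frac1r-\frac1p\big)$.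
   Context: Conventions: $\frac1\infty=0$. A weight is a measurable function with $0<v<\infty$ a.e. $Q$ runs over cubes in $\mathbf{R}^d$ with sides parallel to the axes; $Mf=\sup_Q\big(\frac1{|Q|}\int_Q|f|\big)\mathbf{1}_Q$. The weighted Morrey space $\mathcal{L}^{p,q}_v(\mathbf{R}^d)$, $0<p\le q<\infty$, consists of the measurable $f$ with $\|f\|_{\mathcal{L}^{p,q}_v}=\sup_Q|Q|^{1/q}\big(\frac1{|Q|}\int_Q|fv|^p\big)^{1/p}<\infty$. For a quasi-normed space $X$ of measurable functions with the ideal property: $X'=\{g\in L^0: fg\in L^1\ \forall f\in X\}$ with $\|g\|_{X'}=\sup_{\|f\|_X=1}\|fg\|_{L^1}$; for $t\in(0,\infty)$, $X^t=\{f:|f|^{1/t}\in X\}$ with $\|f\|_{X^t}=\||f|^{1/t}\|_X^t$; $X_{r,s}=\big[[(X^r)']^{(s/r)'}\big]'$, where $(s/r)'=\frac1{1-r/s}$. *)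

theory Defs
  imports "HOL-Analysis.Analysis"
begin

text \<open>The Lebesgue measurable functions. Functions are not identified when they agree almost
  everywhere; all norms below depend only on the almost-everywhere class of their argument.\<close>

definition L0 :: "('a::euclidean_space \<Rightarrow> real) set" where
  "L0 = borel_measurable lebesgue"

definition weight :: "('a::euclidean_space \<Rightarrow> real) \<Rightarrow> bool" where
  "weight v \<longleftrightarrow> v \<in> L0 \<and> (AE x in lebesgue. 0 < v x)"

definition cubes :: "'a::euclidean_space set set" where
  "cubes = {cbox a (a + l *\<^sub>R One) | a l. 0 < l}"

text \<open>Powers of extended nonnegative numbers, used only for exponents \<open>a > 0\<close>.\<close>

definition epowr :: "ennreal \<Rightarrow> real \<Rightarrow> ennreal" where
  "epowr x a = (if x = \<infinity> then \<infinity> else ennreal (enn2real x powr a))"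

definition Lp_norm :: "real \<Rightarrow> ('a::euclidean_space \<Rightarrow> real) \<Rightarrow> ennreal" where
  "Lp_norm a f = epowr (\<integral>\<^sup>+x. ennreal (\<bar>f x\<bar> powr a) \<partial>lebesgue) (1 / a)"

text \<open>The maximal operator takes values in \<open>[0, \<infinity>]\<close>. The outer indicator function is expressed by
  restricting the supremum to the cubes that contain \<open>x\<close>.\<close>

definition maximal :: "('a::euclidean_space \<Rightarrow> real) \<Rightarrow> 'a \<Rightarrow> ennreal" where
  "maximal f x =
     (SUP Q\<in>{Q \<in> cubes. x \<in> Q}. (\<integral>\<^sup>+y\<in>Q. ennreal \<bar>f y\<bar> \<partial>lebesgue) / emeasure lebesgue Q)"

text \<open>A quasi-normed function space is given by its set of elements and its quasi-norm. The
  quasi-norm is extended-valued so that the suprema defining norms make sense unconditionally; its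
  values outside the set of elements are irrelevant.\<close>

record 'a fspace =
  elems :: "('a \<Rightarrow> real) set"
  qnorm :: "('a \<Rightarrow> real) \<Rightarrow> ennreal"

definition morrey_norm ::
    "real \<Rightarrow> real \<Rightarrow> ('a::euclidean_space \<Rightarrow> real) \<Rightarrow> ('a \<Rightarrow> real) \<Rightarrow> ennreal" where
  "morrey_norm p q v f =
     (SUP Q\<in>cubes. epowr (emeasure lebesgue Q) (1 / q) *
        epowr ((\<integral>\<^sup>+x\<in>Q. ennreal (\<bar>f x * v x\<bar> powr p) \<partial>lebesgue) / emeasure lebesgue Q) (1 / p))"

definition morrey :: "real \<Rightarrow> real \<Rightarrow> ('a::euclidean_space \<Rightarrow> real) \<Rightarrow> 'a fspace" where
  "morrey p q v =
     \<lparr>elems = {f \<in> L0. morrey_norm p q v f < \<infinity>}, qnorm = morrey_norm p q v\<rparr>"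

definition kothe_dual :: "'a::euclidean_space fspace \<Rightarrow> 'a fspace" where
  "kothe_dual X =
     \<lparr>elems = {g \<in> L0. \<forall>f\<in>elems X. integrable lebesgue (\<lambda>x. f x * g x)},
      qnorm = (\<lambda>g. SUP f\<in>{f \<in> elems X. qnorm X f = 1}. \<integral>\<^sup>+x. ennreal \<bar>f x * g x\<bar> \<partial>lebesgue)\<rparr>"

definition power_space :: "'a::euclidean_space fspace \<Rightarrow> real \<Rightarrow> 'a fspace" where
  "power_space X t =
     \<lparr>elems = {f \<in> L0. (\<lambda>x. \<bar>f x\<bar> powr (1 / t)) \<in> elems X},
      qnorm = (\<lambda>f. epowr (qnorm X (\<lambda>x. \<bar>f x\<bar> powr (1 / t))) t)\<rparr>"

text \<open>The exponent \<open>(s/r)' = 1 / (1 - r/s)\<close>; since \<open>r / \<infinity> = 0\<close> it equals \<open>1\<close> for \<open>s = \<infinity>\<close>.\<close>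

definition conj_quot :: "ereal \<Rightarrow> real \<Rightarrow> real" where
  "conj_quot s r = 1 / (1 - real_of_ereal (ereal r / s))"

definition rs_space :: "'a::euclidean_space fspace \<Rightarrow> real \<Rightarrow> ereal \<Rightarrow> 'a fspace" where
  "rs_space X r s =
     kothe_dual (power_space (kothe_dual (power_space X r)) (conj_quot s r))"

text \<open>The elements of a space are real-valued, so \<open>maximal f\<close> belongs to \<open>X\<close> if it is finite almost
  everywhere and its real-valued version (zero on the exceptional null set) lies in \<open>X\<close>.\<close>

definition maximal_bounded :: "'a::euclidean_space fspace \<Rightarrow> bool" where
  "maximal_bounded X \<longleftrightarrow>
     (\<exists>C::real. \<forall>f\<in>elems X.
        (AE x in lebesgue. maximal f x < \<infinity>) \<and>
        (\<lambda>x. enn2real (maximal f x)) \<in> elems X \<and>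
        qnorm X (\<lambda>x. enn2real (maximal f x)) \<le> ennreal C * qnorm X f)"

end

theory Submission
  imports Defs
begin

text \<open>
  With \<open>\<sigma> = 1/r - 1/s\<close>, the space \<open>X\<^sub>r\<^sub>,\<^sub>s\<close> of the Morrey space \<open>X\<close> with exponents \<open>p\<close>, \<open>q\<close> and weight \<open>v\<close> is,
  isometrically, the Morrey space with exponents \<open>a = \<sigma> / (1/p - 1/s)\<close>, \<open>b = \<sigma> / (1/q - 1/s)\<close> and weight
  \<open>w = |v|\<^bsup>1/\<sigma>\<^esup>\<close>; no block decomposition of the dual of \<open>X\<^sup>r\<close> is needed. The hypothesis on \<open>v\<close> bounds
  \<open>\<parallel>w\<parallel>\<^sub>b \<parallel>w\<^sup>-\<^sup>1\<parallel>\<^sub>a\<^sub>'\<close> on every cube \<open>Q\<close> by a multiple of \<open>|Q|\<^bsup>1/b + 1/a'\<^esup>\<close>. Hence \<open>w\<close> satisfies the Muckenhoupt condition for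
  \<open>a\<close>, and \<open>w\<^sup>b\<close> is doubling and reverse doubling.

  A cube that meets \<open>Q\<close> either lies in \<open>3Q\<close> or has \<open>Q\<close> in its own triple. The averages over cubes of the
  first kind are controlled by Muckenhoupt's theorem, proved by Lerner's iteration of two weighted
  maximal functions; an average over a cube \<open>R\<close> of the second kind is at most a multiple of
  \<open>\<parallel>f\<parallel> / \<parallel>w 1\<^sub>R\<parallel>\<^sub>b\<close>, directly from the hypothesis. On the Koethe dual one linearises the maximal operator
  over a finite family of cubes and shows that the transposed operators are bounded on the Morrey
  space, uniformly in the family: their local parts by duality from Muckenhoupt's theorem for \<open>1/w\<close>,
  the remaining parts by a geometric series that converges thanks to reverse doubling.
\<close>

section \<open>Hoelder's inequality and its converse\<close>

text \<open>The exponents come from the affine map \<open>t \<mapsto> (t - 1/s) / \<sigma>\<close>,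
  which carries 1/r, 1/p, 1/q, 1/s to 1, 1/a, 1/b, 0 and so reduces (r, s) to (1, \<infinity>). One
  inequality between the norms of \<open>X\<^sub>r\<^sub>,\<^sub>s\<close> and of the Morrey space
  comes from testing with functions \<open>u * w\<close> on a single cube, the other from showing
  that products \<open>|g| powr (1 / \<tau>) * u\<close> belong to the r-th power of X. Finite
  families of cubes are more than a convenience: Lerner's iteration rests on a self-improving
  inequality in which a power of the unknown integral is divided out, so that integral must be known
  to be finite beforehand; for a finite family it is. Cubes with rational data then exhaust the
  maximal operator monotonically. The dual cannot be treated like the Morrey space itself. For the
  maximal function of a Morrey function only the largest average over a big cube matters; the
  transposed linear operator adds the contributions of all big cubes, and a bound uniform in the
  scale would diverge. Reverse doubling supplies decay in the scale.\<close>

lemma nn_holder_pos: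
  fixes f g :: "'a \<Rightarrow> real"
  assumes pq: "1 < p" "1 < q" "1 / p + 1 / q = 1"
    and [measurable]: "f \<in> borel_measurable M" "g \<in> borel_measurable M"
    and nn: "\<And>x. 0 \<le> f x" "\<And>x. 0 \<le> g x" and AB: "0 < A" "0 < B"
    and f: "(\<integral>\<^sup>+x. ennreal (f x powr p) \<partial>M) \<le> ennreal (A powr p)"
    and g: "(\<integral>\<^sup>+x. ennreal (g x powr q) \<partial>M) \<le> ennreal (B powr q)"
  shows "(\<integral>\<^sup>+x. ennreal (f x * g x) \<partial>M) \<le> ennreal (A * B)"
proof -
  have le: "f x * g x \<le> A * B / (p * A powr p) * f x powr p + A * B / (q * B powr q) * g x powr q" for x
  proof -
    have "f x / A * (g x / B) \<le> (f x / A) powr p / p + (g x / B) powr q / q"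
      using nn AB pq by (intro Youngs_inequality) auto
    also have "\<dots> = f x powr p / (p * A powr p) + g x powr q / (q * B powr q)"
      using nn AB by (simp add: powr_divide mult.commute)
    finally have "A * B * (f x / A * (g x / B))
        \<le> A * B * (f x powr p / (p * A powr p) + g x powr q / (q * B powr q))"
      using AB by (intro mult_left_mono) auto
    then show ?thesis using AB by (simp add: field_simps)
  qed
  have "(\<integral>\<^sup>+x. ennreal (f x * g x) \<partial>M) \<le>
    (\<integral>\<^sup>+x. ennreal (A * B / (p * A powr p)) * ennreal (f x powr p)
       + ennreal (A * B / (q * B powr q)) * ennreal (g x powr q) \<partial>M)"
    using le nn AB pq
    by (intro nn_integral_mono)
       (simp add: ennreal_mult[symmetric] ennreal_plus[symmetric] ennreal_leI del: ennreal_plus)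
  also have "\<dots> = ennreal (A * B / (p * A powr p)) * (\<integral>\<^sup>+x. ennreal (f x powr p) \<partial>M)
       + ennreal (A * B / (q * B powr q)) * (\<integral>\<^sup>+x. ennreal (g x powr q) \<partial>M)"
    by (subst nn_integral_add) (auto simp: nn_integral_cmult)
  also have "\<dots> \<le> ennreal (A * B / (p * A powr p)) * ennreal (A powr p)
       + ennreal (A * B / (q * B powr q)) * ennreal (B powr q)"
    by (intro add_mono mult_left_mono f g) auto
  also have "\<dots> = ennreal (A * B / p + A * B / q)"
    using AB pq by (simp add: ennreal_mult[symmetric] ennreal_plus[symmetric] field_simps del: ennreal_plus)
  also have "A * B / p + A * B / q = A * B * (1 / p + 1 / q)" by (simp add: field_simps)
  finally show ?thesis using pq by simp
qed

text \<open>Young's inequality divides by the bounds, so a vanishing bound is reached by enlarging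
  both by \<open>e\<close> and letting \<open>e\<close> tend to 0. Real bounds \<open>A\<close>,
  \<open>B\<close> in place of the norms spare roots of extended numbers.\<close>

lemma nn_holder:
  fixes f g :: "'a \<Rightarrow> real"
  assumes pq: "1 < p" "1 < q" "1 / p + 1 / q = 1"
    and [measurable]: "f \<in> borel_measurable M" "g \<in> borel_measurable M"
    and nn: "\<And>x. 0 \<le> f x" "\<And>x. 0 \<le> g x" and AB: "0 \<le> A" "0 \<le> B"
    and f: "(\<integral>\<^sup>+x. ennreal (f x powr p) \<partial>M) \<le> ennreal (A powr p)"
    and g: "(\<integral>\<^sup>+x. ennreal (g x powr q) \<partial>M) \<le> ennreal (B powr q)"
  shows "(\<integral>\<^sup>+x. ennreal (f x * g x) \<partial>M) \<le> ennreal (A * B)"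
proof -
  have *: "(\<integral>\<^sup>+x. ennreal (f x * g x) \<partial>M) \<le> ennreal ((A + e) * (B + e))" if e: "e > 0" for e
  proof (rule nn_holder_pos[OF pq _ _ nn])
    have "A powr p \<le> (A + e) powr p" "B powr q \<le> (B + e) powr q"
      using AB e pq by (auto intro!: powr_mono2)
    then show "(\<integral>\<^sup>+x. ennreal (f x powr p) \<partial>M) \<le> ennreal ((A + e) powr p)"
      "(\<integral>\<^sup>+x. ennreal (g x powr q) \<partial>M) \<le> ennreal ((B + e) powr q)"
      using f g by (auto intro: order_trans ennreal_leI)
  qed (use AB e in auto)
  have "((\<lambda>e. ennreal ((A + e) * (B + e))) \<longlongrightarrow> ennreal ((A + 0) * (B + 0))) (at_right 0)"
    by (intro tendsto_intros)
  then have "((\<lambda>e. ennreal ((A + e) * (B + e))) \<longlongrightarrow> ennreal (A * B)) (at_right 0)" by simp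
  then show ?thesis
    by (rule tendsto_lowerbound) (auto simp: eventually_at_right_field intro!: exI[of _ 1] *)
qed

lemma conjugate_exponent:
  fixes p q :: real
  assumes "1 < p" "1 / p + 1 / q = 1"
  shows "1 < q" "(p - 1) * q = p" "q = p / (p - 1)" "p / q = p - 1"
proof -
  have "1 / q = (p - 1) / p" using assms by (simp add: field_simps)
  then show q: "q = p / (p - 1)" using assms by (metis div_by_1 divide_divide_eq_right mult_1)
  show "1 < q" unfolding q using assms(1) by simp
  show "(p - 1) * q = p" "p / q = p - 1" unfolding q using assms(1) by simp_all
qed

text \<open>The extremal function of Hoelder's inequality is \<open>F powr (p - 1)\<close>,
  normalised, which requires the integral of \<open>F powr p\<close> to be finite and nonzero.
  Finiteness is part of the conclusion, so the argument runs on the truncations \<open>Fn\<close> in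
  height and support and ends with monotone convergence.\<close>

lemma converse_holder:
  fixes F :: "'a::euclidean_space \<Rightarrow> real"
  assumes p: "1 < p" "1 / p + 1 / q = 1" and [measurable]: "F \<in> borel_measurable lebesgue"
    and nn: "\<And>x. 0 \<le> F x" and K: "0 \<le> K"
    and test: "\<And>u. u \<in> borel_measurable lebesgue \<Longrightarrow> (\<And>x. 0 \<le> u x) \<Longrightarrow>
       (\<integral>\<^sup>+x. ennreal (u x powr q) \<partial>lebesgue) \<le> 1 \<Longrightarrow>
       (\<integral>\<^sup>+x. ennreal (F x * u x) \<partial>lebesgue) \<le> ennreal K"
  shows "(\<integral>\<^sup>+x. ennreal (F x powr p) \<partial>lebesgue) \<le> ennreal (K powr p)"
proof -
  note q = conjugate_exponent[OF p]
  define Fn where "Fn n x = min (F x) (real n) * indicator (ball 0 (real n)) x" for n x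
  have [measurable]: "Fn n \<in> borel_measurable lebesgue" for n
  proof -
    have [measurable]: "ball (0::'a) (real n) \<in> sets lebesgue" by simp
    show ?thesis unfolding Fn_def by measurable
  qed
  have Fn0: "0 \<le> Fn n x" and FnF: "Fn n x \<le> F x" for n x
    using nn[of x] by (auto simp: Fn_def indicator_def)
  have bound: "(\<integral>\<^sup>+x. ennreal (Fn n x powr p) \<partial>lebesgue) \<le> ennreal (K powr p)" for n
  proof -
    have "(\<integral>\<^sup>+x. ennreal (Fn n x powr p) \<partial>lebesgue)
        \<le> (\<integral>\<^sup>+x. ennreal (real n powr p) * indicator (ball (0::'a) (real n)) x \<partial>lebesgue)"
      using p nn by (intro nn_integral_mono) (auto simp: Fn_def indicator_def intro!: ennreal_leI powr_mono2)
    also have "\<dots> = ennreal (real n powr p) * emeasure lebesgue (ball (0::'a) (real n))"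
      by (subst nn_integral_cmult_indicator) auto
    also have "\<dots> < \<infinity>"
      using emeasure_bounded_finite[of "ball (0::'a) (real n)"] by (auto simp: ennreal_mult_less_top)
    finally obtain I where I: "(\<integral>\<^sup>+x. ennreal (Fn n x powr p) \<partial>lebesgue) = ennreal I" "0 \<le> I"
      by (metis ennreal_cases infinity_ennreal_def less_irrefl)
    show ?thesis
    proof (cases "I = 0")
      case False
      then have Ipos: "I > 0" using I by auto
      \<comment> \<open>Since \<open>(p - 1) * q = p\<close>, dividing by
        \<open>I powr (1 / q)\<close> gives \<open>u\<close> norm one in the exponent
        \<open>q\<close>, and its pairing with \<open>Fn n\<close> is
        \<open>I / I powr (1 / q) = I powr (1 / p)\<close>.\<close>
      define u where "u x = Fn n x powr (p - 1) / I powr (1 / q)" for x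
      have u: "(\<integral>\<^sup>+x. ennreal (u x powr q) \<partial>lebesgue) = 1"
      proof -
        have "u x powr q = (1 / I) * Fn n x powr p" for x
          using Fn0[of n x] q(1,2) Ipos by (simp add: u_def powr_divide powr_powr)
        then have "(\<integral>\<^sup>+x. ennreal (u x powr q) \<partial>lebesgue)
            = (\<integral>\<^sup>+x. ennreal (1 / I) * ennreal (Fn n x powr p) \<partial>lebesgue)"
          using Ipos by (intro nn_integral_cong) (simp add: ennreal_mult[symmetric])
        also have "\<dots> = ennreal (1 / I) * ennreal I"
          by (subst nn_integral_cmult) (auto simp: I)
        finally have "(\<integral>\<^sup>+x. ennreal (u x powr q) \<partial>lebesgue) = ennreal (1 / I) * ennreal I" .
        then show ?thesis using Ipos by (simp add: ennreal_mult[symmetric])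
      qed
      have [measurable]: "u \<in> borel_measurable lebesgue" unfolding u_def by measurable
      have u0: "0 \<le> u x" for x by (auto simp: u_def)
      have "ennreal (1 / I powr (1 / q)) * ennreal I = (\<integral>\<^sup>+x. ennreal (Fn n x * u x) \<partial>lebesgue)"
      proof -
        have "Fn n x * u x = 1 / I powr (1 / q) * Fn n x powr p" for x
          using powr_mult_base[OF Fn0, of n x "p - 1"] by (simp add: u_def)
        then have "(\<integral>\<^sup>+x. ennreal (Fn n x * u x) \<partial>lebesgue)
            = (\<integral>\<^sup>+x. ennreal (1 / I powr (1 / q)) * ennreal (Fn n x powr p) \<partial>lebesgue)"
          by (intro nn_integral_cong) (simp add: ennreal_mult[symmetric])
        also have "\<dots> = ennreal (1 / I powr (1 / q)) * ennreal I"
          by (subst nn_integral_cmult) (auto simp: I)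
        finally show ?thesis by simp
      qed
      also have "\<dots> \<le> (\<integral>\<^sup>+x. ennreal (F x * u x) \<partial>lebesgue)"
        using FnF u0 by (intro nn_integral_mono ennreal_leI mult_right_mono)
      also have "\<dots> \<le> ennreal K" using u u0 by (intro test) auto
      finally have "I / I powr (1 / q) \<le> K"
        using I Ipos K by (simp add: ennreal_mult[symmetric])
      moreover have "I / I powr (1 / q) = I powr (1 / p)"
      proof -
        have "1 / p = 1 - 1 / q" using p by simp
        then show ?thesis using Ipos by (simp add: powr_diff)
      qed
      ultimately have "(I powr (1 / p)) powr p \<le> K powr p" using p by (intro powr_mono2) auto
      then show ?thesis using p Ipos I by (simp add: powr_powr ennreal_leI)
    qed (simp add: I)
  qed
  have lim: "(SUP n. ennreal (Fn n x powr p)) = ennreal (F x powr p)" for x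
  proof (rule antisym)
    show "(SUP n. ennreal (Fn n x powr p)) \<le> ennreal (F x powr p)"
      using FnF Fn0 p by (intro SUP_least ennreal_leI powr_mono2) auto
    obtain n where "real n > max (F x) (norm x)" using reals_Archimedean2 by blast
    then have "Fn n x = F x" by (auto simp: Fn_def)
    then show "ennreal (F x powr p) \<le> (SUP n. ennreal (Fn n x powr p))"
      by (metis SUP_upper UNIV_I)
  qed
  have inc: "incseq (\<lambda>n x. ennreal (Fn n x powr p))"
  proof (intro incseq_SucI le_funI ennreal_leI powr_mono2)
    fix n x show "Fn n x \<le> Fn (Suc n) x" "0 \<le> Fn n x" "0 \<le> p"
      using Fn0 p nn[of x] by (auto simp: Fn_def indicator_def)
  qed
  have "(\<integral>\<^sup>+x. ennreal (F x powr p) \<partial>lebesgue) = (SUP n. \<integral>\<^sup>+x. ennreal (Fn n x powr p) \<partial>lebesgue)"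
    by (subst nn_integral_monotone_convergence_SUP[OF inc, symmetric]) (auto simp: lim)
  also have "\<dots> \<le> ennreal (K powr p)" by (intro SUP_least bound)
  finally show ?thesis .
qed

section \<open>From localised weak type to strong type\<close>

lemma sigma_finite_lebesgue: "sigma_finite_measure (lebesgue :: 'a::euclidean_space measure)"
proof
  obtain A :: "'a set set" where A: "countable A" "A \<subseteq> sets lborel" "\<Union>A = space lborel"
      "\<forall>a\<in>A. emeasure lborel a \<noteq> \<infinity>"
    using lborel.sigma_finite_countable by blast
  then show "\<exists>A. countable A \<and> A \<subseteq> sets lebesgue \<and> \<Union> A = space lebesgue \<and>
       (\<forall>a\<in>A. emeasure (lebesgue :: 'a measure) a \<noteq> \<infinity>)"
    by (intro exI[of _ A]) auto
qed

lemma nn_integral_powr_0_c: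
  fixes \<alpha> c :: real
  assumes "0 < \<alpha>" "0 \<le> c"
  shows "(\<integral>\<^sup>+t. ennreal (t powr (\<alpha> - 1)) * indicator {0<..c} t \<partial>lborel) = ennreal (c powr \<alpha> / \<alpha>)"
proof -
  have "((\<lambda>x. x powr (\<alpha> - 1)) has_integral (c powr \<alpha> / \<alpha>)) {0..c}"
    using has_integral_powr_from_0[of "\<alpha> - 1" c] assms by simp
  then have "(\<integral>\<^sup>+t. ennreal (t powr (\<alpha> - 1)) * indicator {0..c} t \<partial>lborel) = ennreal (c powr \<alpha> / \<alpha>)"
    by (intro nn_integral_has_integral_lebesgue') auto
  moreover have "(\<integral>\<^sup>+t. ennreal (t powr (\<alpha> - 1)) * indicator {0<..c} t \<partial>lborel)
     = (\<integral>\<^sup>+t. ennreal (t powr (\<alpha> - 1)) * indicator {0..c} t \<partial>lborel)"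
    by (intro nn_integral_cong) (auto simp: indicator_def)
  ultimately show ?thesis by simp
qed

text \<open>Layer-cake formula: \<open>\<Phi> x powr \<alpha>\<close> is the integral of
  \<open>\<alpha> * t powr (\<alpha> - 1)\<close> over \<open>0 < t \<le> \<Phi> x\<close>, and the
  two integrals are exchanged by Tonelli. The level sets include equality, as in the weak-type
  inequality below.\<close>

lemma nn_integral_layers:
  fixes \<Phi> m :: "'a::euclidean_space \<Rightarrow> real"
  assumes [measurable]: "\<Phi> \<in> borel_measurable lebesgue" "m \<in> borel_measurable lebesgue"
    and nn: "\<And>x. 0 \<le> \<Phi> x" and \<alpha>: "0 < \<alpha>"
  shows "(\<integral>\<^sup>+x. ennreal (\<Phi> x powr \<alpha>) * ennreal (m x) \<partial>lebesgue) =
     (\<integral>\<^sup>+t. ennreal (\<alpha> * t powr (\<alpha> - 1)) * indicator {0<..} t *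
        (\<integral>\<^sup>+x. indicator {x. t \<le> \<Phi> x} x * ennreal (m x) \<partial>lebesgue) \<partial>lborel)"
proof -
  interpret L: sigma_finite_measure "lebesgue :: 'a measure" by (rule sigma_finite_lebesgue)
  interpret P: pair_sigma_finite "lebesgue :: 'a measure" "lborel :: real measure" ..
  let ?k = "\<lambda>x t. ennreal (\<alpha> * t powr (\<alpha> - 1)) * indicator {0<..} t * (indicator {x. t \<le> \<Phi> x} x * ennreal (m x))"
  have [measurable]: "(\<lambda>(x, t). ?k x t) \<in> borel_measurable (lebesgue \<Otimes>\<^sub>M lborel)"
  proof -
    have "(\<lambda>(x, t). ?k x t) = (\<lambda>(x, t). ennreal (\<alpha> * t powr (\<alpha> - 1)) * indicator {0<..} t * ((if t \<le> \<Phi> x then 1 else 0) * ennreal (m x)))"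
      by (auto simp: indicator_def fun_eq_iff)
    also have "\<dots> \<in> borel_measurable (lebesgue \<Otimes>\<^sub>M lborel)" by measurable
    finally show ?thesis .
  qed
  have "ennreal (\<Phi> x powr \<alpha>) * ennreal (m x) = (\<integral>\<^sup>+t. ?k x t \<partial>lborel)" for x
  proof -
    have "(\<integral>\<^sup>+t. ?k x t \<partial>lborel) = (\<integral>\<^sup>+t. (ennreal (t powr (\<alpha> - 1)) * indicator {0<..\<Phi> x} t) * (ennreal \<alpha> * ennreal (m x)) \<partial>lborel)"
      using \<alpha> by (intro nn_integral_cong) (auto simp: indicator_def ennreal_mult algebra_simps)
    also have "\<dots> = ennreal (\<Phi> x powr \<alpha> / \<alpha>) * (ennreal \<alpha> * ennreal (m x))"
      using nn_integral_powr_0_c[OF \<alpha> nn, of x] by (subst nn_integral_multc) auto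
    also have "\<dots> = ennreal (\<Phi> x powr \<alpha>) * ennreal (m x)"
      using \<alpha> by (simp add: mult.assoc[symmetric] ennreal_mult[symmetric])
    finally show ?thesis by simp
  qed
  then have "(\<integral>\<^sup>+x. ennreal (\<Phi> x powr \<alpha>) * ennreal (m x) \<partial>lebesgue) = (\<integral>\<^sup>+x. (\<integral>\<^sup>+t. ?k x t \<partial>lborel) \<partial>lebesgue)"
    by simp
  also have "\<dots> = (\<integral>\<^sup>+t. (\<integral>\<^sup>+x. ?k x t \<partial>lebesgue) \<partial>lborel)"
    by (rule P.Fubini'[symmetric]) simp
  also have "\<dots> = (\<integral>\<^sup>+t. ennreal (\<alpha> * t powr (\<alpha> - 1)) * indicator {0<..} t *
        (\<integral>\<^sup>+x. indicator {x. t \<le> \<Phi> x} x * ennreal (m x) \<partial>lebesgue) \<partial>lborel)"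
    by (intro nn_integral_cong nn_integral_cmult) measurable
  finally show ?thesis .
qed

text \<open>A weak-type inequality whose right-hand side is localised to the level set improves itself to
  a strong-type inequality, as in Doob's maximal inequality.\<close>

lemma strong_type_of_weak_type:
  fixes \<Phi> h m :: "'a::euclidean_space \<Rightarrow> real"
  assumes p: "1 < p" and D: "0 \<le> D"
    and [measurable]: "\<Phi> \<in> borel_measurable lebesgue" "h \<in> borel_measurable lebesgue" "m \<in> borel_measurable lebesgue"
    and nn: "\<And>x. 0 \<le> \<Phi> x" "\<And>x. 0 \<le> h x" "\<And>x. 0 \<le> m x"
    and weak: "\<And>t. 0 < t \<Longrightarrow> ennreal t * (\<integral>\<^sup>+x. indicator {x. t \<le> \<Phi> x} x * ennreal (m x) \<partial>lebesgue)
        \<le> ennreal D * (\<integral>\<^sup>+x. indicator {x. t \<le> \<Phi> x} x * ennreal (h x * m x) \<partial>lebesgue)"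
    and fin: "(\<integral>\<^sup>+x. ennreal (\<Phi> x powr p * m x) \<partial>lebesgue) < \<infinity>"
  shows "(\<integral>\<^sup>+x. ennreal (\<Phi> x powr p * m x) \<partial>lebesgue)
      \<le> ennreal ((D * p / (p - 1)) powr p) * (\<integral>\<^sup>+x. ennreal (h x powr p * m x) \<partial>lebesgue)"
proof -
  define q where "q = p / (p - 1)"
  have q: "1 < q" "1 / p + 1 / q = 1" "(p - 1) * q = p"
    using p by (auto simp: q_def field_simps)
  \<comment> \<open>The weak-type inequality trades one factor \<open>t\<close> for
    \<open>h\<close>, so layers of \<open>\<Phi> powr p\<close> turn into layers of
    \<open>\<Phi> powr (p - 1)\<close>; the factor \<open>p / (p - 1)\<close> is the quotient of the
    constants in the two layer densities.\<close>
  have "(\<integral>\<^sup>+x. ennreal (\<Phi> x powr p) * ennreal (m x) \<partial>lebesgue)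
      \<le> (\<integral>\<^sup>+t. ennreal (D * p / (p - 1)) * (ennreal ((p - 1) * t powr (p - 1 - 1)) * indicator {0<..} t *
        (\<integral>\<^sup>+x. indicator {x. t \<le> \<Phi> x} x * ennreal (h x * m x) \<partial>lebesgue)) \<partial>lborel)"
    unfolding nn_integral_layers[OF \<open>\<Phi> \<in> _\<close> \<open>m \<in> _\<close> nn(1), of p, OF order.strict_trans[OF zero_less_one p]]
  proof (intro nn_integral_mono)
    fix t :: real
    show "ennreal (p * t powr (p - 1)) * indicator {0<..} t * (\<integral>\<^sup>+x. indicator {x. t \<le> \<Phi> x} x * ennreal (m x) \<partial>lebesgue)
      \<le> ennreal (D * p / (p - 1)) * (ennreal ((p - 1) * t powr (p - 1 - 1)) * indicator {0<..} t *
        (\<integral>\<^sup>+x. indicator {x. t \<le> \<Phi> x} x * ennreal (h x * m x) \<partial>lebesgue))"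
    proof (cases "0 < t")
      case True
      have "t powr (p - 1) = t * t powr (p - 1 - 1)" using True by (simp add: powr_mult_base)
      then have "ennreal (p * t powr (p - 1)) * (\<integral>\<^sup>+x. indicator {x. t \<le> \<Phi> x} x * ennreal (m x) \<partial>lebesgue)
         = ennreal (p * t powr (p - 1 - 1)) * (ennreal t * (\<integral>\<^sup>+x. indicator {x. t \<le> \<Phi> x} x * ennreal (m x) \<partial>lebesgue))"
        using True p by (simp add: ennreal_mult algebra_simps)
      also have "\<dots> \<le> ennreal (p * t powr (p - 1 - 1)) * (ennreal D * (\<integral>\<^sup>+x. indicator {x. t \<le> \<Phi> x} x * ennreal (h x * m x) \<partial>lebesgue))"
        by (intro mult_left_mono weak True) simp
      also have "\<dots> = ennreal (p * t powr (p - 1 - 1)) * ennreal D * (\<integral>\<^sup>+x. indicator {x. t \<le> \<Phi> x} x * ennreal (h x * m x) \<partial>lebesgue)"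
        by (simp only: mult.assoc)
      also have "ennreal (p * t powr (p - 1 - 1)) * ennreal D = ennreal (D * p / (p - 1)) * ennreal ((p - 1) * t powr (p - 1 - 1))"
      proof -
        define T where "T = t powr (p - 1 - 1)"
        have "p * T * D = D * p / (p - 1) * ((p - 1) * T)" "0 \<le> T" using p by (simp_all add: T_def)
        then have "ennreal (p * T) * ennreal D = ennreal (D * p / (p - 1)) * ennreal ((p - 1) * T)"
          using p D ennreal_mult[of "p * T" D] ennreal_mult[of "D * p / (p - 1)" "(p - 1) * T"] by (simp add: mult.commute)
        then show ?thesis by (simp add: T_def)
      qed
      finally show ?thesis using True by (simp add: mult.assoc)
    qed simp
  qed
  also have "\<dots> = ennreal (D * p / (p - 1)) * (\<integral>\<^sup>+x. ennreal (\<Phi> x powr (p - 1)) * ennreal (h x * m x) \<partial>lebesgue)"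
  proof (subst nn_integral_layers)
    interpret L: sigma_finite_measure "lebesgue :: 'a measure" by (rule sigma_finite_lebesgue)
    have "(\<lambda>(t,x). (indicator {x. t \<le> \<Phi> x} x :: ennreal) * ennreal (h x * m x))
      = (\<lambda>(t,x). (if t \<le> \<Phi> x then 1 else 0) * ennreal (h x * m x))" by (auto simp: indicator_def fun_eq_iff)
    also have "\<dots> \<in> borel_measurable (lborel \<Otimes>\<^sub>M lebesgue)" by measurable
    finally have [measurable]: "(\<lambda>t. \<integral>\<^sup>+x. indicator {x. t \<le> \<Phi> x} x * ennreal (h x * m x) \<partial>lebesgue) \<in> borel_measurable lborel"
      by (rule L.borel_measurable_nn_integral)
    show "(\<integral>\<^sup>+t. ennreal (D * p / (p - 1)) * (ennreal ((p - 1) * t powr (p - 1 - 1)) * indicator {0<..} t *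
        (\<integral>\<^sup>+x. indicator {x. t \<le> \<Phi> x} x * ennreal (h x * m x) \<partial>lebesgue)) \<partial>lborel)
      = ennreal (D * p / (p - 1)) * (\<integral>\<^sup>+t. (ennreal ((p - 1) * t powr (p - 1 - 1)) * indicator {0<..} t *
        (\<integral>\<^sup>+x. indicator {x. t \<le> \<Phi> x} x * ennreal (h x * m x) \<partial>lebesgue)) \<partial>lborel)"
      by (rule nn_integral_cmult) measurable
  qed (use p nn in auto)
  finally have main: "(\<integral>\<^sup>+x. ennreal (\<Phi> x powr p * m x) \<partial>lebesgue)
      \<le> ennreal (D * p / (p - 1)) * (\<integral>\<^sup>+x. ennreal (\<Phi> x powr (p - 1) * h x * m x) \<partial>lebesgue)"
    using nn by (simp add: ennreal_mult algebra_simps)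
  obtain I where I: "(\<integral>\<^sup>+x. ennreal (\<Phi> x powr p * m x) \<partial>lebesgue) = ennreal I" "0 \<le> I"
    using fin by (metis ennreal_cases infinity_ennreal_def less_irrefl)
  show ?thesis
  proof (cases "(\<integral>\<^sup>+x. ennreal (h x powr p * m x) \<partial>lebesgue)")
    case (real J)
    show ?thesis
    proof (cases "I = 0")
      case False
      then have Ipos: "0 < I" using I by auto
      \<comment> \<open>Hoelder in the measure with density \<open>m\<close> leaves \<open>I\<close>
        bounded by a multiple of \<open>I powr (1 / q) * J powr (1 / p)\<close>; dividing by
        \<open>I powr (1 / q)\<close> is where the hypothesis \<open>fin\<close> is spent.\<close>
      have "(\<integral>\<^sup>+x. ennreal (\<Phi> x powr (p - 1) * h x) \<partial>density lebesgue m) \<le> ennreal (I powr (1 / q) * J powr (1 / p))"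
        using p q I real Ipos nn
        by (intro nn_holder[of q p])
           (auto simp: nn_integral_density powr_powr ennreal_mult'[symmetric] mult.commute ac_simps)
      then have "(\<integral>\<^sup>+x. ennreal (\<Phi> x powr (p - 1) * h x * m x) \<partial>lebesgue) \<le> ennreal (I powr (1 / q) * J powr (1 / p))"
        using nn by (simp add: nn_integral_density ennreal_mult[symmetric] ac_simps)
      then have "ennreal I \<le> ennreal (D * p / (p - 1)) * ennreal (I powr (1 / q) * J powr (1 / p))"
        using main I by (metis (no_types, lifting) mult_left_mono order_trans zero_le)
      then have "I \<le> (D * p / (p - 1)) * (I powr (1 / q) * J powr (1 / p))"
        using D p by (simp add: ennreal_mult[symmetric])
      then have "I / I powr (1 / q) \<le> (D * p / (p - 1)) * J powr (1 / p)"
        using Ipos by (simp add: field_simps)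
      moreover have "I / I powr (1 / q) = I powr (1 / p)"
      proof -
        have "1 / p = 1 - 1 / q" using q by simp
        then show ?thesis using Ipos by (simp add: powr_diff)
      qed
      ultimately have "(I powr (1 / p)) powr p \<le> ((D * p / (p - 1)) * J powr (1 / p)) powr p"
        using p by (intro powr_mono2) auto
      moreover have "((D * p / (p - 1)) * J powr (1 / p)) powr p = (D * p / (p - 1)) powr p * J"
        using p D real by (subst powr_mult) (auto simp: powr_powr)
      ultimately have "I \<le> (D * p / (p - 1)) powr p * J"
        using p Ipos by (simp add: powr_powr)
      then show ?thesis using I real by (simp add: ennreal_mult[symmetric] ennreal_leI)
    qed (simp add: I)
  next
    case top
    show ?thesis
    \<comment> \<open>An infinite right-hand integral makes the claim trivial unless the constant in
      front vanishes, since \<open>0 * \<infinity> = 0\<close>; in that case the left side is 0 by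
      \<open>main\<close>.\<close>
    proof (cases "D = 0")
      case True
      then show ?thesis using main by simp
    next
      case False
      then have "ennreal ((D * p / (p - 1)) powr p) \<noteq> 0" using D p by (auto simp: ennreal_eq_0_iff)
      then show ?thesis using top by (simp add: ennreal_mult_top)
    qed
  qed
qed

section \<open>Finite maximal functions\<close>

declare split_paired_All [simp del] split_paired_Ex [simp del]

text \<open>A cube is a pair of lower corner and side length, so that side, volume and concentric
  dilation are functions of the data and families of cubes are sets of pairs. The simplifier must
  then not split quantifiers over cubes into quantifiers over corner and side.\<close>

definition cube :: "'a::euclidean_space \<times> real \<Rightarrow> 'a set" where
  "cube Q = cbox (fst Q) (fst Q + snd Q *\<^sub>R One)"

definition triple :: "'a::euclidean_space \<times> real \<Rightarrow> 'a \<times> real" where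
  "triple Q = (fst Q - snd Q *\<^sub>R One, 3 * snd Q)"

definition vol :: "'a::euclidean_space \<times> real \<Rightarrow> real" where
  "vol Q = snd Q ^ DIM('a)"

definition nint :: "('a::euclidean_space \<Rightarrow> real) \<Rightarrow> 'a \<times> real \<Rightarrow> ennreal" where
  "nint m Q = (\<integral>\<^sup>+x\<in>cube Q. ennreal (m x) \<partial>lebesgue)"

text \<open>An infinite \<open>nint\<close> is sent to 0 by \<open>enn2real\<close>, so an upper
  bound on \<open>mass\<close> has content only next to finiteness of \<open>nint\<close>; the
  conditions on weights below therefore list both.\<close>

definition mass :: "('a::euclidean_space \<Rightarrow> real) \<Rightarrow> 'a \<times> real \<Rightarrow> real" where
  "mass m Q = enn2real (nint m Q)"

text \<open>The coefficients are arbitrary rather than averages of a function: they will also be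
  weighted averages, powers of averages, and averages set to 0 for cubes that are not local. The
  inserted 0 makes the maximum exist and is the value off all cubes.\<close>

definition fmax :: "('a::euclidean_space \<times> real) set \<Rightarrow> ('a \<times> real \<Rightarrow> real) \<Rightarrow> 'a \<Rightarrow> real" where
  "fmax F c x = Max (insert 0 (c ` {Q \<in> F. x \<in> cube Q}))"

lemma mem_cube: "x \<in> cube Q \<longleftrightarrow> (\<forall>i\<in>Basis. fst Q \<bullet> i \<le> x \<bullet> i \<and> x \<bullet> i \<le> fst Q \<bullet> i + snd Q)"
  by (auto simp: cube_def mem_box inner_simps)

lemma cubes_eq: "cubes = cube ` {Q. 0 < snd Q}"
proof (intro set_eqI iffI)
  fix S :: "'a set"
  assume "S \<in> cubes"
  then obtain a :: 'a and l where "S = cube (a, l)" "0 < l" by (auto simp: cubes_def cube_def)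
  then show "S \<in> cube ` {Q. 0 < snd Q}" by force
next
  fix S :: "'a set"
  assume "S \<in> cube ` {Q. 0 < snd Q}"
  then show "S \<in> cubes" by (auto simp: cubes_def cube_def)
qed

lemma cube_sets [measurable, simp]: "cube Q \<in> sets lebesgue" "cube Q \<in> sets borel"
  by (auto simp: cube_def)

lemma vol_pos: "0 < snd Q \<Longrightarrow> 0 < vol Q"
  by (simp add: vol_def)

lemma emeasure_cube: "0 < snd Q \<Longrightarrow> emeasure lebesgue (cube Q) = ennreal (vol Q)"
  by (simp add: cube_def vol_def emeasure_lborel_cbox_eq inner_simps)

lemma snd_triple [simp]: "snd (triple Q) = 3 * snd Q"
  by (simp add: triple_def)

lemma vol_triple: "vol (triple (Q :: 'a::euclidean_space \<times> real)) = 3 ^ DIM('a) * vol Q"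
  by (simp add: vol_def power_mult_distrib)

lemma mem_triple: "x \<in> cube (triple Q) \<longleftrightarrow>
    (\<forall>i\<in>Basis. fst Q \<bullet> i - snd Q \<le> x \<bullet> i \<and> x \<bullet> i \<le> fst Q \<bullet> i + 2 * snd Q)"
  by (auto simp: mem_cube triple_def inner_simps)

text \<open>Applied in both orders of the side lengths, this is the dichotomy between local and far
  cubes; with a maximal side it is the step of the covering lemma.\<close>

lemma cube_meets_subset_triple:
  assumes "x \<in> cube Q" "x \<in> cube R" "snd R \<le> snd Q"
  shows "cube R \<subseteq> cube (triple Q)"
proof
  fix y assume y: "y \<in> cube R"
  show "y \<in> cube (triple Q)"
    unfolding mem_triple
  proof
    fix i :: 'a assume i: "i \<in> Basis"
    show "fst Q \<bullet> i - snd Q \<le> y \<bullet> i \<and> y \<bullet> i \<le> fst Q \<bullet> i + 2 * snd Q"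
      using bspec[OF assms(1)[unfolded mem_cube] i] bspec[OF assms(2)[unfolded mem_cube] i]
        bspec[OF y[unfolded mem_cube] i] assms(3) by auto
  qed
qed

lemma cube_subset_triple: "0 < snd Q \<Longrightarrow> cube Q \<subseteq> cube (triple Q)"
  using cube_meets_subset_triple[of _ Q Q] by blast

lemma nint_mono_cube: "cube Q \<subseteq> cube R \<Longrightarrow> nint m Q \<le> nint m R"
  unfolding nint_def by (intro nn_integral_mono) (auto simp: indicator_def)

lemma nint_mass: "nint m Q < \<infinity> \<Longrightarrow> nint m Q = ennreal (mass m Q)"
  by (simp add: mass_def)

lemma mass_nonneg [simp]: "0 \<le> mass m Q" by (simp add: mass_def)

lemma nint_pos:
  assumes [measurable]: "m \<in> borel_measurable lebesgue" and "AE x in lebesgue. 0 < m x" "0 < snd Q"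
  shows "0 < nint m Q"
proof (rule ccontr)
  assume "\<not> 0 < nint m Q"
  then have "nint m Q = 0" by (simp add: not_gr_zero)
  then have "AE x in lebesgue. ennreal (m x) * indicator (cube Q) x = 0"
    unfolding nint_def by (subst (asm) nn_integral_0_iff_AE) auto
  then have "AE x in lebesgue. x \<notin> cube Q"
    using assms(2) by eventually_elim (auto simp: indicator_def split: if_splits)
  then have "emeasure lebesgue (cube Q) = 0"
    by (subst (asm) AE_iff_measurable[of "cube Q"]) auto
  then show False using assms(3) emeasure_cube[OF assms(3)] vol_pos[OF assms(3)] by simp
qed

text \<open>Greedy selection: a cube of greatest side is kept, every cube that meets it lies in its
  triple and is discarded, and induction handles the rest. A greatest side exists because the family
  is finite, which gives the dilation factor 3.\<close>

lemma vitali_finite: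
  fixes F :: "('a::euclidean_space \<times> real) set"
  assumes "finite F" "\<forall>Q\<in>F. 0 < snd Q"
  shows "\<exists>G\<subseteq>F. (\<forall>Q\<in>G. \<forall>R\<in>G. Q \<noteq> R \<longrightarrow> cube Q \<inter> cube R = {}) \<and>
           (\<forall>Q\<in>F. \<exists>R\<in>G. cube Q \<subseteq> cube (triple R))"
  using assms
proof (induction "card F" arbitrary: F rule: less_induct)
  case less
  show ?case
  proof (cases "F = {}")
    case False
    then have "Max (snd ` F) \<in> snd ` F" using less.prems by (intro Max_in) auto
    then obtain R where R: "R \<in> F" "snd R = Max (snd ` F)" by auto
    have Rmax: "snd Q \<le> snd R" if "Q \<in> F" for Q
      using less.prems that R by simp
    define F' where "F' = {Q \<in> F. cube Q \<inter> cube R = {}}"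
    have "fst R \<in> cube R" using less.prems R by (force simp: mem_cube)
    then have "R \<notin> F'" by (auto simp: F'_def)
    then have "F' \<subset> F" using R by (auto simp: F'_def)
    then have "card F' < card F" using less.prems by (intro psubset_card_mono) auto
    then obtain G where G: "G \<subseteq> F'" "\<forall>Q\<in>G. \<forall>R\<in>G. Q \<noteq> R \<longrightarrow> cube Q \<inter> cube R = {}"
        "\<forall>Q\<in>F'. \<exists>R\<in>G. cube Q \<subseteq> cube (triple R)"
    proof -
      have "finite F'" "\<forall>Q\<in>F'. 0 < snd Q" using less.prems by (auto simp: F'_def)
      then show ?thesis using less.hyps[OF \<open>card F' < card F\<close>] that by blast
    qed
    have "\<exists>R'\<in>insert R G. cube Q \<subseteq> cube (triple R')" if QF: "Q \<in> F" for Q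
    proof (cases "Q \<in> F'")
      case False
      then obtain x where "x \<in> cube Q" "x \<in> cube R" using QF by (auto simp: F'_def)
      then show ?thesis using cube_meets_subset_triple Rmax[OF QF] by blast
    qed (use G in auto)
    moreover have "\<forall>Q\<in>insert R G. \<forall>R'\<in>insert R G. Q \<noteq> R' \<longrightarrow> cube Q \<inter> cube R' = {}"
      using G by (auto simp: F'_def)
    moreover have "insert R G \<subseteq> F" using R G by (auto simp: F'_def)
    ultimately show ?thesis by blast
  qed auto
qed

lemma fmax_nonneg: "finite F \<Longrightarrow> 0 \<le> fmax F c x"
  by (simp add: fmax_def)

lemma fmax_ge: "finite F \<Longrightarrow> Q \<in> F \<Longrightarrow> x \<in> cube Q \<Longrightarrow> c Q \<le> fmax F c x"
  unfolding fmax_def by (intro Max_ge) auto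

lemma fmax_cases:
  assumes "finite F"
  obtains "fmax F c x = 0" | Q where "Q \<in> F" "x \<in> cube Q" "fmax F c x = c Q"
proof -
  have "fmax F c x \<in> insert 0 (c ` {Q \<in> F. x \<in> cube Q})"
    unfolding fmax_def using assms by (intro Max_in) auto
  then show ?thesis using that by auto
qed

lemma fmax_empty [simp]: "fmax {} c x = 0"
  by (simp add: fmax_def)

lemma fmax_insert:
  assumes "finite F"
  shows "fmax (insert Q F) c x = (if x \<in> cube Q then max (c Q) (fmax F c x) else fmax F c x)"
proof (cases "x \<in> cube Q")
  case True
  then have "{R \<in> insert Q F. x \<in> cube R} = insert Q {R \<in> F. x \<in> cube R}" by auto
  then have "insert 0 (c ` {R \<in> insert Q F. x \<in> cube R}) = insert (c Q) (insert 0 (c ` {R \<in> F. x \<in> cube R}))"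
    by auto
  then show ?thesis using True assms by (simp add: fmax_def)
next
  case False
  then have "{R \<in> insert Q F. x \<in> cube R} = {R \<in> F. x \<in> cube R}" by auto
  then show ?thesis using False by (simp add: fmax_def)
qed

lemma fmax_mono:
  assumes "F \<subseteq> G" "finite G"
  shows "fmax F c x \<le> fmax G c x"
  unfolding fmax_def using assms by (intro Max_mono) auto

lemma fmax_measurable [measurable]:
  assumes "finite F"
  shows "fmax F c \<in> borel_measurable lebesgue"
  using assms
proof (induction F)
  case (insert Q F)
  note insert.IH[measurable]
  have "fmax (insert Q F) c = (\<lambda>x. if x \<in> cube Q then max (c Q) (fmax F c x) else fmax F c x)"
    using insert by (auto simp: fmax_insert)
  also have "\<dots> \<in> borel_measurable lebesgue" by measurable
  finally show ?case .
qed (simp add: fun_eq_iff[symmetric] fmax_def)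

text \<open>The level set is the union of the cubes whose coefficient is at least \<open>t\<close>.
  The triples of a disjoint subfamily cover it, while the subfamily itself stays inside it; doubling
  passes from the triples back to the cubes, and the integral of \<open>h\<close> remains confined
  to the level set.\<close>

lemma fmax_weak_type:
  fixes h m :: "'a::euclidean_space \<Rightarrow> real"
  assumes F: "finite F" "\<forall>Q\<in>F. 0 < snd Q"
    and [measurable]: "h \<in> borel_measurable lebesgue" "m \<in> borel_measurable lebesgue"
    and doubling: "\<And>Q. 0 < snd Q \<Longrightarrow> nint m (triple Q) \<le> ennreal D * nint m Q"
    and c: "\<And>Q. Q \<in> F \<Longrightarrow> ennreal (c Q) * nint m Q \<le> nint (\<lambda>x. h x * m x) Q"
    and t: "0 < t"
  shows "ennreal t * (\<integral>\<^sup>+x. indicator {x. t \<le> fmax F c x} x * ennreal (m x) \<partial>lebesgue)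
        \<le> ennreal D * (\<integral>\<^sup>+x. indicator {x. t \<le> fmax F c x} x * ennreal (h x * m x) \<partial>lebesgue)"
proof -
  define Ft where "Ft = {Q \<in> F. t \<le> c Q}"
  have Ft: "finite Ft" "\<forall>Q\<in>Ft. 0 < snd Q" using F by (auto simp: Ft_def)
  obtain G where G: "G \<subseteq> Ft" "\<forall>Q\<in>G. \<forall>R\<in>G. Q \<noteq> R \<longrightarrow> cube Q \<inter> cube R = {}"
      "\<forall>Q\<in>Ft. \<exists>R\<in>G. cube Q \<subseteq> cube (triple R)"
    using vitali_finite[OF Ft] by blast
  have fG: "finite G" using G(1) Ft(1) finite_subset by blast
  have cover: "indicator {x. t \<le> fmax F c x} x \<le> (\<Sum>R\<in>G. indicator (cube (triple R)) x :: ennreal)" for x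
  proof (cases "t \<le> fmax F c x")
    case True
    \<comment> \<open>Positivity of \<open>t\<close> rules out the default value 0 of
      \<open>fmax\<close>.\<close>
    with t obtain Q where "Q \<in> F" "x \<in> cube Q" "fmax F c x = c Q"
      by (metis F(1) fmax_cases not_less)
    then have "Q \<in> Ft" using True by (simp add: Ft_def)
    then obtain R where R: "R \<in> G" "x \<in> cube (triple R)" using G(3) \<open>x \<in> cube Q\<close> by blast
    have "indicator (cube (triple R)) x \<le> (\<Sum>R\<in>G. indicator (cube (triple R)) x :: ennreal)"
      using R fG by (intro member_le_sum) auto
    then show ?thesis using R True by simp
  qed simp
  have packing: "(\<Sum>R\<in>G. indicator (cube R) x :: ennreal) \<le> indicator {x. t \<le> fmax F c x} x" for x
  proof (cases "\<exists>R\<in>G. x \<in> cube R")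
    case True
    then obtain R where R: "R \<in> G" "x \<in> cube R" by blast
    have "(\<Sum>R\<in>G. indicator (cube R) x :: ennreal) = (\<Sum>R\<in>{R}. indicator (cube R) x)"
      using R G(2) fG by (intro sum.mono_neutral_right) (auto simp: indicator_def)
    moreover have "t \<le> fmax F c x"
      using fmax_ge[OF F(1), of R x c] R G(1) by (auto simp: Ft_def)
    ultimately show ?thesis using R by simp
  qed (simp add: indicator_def)
  have "ennreal t * (\<integral>\<^sup>+x. indicator {x. t \<le> fmax F c x} x * ennreal (m x) \<partial>lebesgue)
      \<le> ennreal t * (\<integral>\<^sup>+x. (\<Sum>R\<in>G. ennreal (m x) * indicator (cube (triple R)) x) \<partial>lebesgue)"
    using cover by (intro mult_left_mono nn_integral_mono)
      (auto simp: sum_distrib_left[symmetric] mult.commute intro!: mult_left_mono)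
  also have "\<dots> = ennreal t * (\<Sum>R\<in>G. nint m (triple R))"
    by (subst nn_integral_sum) (auto simp: nint_def)
  also have "\<dots> \<le> ennreal t * (\<Sum>R\<in>G. ennreal D * nint m R)"
    using G(1) Ft by (intro mult_left_mono sum_mono doubling) auto
  also have "\<dots> = ennreal D * (\<Sum>R\<in>G. ennreal t * nint m R)"
    by (simp add: sum_distrib_left mult.left_commute)
  also have "\<dots> \<le> ennreal D * (\<Sum>R\<in>G. nint (\<lambda>x. h x * m x) R)"
  proof (intro mult_left_mono sum_mono)
    fix R assume "R \<in> G"
    then have "R \<in> F" "t \<le> c R" using G(1) by (auto simp: Ft_def)
    then have "ennreal t * nint m R \<le> ennreal (c R) * nint m R"
      by (intro mult_right_mono ennreal_leI) auto
    then show "ennreal t * nint m R \<le> nint (\<lambda>x. h x * m x) R"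
      using c[OF \<open>R \<in> F\<close>] by (rule order_trans)
  qed simp
  also have "\<dots> = ennreal D * (\<integral>\<^sup>+x. (\<Sum>R\<in>G. ennreal (h x * m x) * indicator (cube R) x) \<partial>lebesgue)"
    by (subst nn_integral_sum) (auto simp: nint_def)
  also have "\<dots> \<le> ennreal D * (\<integral>\<^sup>+x. indicator {x. t \<le> fmax F c x} x * ennreal (h x * m x) \<partial>lebesgue)"
  proof (intro mult_left_mono nn_integral_mono)
    fix x
    show "(\<Sum>R\<in>G. ennreal (h x * m x) * indicator (cube R) x)
        \<le> indicator {x. t \<le> fmax F c x} x * ennreal (h x * m x)"
      using mult_left_mono[OF packing[of x], of "ennreal (h x * m x)"]
      by (simp only: sum_distrib_left mult.commute zero_le simp_thms True_implies_equals)
  qed simp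
  finally show ?thesis .
qed

text \<open>For finitely many cubes of finite mass, the power of \<open>fmax\<close> is dominated by
  a finite sum of multiples of indicators; this is the a priori finiteness that the self-improvement
  of the weak-type inequality demands. The resulting constant does not depend on the family.\<close>

lemma fmax_strong_type:
  fixes h m :: "'a::euclidean_space \<Rightarrow> real"
  assumes F: "finite F" "\<forall>Q\<in>F. 0 < snd Q" and p: "1 < p" and D: "0 \<le> D"
    and [measurable]: "h \<in> borel_measurable lebesgue" "m \<in> borel_measurable lebesgue"
    and nn: "\<And>x. 0 \<le> h x" "\<And>x. 0 \<le> m x"
    and fin: "\<And>Q. 0 < snd Q \<Longrightarrow> nint m Q < \<infinity>"
    and doubling: "\<And>Q. 0 < snd Q \<Longrightarrow> nint m (triple Q) \<le> ennreal D * nint m Q"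
    and c: "\<And>Q. Q \<in> F \<Longrightarrow> ennreal (c Q) * nint m Q \<le> nint (\<lambda>x. h x * m x) Q"
  shows "(\<integral>\<^sup>+x. ennreal (fmax F c x powr p * m x) \<partial>lebesgue)
      \<le> ennreal ((D * p / (p - 1)) powr p) * (\<integral>\<^sup>+x. ennreal (h x powr p * m x) \<partial>lebesgue)"
proof (rule strong_type_of_weak_type)
  have "ennreal (fmax F c x powr p * m x)
      \<le> (\<Sum>Q\<in>F. ennreal (\<bar>c Q\<bar> powr p) * (ennreal (m x) * indicator (cube Q) x))" for x
  proof (cases rule: fmax_cases[OF F(1), of c x])
    case (2 Q)
    have "ennreal (fmax F c x powr p * m x) \<le> ennreal (\<bar>c Q\<bar> powr p) * (ennreal (m x) * indicator (cube Q) x)"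
      using 2 nn fmax_nonneg[OF F(1), of c x] by (auto simp: ennreal_mult)
    also have "\<dots> \<le> (\<Sum>Q\<in>F. ennreal (\<bar>c Q\<bar> powr p) * (ennreal (m x) * indicator (cube Q) x))"
      using 2 F(1) by (intro member_le_sum) auto
    finally show ?thesis .
  qed (use p in auto)
  then have "(\<integral>\<^sup>+x. ennreal (fmax F c x powr p * m x) \<partial>lebesgue)
      \<le> (\<integral>\<^sup>+x. (\<Sum>Q\<in>F. ennreal (\<bar>c Q\<bar> powr p) * (ennreal (m x) * indicator (cube Q) x)) \<partial>lebesgue)"
    by (rule nn_integral_mono)
  also have "\<dots> = (\<Sum>Q\<in>F. ennreal (\<bar>c Q\<bar> powr p) * nint m Q)"
    by (subst nn_integral_sum) (auto simp: nint_def nn_integral_cmult)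
  also have "\<dots> < \<infinity>"
    using fin F by (auto simp: ennreal_mult_less_top intro!: sum_Inf)
  finally show "(\<integral>\<^sup>+x. ennreal (fmax F c x powr p * m x) \<partial>lebesgue) < \<infinity>" .
qed (use fmax_weak_type[OF F _ _ doubling c] fmax_nonneg[OF F(1)] p D nn F in auto)

section \<open>Muckenhoupt's theorem\<close>

text \<open>The condition for \<open>w powr a\<close> to be a Muckenhoupt weight, written with
  \<open>w\<close> as a multiplier. In this form it is symmetric: exchanging the exponents replaces
  \<open>w\<close> by its inverse, which is how \<open>w powr - a'\<close> inherits doubling and how
  duality arguments return to the same theorem.\<close>

definition muckenhoupt :: "real \<Rightarrow> real \<Rightarrow> real \<Rightarrow> ('a::euclidean_space \<Rightarrow> real) \<Rightarrow> bool" where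
  "muckenhoupt a a' K w \<longleftrightarrow> w \<in> borel_measurable lebesgue \<and> (\<forall>x. 0 \<le> w x) \<and> (AE x in lebesgue. 0 < w x) \<and>
     (\<forall>Q. 0 < snd Q \<longrightarrow> nint (\<lambda>x. w x powr a) Q < \<infinity> \<and> nint (\<lambda>x. w x powr - a') Q < \<infinity> \<and>
        mass (\<lambda>x. w x powr a) Q powr (1 / a) * mass (\<lambda>x. w x powr - a') Q powr (1 / a') \<le> K * vol Q)"

lemma muckenhoupt_inverse:
  assumes "muckenhoupt a a' K w"
  shows "muckenhoupt a' a K (\<lambda>x. inverse (w x))"
proof -
  have nn: "\<And>x. 0 \<le> w x" using assms by (auto simp: muckenhoupt_def)
  have "inverse (w x) powr c = w x powr - c" for x c
    by (metis inverse_powr nn powr_minus)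
  then show ?thesis
    using assms unfolding muckenhoupt_def by (auto simp: mult.commute)
qed

lemma muckenhoupt_mass_pos:
  assumes "muckenhoupt a a' K w" "0 < snd Q"
  shows "0 < mass (\<lambda>x. w x powr a) Q" "0 < mass (\<lambda>x. w x powr - a') Q"
proof -
  have [measurable]: "w \<in> borel_measurable lebesgue" and pos: "AE x in lebesgue. 0 < w x"
    using assms by (auto simp: muckenhoupt_def)
  have "0 < nint (\<lambda>x. w x powr e) Q" for e
    by (rule nint_pos[OF _ _ assms(2)]) (measurable, use pos in eventually_elim, simp)
  moreover have "nint (\<lambda>x. w x powr a) Q < \<infinity>" "nint (\<lambda>x. w x powr - a') Q < \<infinity>"
    using assms unfolding muckenhoupt_def by blast+
  ultimately show "0 < mass (\<lambda>x. w x powr a) Q" "0 < mass (\<lambda>x. w x powr - a') Q"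
    unfolding mass_def by (simp_all add: enn2real_positive_iff)
qed

lemma holder_cube:
  fixes f g :: "'a::euclidean_space \<Rightarrow> real"
  assumes pq: "1 < p" "1 / p + 1 / q = 1"
    and [measurable]: "f \<in> borel_measurable lebesgue" "g \<in> borel_measurable lebesgue"
    and nn: "\<And>x. 0 \<le> f x" "\<And>x. 0 \<le> g x" and AB: "0 \<le> A" "0 \<le> B"
    and f: "nint (\<lambda>x. f x powr p) Q \<le> ennreal (A powr p)"
    and g: "nint (\<lambda>x. g x powr q) Q \<le> ennreal (B powr q)"
  shows "nint (\<lambda>x. f x * g x) Q \<le> ennreal (A * B)"
proof -
  let ?M = "restrict_space lebesgue (cube Q)"
  have eq: "nint h Q = (\<integral>\<^sup>+x. ennreal (h x) \<partial>?M)" for h :: "'a \<Rightarrow> real"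
    unfolding nint_def by (subst nn_integral_restrict_space) auto
  show ?thesis
    using f g unfolding eq
    by (intro nn_holder[OF pq(1) conjugate_exponent(1)[OF pq] pq(2)] nn AB) (auto intro: measurable_restrict_space1)
qed

text \<open>Hoelder's inequality for \<open>1 = w * inverse w\<close>: the product that the
  Muckenhoupt condition bounds from above is never below the volume.\<close>

lemma vol_le_mass_mult:
  assumes w: "w \<in> borel_measurable lebesgue" "\<And>x. 0 \<le> w x" "AE x in lebesgue. 0 < w x"
    and pq: "1 < a" "1 / a + 1 / a' = 1" and Q: "0 < snd Q"
    and fin: "nint (\<lambda>x. w x powr a) Q < \<infinity>" "nint (\<lambda>x. w x powr - a') Q < \<infinity>"
  shows "vol Q \<le> mass (\<lambda>x. w x powr a) Q powr (1 / a) * mass (\<lambda>x. w x powr - a') Q powr (1 / a')"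
proof -
  note [measurable] = w(1)
  note a' = conjugate_exponent(1)[OF pq]
  have "ennreal (vol Q) = nint (\<lambda>x. w x * inverse (w x)) Q"
  proof -
    have "AE x in lebesgue. ennreal (w x * inverse (w x)) * indicator (cube Q) x = indicator (cube Q) x"
      using w(3) by eventually_elim (auto simp: indicator_def)
    then have "nint (\<lambda>x. w x * inverse (w x)) Q = emeasure lebesgue (cube Q)"
      unfolding nint_def by (subst nn_integral_cong_AE) auto
    then show ?thesis using emeasure_cube[OF Q] by simp
  qed
  also have "\<dots> \<le> ennreal (mass (\<lambda>x. w x powr a) Q powr (1 / a) * mass (\<lambda>x. w x powr - a') Q powr (1 / a'))"
  proof (rule holder_cube[OF pq])
    have "inverse (w x) powr a' = w x powr - a'" for x
      by (metis inverse_powr w(2) powr_minus)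
    then show "nint (\<lambda>x. inverse (w x) powr a') Q \<le> ennreal ((mass (\<lambda>x. w x powr - a') Q powr (1 / a')) powr a')"
      using a' fin by (simp add: powr_powr nint_mass)
    show "nint (\<lambda>x. w x powr a) Q \<le> ennreal ((mass (\<lambda>x. w x powr a) Q powr (1 / a)) powr a)"
      using pq fin by (simp add: powr_powr nint_mass)
  qed (use w in auto)
  finally show ?thesis by simp
qed

text \<open>Let W and S be the norms of \<open>w\<close> and its inverse on a cube. The condition on
  3Q and the lower bound \<open>vol Q \<le> W(Q) S(Q) \<le> W(Q) S(3Q)\<close> share the factor
  S(3Q), which cancels; the constant is \<open>K\<close> times the ratio of volumes, raised to the
  power \<open>a\<close>.\<close>

lemma muckenhoupt_doubling:
  fixes w :: "'a::euclidean_space \<Rightarrow> real"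
  assumes m: "muckenhoupt a a' K w" and pq: "1 < a" "1 / a + 1 / a' = 1" and Q: "0 < snd Q" and K: "0 < K"
  shows "nint (\<lambda>x. w x powr a) (triple Q) \<le> ennreal ((K * 3 ^ DIM('a)) powr a) * nint (\<lambda>x. w x powr a) Q"
proof -
  let ?W = "mass (\<lambda>x. w x powr a)" and ?S = "mass (\<lambda>x. w x powr - a')"
  have Q3: "0 < snd (triple Q)" using Q by simp
  have fin: "nint (\<lambda>x. w x powr a) R < \<infinity>" "nint (\<lambda>x. w x powr - a') R < \<infinity>"
    and le: "?W R powr (1 / a) * ?S R powr (1 / a') \<le> K * vol R" if "0 < snd R" for R
    using m that unfolding muckenhoupt_def by blast+
  have Spos: "0 < ?S (triple Q)" "0 < ?W Q" "0 < ?W (triple Q)" using muckenhoupt_mass_pos[OF m] Q Q3 by auto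
  have "?S Q \<le> ?S (triple Q)"
    using nint_mono_cube[OF cube_subset_triple[OF Q], of "\<lambda>x. w x powr - a'"] fin[OF Q] fin[OF Q3]
    by (simp add: nint_mass)
  then have S: "?S Q powr (1 / a') \<le> ?S (triple Q) powr (1 / a')"
    using conjugate_exponent(1)[OF pq] by (intro powr_mono2) auto
  have "?W (triple Q) powr (1 / a) * ?S (triple Q) powr (1 / a') \<le> K * 3 ^ DIM('a) * vol Q"
    using le[OF Q3] by (simp add: vol_triple)
  also have "\<dots> \<le> K * 3 ^ DIM('a) * (?W Q powr (1 / a) * ?S (triple Q) powr (1 / a'))"
  proof (intro mult_left_mono)
    have "vol Q \<le> ?W Q powr (1 / a) * ?S Q powr (1 / a')"
      using m fin[OF Q] Q pq by (intro vol_le_mass_mult) (auto simp: muckenhoupt_def)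
    also have "\<dots> \<le> ?W Q powr (1 / a) * ?S (triple Q) powr (1 / a')"
      by (intro mult_left_mono S) auto
    finally show "vol Q \<le> ?W Q powr (1 / a) * ?S (triple Q) powr (1 / a')" .
  qed (use K in auto)
  finally have "?W (triple Q) powr (1 / a) \<le> K * 3 ^ DIM('a) * ?W Q powr (1 / a)"
    using Spos by (simp add: mult.assoc[symmetric])
  then have "(?W (triple Q) powr (1 / a)) powr a \<le> (K * 3 ^ DIM('a) * ?W Q powr (1 / a)) powr a"
    using pq by (intro powr_mono2) auto
  moreover have "(K * 3 ^ DIM('a) * ?W Q powr (1 / a)) powr a = (K * 3 ^ DIM('a)) powr a * ?W Q"
    using K pq Spos by (subst powr_mult) (auto simp: powr_powr)
  ultimately have "?W (triple Q) \<le> (K * 3 ^ DIM('a)) powr a * ?W Q"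
    using Spos pq by (simp add: powr_powr)
  then show ?thesis using fin[OF Q] fin[OF Q3] by (simp add: nint_mass ennreal_mult[symmetric] ennreal_leI)
qed

text \<open>Lerner's iteration: with \<open>G\<close> the maximal function with respect to the weight \<open>w powr - a'\<close>, the power
  \<open>a - 1\<close> of an average is at most a multiple of the average of \<open>G powr (a - 1) * w powr - a\<close> with respect
  to \<open>w powr a\<close>.\<close>

lemma muckenhoupt_fmax:
  fixes w :: "'a::euclidean_space \<Rightarrow> real"
  assumes m: "muckenhoupt a a' K w" and pq: "1 < a" "1 / a + 1 / a' = 1" and K: "0 < K"
  shows "\<exists>C\<ge>0. \<forall>F c f. finite F \<longrightarrow> (\<forall>Q\<in>F. 0 < snd Q) \<longrightarrow> (\<forall>Q\<in>F. 0 \<le> c Q) \<longrightarrow> f \<in> borel_measurable lebesgue \<longrightarrow>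
     (\<forall>x. 0 \<le> f x) \<longrightarrow> (\<forall>Q\<in>F. ennreal (c Q * vol Q) \<le> nint f Q) \<longrightarrow>
     (\<integral>\<^sup>+x. ennreal (fmax F c x powr a * w x powr a) \<partial>lebesgue)
       \<le> ennreal C * (\<integral>\<^sup>+x. ennreal (f x powr a * w x powr a) \<partial>lebesgue)"
proof -
  let ?W = "mass (\<lambda>x. w x powr a)" and ?S = "mass (\<lambda>x. w x powr - a')"
  have w[measurable]: "w \<in> borel_measurable lebesgue" and wnn: "\<And>x. 0 \<le> w x" and wpos: "AE x in lebesgue. 0 < w x"
    using m by (auto simp: muckenhoupt_def)
  have fin: "nint (\<lambda>x. w x powr a) R < \<infinity>" "nint (\<lambda>x. w x powr - a') R < \<infinity>"
    and le: "?W R powr (1 / a) * ?S R powr (1 / a') \<le> K * vol R" if "0 < snd R" for R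
    using m that unfolding muckenhoupt_def by blast+
  note a' = conjugate_exponent[OF pq]
  have a'a: "1 / a' + 1 / a = 1" using pq by simp
  note aa' = conjugate_exponent[OF a'(1) a'a]
  define D1 where "D1 = (K * 3 ^ DIM('a)) powr a"
  define D2 where "D2 = (K * 3 ^ DIM('a)) powr a'"
  define C1 where "C1 = (D2 * a / (a - 1)) powr a"
  define C2 where "C2 = (D1 * a' / (a' - 1)) powr a'"
  have doub1: "nint (\<lambda>x. w x powr a) (triple Q) \<le> ennreal D1 * nint (\<lambda>x. w x powr a) Q" if "0 < snd Q" for Q
    unfolding D1_def by (rule muckenhoupt_doubling[OF m pq that K])
  have inv: "inverse (w x) powr c = w x powr - c" for x c
    by (metis inverse_powr wnn powr_minus)
  have doub2: "nint (\<lambda>x. w x powr - a') (triple Q) \<le> ennreal D2 * nint (\<lambda>x. w x powr - a') Q" if "0 < snd Q" for Q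
    using muckenhoupt_doubling[OF muckenhoupt_inverse[OF m] a'(1) a'a that K] by (simp add: inv D2_def)
  show ?thesis
  proof (intro exI[of _ "K powr (a * a') * C2 * C1"] conjI allI impI)
    show "0 \<le> K powr (a * a') * C2 * C1" by (simp add: C1_def C2_def)
    fix F :: "('a \<times> real) set" and c and f :: "'a \<Rightarrow> real"
    assume F: "finite F" "\<forall>Q\<in>F. 0 < snd Q" and c0: "\<forall>Q\<in>F. 0 \<le> c Q" and [measurable]: "f \<in> borel_measurable lebesgue"
      and f0: "\<forall>x. 0 \<le> f x" and cf: "\<forall>Q\<in>F. ennreal (c Q * vol Q) \<le> nint f Q"
    \<comment> \<open>A lower bound for the average of \<open>h1 = f * w powr a'\<close> with
      respect to \<open>w powr - a'\<close>: the integral of \<open>f\<close> over \<open>Q\<close>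
      is replaced by \<open>c Q * vol Q\<close>.\<close>
    define A where "A Q = c Q * vol Q / ?S Q" for Q
    define h1 where "h1 x = f x * w x powr a'" for x
    define G where "G = fmax F A"
    \<comment> \<open>By the Muckenhoupt condition to the power \<open>a\<close>, together with
      \<open>A Q \<le> G\<close> on \<open>Q\<close>, the number \<open>c Q powr (a - 1)\<close> is
      at most \<open>K powr a\<close> times the average of \<open>h2\<close> with respect to
      \<open>w powr a\<close>; \<open>B\<close> absorbs the constant.\<close>
    define B where "B Q = c Q powr (a - 1) / K powr a" for Q
    define h2 where "h2 x = G x powr (a - 1) * w x powr - a" for x
    have [measurable]: "G \<in> borel_measurable lebesgue" unfolding G_def by (rule fmax_measurable[OF F(1)])
    have [measurable]: "h1 \<in> borel_measurable lebesgue" "h2 \<in> borel_measurable lebesgue"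
      unfolding h1_def h2_def by measurable
    have Spos: "0 < ?S Q" "0 < ?W Q" if "Q \<in> F" for Q using muckenhoupt_mass_pos[OF m] F that by auto
    have G0: "0 \<le> G x" for x unfolding G_def by (rule fmax_nonneg[OF F(1)])
    have "(\<integral>\<^sup>+x. ennreal (G x powr a * w x powr - a') \<partial>lebesgue)
      \<le> ennreal C1 * (\<integral>\<^sup>+x. ennreal (h1 x powr a * w x powr - a') \<partial>lebesgue)"
      unfolding G_def C1_def
    proof (rule fmax_strong_type[OF F pq(1)])
      fix Q assume Q: "Q \<in> F"
      have "ennreal (A Q) * nint (\<lambda>x. w x powr - a') Q = ennreal (c Q * vol Q)"
        using Q c0 F Spos[OF Q] fin[of Q] vol_pos[of Q]
        by (simp add: A_def nint_mass ennreal_mult[symmetric])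
      also have "\<dots> \<le> nint f Q" using cf Q by blast
      also have "\<dots> = nint (\<lambda>x. h1 x * w x powr - a') Q"
        unfolding nint_def h1_def using wpos
        by (intro nn_integral_cong_AE) (auto simp: mult.assoc powr_add[symmetric] elim!: eventually_mono)
      finally show "ennreal (A Q) * nint (\<lambda>x. w x powr - a') Q \<le> nint (\<lambda>x. h1 x * w x powr - a') Q" .
    qed (use doub2 fin f0 D2_def h1_def in auto)
    also have "(\<integral>\<^sup>+x. ennreal (h1 x powr a * w x powr - a') \<partial>lebesgue)
       = (\<integral>\<^sup>+x. ennreal (f x powr a * w x powr a) \<partial>lebesgue)"
    proof (intro nn_integral_cong arg_cong[where f=ennreal])
      fix x
      have "a' * a + - a' = a" using a'(2) by (simp add: algebra_simps a'(3)) (use pq in \<open>simp add: field_simps\<close>)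
      then show "h1 x powr a * w x powr - a' = f x powr a * w x powr a"
        using f0 wnn[of x] by (simp add: h1_def powr_mult powr_powr powr_add[symmetric] mult.assoc)
    qed
    finally have 1: "(\<integral>\<^sup>+x. ennreal (G x powr a * w x powr - a') \<partial>lebesgue)
      \<le> ennreal C1 * (\<integral>\<^sup>+x. ennreal (f x powr a * w x powr a) \<partial>lebesgue)" .
    have "(\<integral>\<^sup>+x. ennreal (fmax F B x powr a' * w x powr a) \<partial>lebesgue)
      \<le> ennreal C2 * (\<integral>\<^sup>+x. ennreal (h2 x powr a' * w x powr a) \<partial>lebesgue)"
      unfolding C2_def
    proof (rule fmax_strong_type[OF F a'(1)])
      fix Q assume Q: "Q \<in> F"
      then have sQ: "0 < snd Q" and cQ: "0 \<le> c Q" using F c0 by auto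
      note v = vol_pos[OF sQ]
      have "?W Q * ?S Q powr (a - 1) = (?W Q powr (1 / a) * ?S Q powr (1 / a')) powr a"
        using Spos[OF Q] pq a'(4) by (subst powr_mult) (auto simp: powr_powr)
      also have "\<dots> \<le> (K * vol Q) powr a"
        using le[OF sQ] pq by (intro powr_mono2) auto
      also have "\<dots> = K powr a * (vol Q powr (a - 1) * vol Q)"
        using K v powr_mult_base[of "vol Q" "a - 1"] by (simp add: powr_mult mult.commute)
      finally have W: "?W Q * ?S Q powr (a - 1) \<le> K powr a * (vol Q powr (a - 1) * vol Q)" .
      have "B Q * ?W Q \<le> A Q powr (a - 1) * vol Q"
      proof -
        have A: "A Q powr (a - 1) = c Q powr (a - 1) * vol Q powr (a - 1) / ?S Q powr (a - 1)"
          using cQ v Spos[OF Q] by (simp add: A_def powr_divide powr_mult)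
        have "B Q * ?W Q = c Q powr (a - 1) * (?W Q * ?S Q powr (a - 1)) / (K powr a * ?S Q powr (a - 1))"
          using K Spos[OF Q] by (simp add: B_def)
        also have "\<dots> \<le> c Q powr (a - 1) * (K powr a * (vol Q powr (a - 1) * vol Q)) / (K powr a * ?S Q powr (a - 1))"
          by (intro divide_right_mono mult_left_mono W) auto
        also have "\<dots> = A Q powr (a - 1) * vol Q"
          using K Spos[OF Q] by (simp add: A)
        finally show ?thesis .
      qed
      then have "ennreal (B Q) * nint (\<lambda>x. w x powr a) Q \<le> ennreal (A Q powr (a - 1)) * emeasure lebesgue (cube Q)"
        using fin[OF sQ] v emeasure_cube[OF sQ]
        by (simp add: B_def nint_mass ennreal_mult[symmetric] ennreal_leI)
      also have "\<dots> = (\<integral>\<^sup>+x\<in>cube Q. ennreal (A Q powr (a - 1)) \<partial>lebesgue)"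
        by (simp add: nn_integral_cmult_indicator)
      also have "\<dots> \<le> (\<integral>\<^sup>+x\<in>cube Q. ennreal (G x powr (a - 1)) \<partial>lebesgue)"
      proof (intro nn_integral_mono)
        fix x
        show "ennreal (A Q powr (a - 1)) * indicator (cube Q) x \<le> ennreal (G x powr (a - 1)) * indicator (cube Q) x"
        proof (cases "x \<in> cube Q")
          case True
          then have "A Q \<le> G x" unfolding G_def by (rule fmax_ge[OF F(1) Q])
          moreover have "0 \<le> A Q" using cQ v by (simp add: A_def)
          ultimately show ?thesis using True pq by (auto intro!: ennreal_leI powr_mono2)
        qed simp
      qed
      also have "\<dots> = nint (\<lambda>x. h2 x * w x powr a) Q"
        unfolding nint_def h2_def using wpos
        by (intro nn_integral_cong_AE) (auto simp: mult.assoc powr_add[symmetric] elim!: eventually_mono)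
      finally show "ennreal (B Q) * nint (\<lambda>x. w x powr a) Q \<le> nint (\<lambda>x. h2 x * w x powr a) Q" .
    qed (use doub1 fin D1_def h2_def in auto)
    also have "(\<integral>\<^sup>+x. ennreal (h2 x powr a' * w x powr a) \<partial>lebesgue)
       = (\<integral>\<^sup>+x. ennreal (G x powr a * w x powr - a') \<partial>lebesgue)"
    proof (intro nn_integral_cong arg_cong[where f=ennreal])
      fix x
      have "- (a * a') + a = - a'" using a'(2) by (simp add: algebra_simps)
      then show "h2 x powr a' * w x powr a = G x powr a * w x powr - a'"
        using a'(2) by (simp add: h2_def powr_mult powr_powr powr_add[symmetric] mult.assoc)
    qed
    finally have 2: "(\<integral>\<^sup>+x. ennreal (fmax F B x powr a' * w x powr a) \<partial>lebesgue)
      \<le> ennreal C2 * (\<integral>\<^sup>+x. ennreal (G x powr a * w x powr - a') \<partial>lebesgue)" .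
    \<comment> \<open>As \<open>(a - 1) * a' = a\<close>, the \<open>a'\<close>-th power of
      \<open>B\<close> is \<open>c powr a\<close> up to a constant, so the second maximal function
      in exponent \<open>a'\<close> controls the original one in exponent \<open>a\<close>.\<close>
    have "fmax F c x powr a * w x powr a \<le> K powr (a * a') * (fmax F B x powr a' * w x powr a)" for x
    proof (cases rule: fmax_cases[OF F(1), of c x])
      case (2 Q)
      then have cQ: "0 \<le> c Q" using c0 by auto
      have "c Q powr a = K powr (a * a') * B Q powr a'"
        using K cQ a'(2) by (simp add: B_def powr_divide powr_powr)
      also have "\<dots> \<le> K powr (a * a') * fmax F B x powr a'"
        using fmax_ge[OF F(1), of Q x B] 2 a'(1) by (intro mult_left_mono powr_mono2) (auto simp: B_def)
      finally show ?thesis using 2 by (simp add: mult.assoc[symmetric] mult_right_mono)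
    qed (use pq in simp)
    then have "(\<integral>\<^sup>+x. ennreal (fmax F c x powr a * w x powr a) \<partial>lebesgue)
       \<le> (\<integral>\<^sup>+x. ennreal (K powr (a * a')) * ennreal (fmax F B x powr a' * w x powr a) \<partial>lebesgue)"
      by (intro nn_integral_mono) (simp add: ennreal_mult[symmetric] ennreal_leI)
    also have "\<dots> = ennreal (K powr (a * a')) * (\<integral>\<^sup>+x. ennreal (fmax F B x powr a' * w x powr a) \<partial>lebesgue)"
    proof -
      note fmax_measurable[OF F(1), of B, measurable]
      show ?thesis by (rule nn_integral_cmult) measurable
    qed
    also have "\<dots> \<le> ennreal (K powr (a * a')) * (ennreal C2 * (ennreal C1 * (\<integral>\<^sup>+x. ennreal (f x powr a * w x powr a) \<partial>lebesgue)))"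
      by (intro mult_left_mono order_trans[OF 2] 1) auto
    finally show "(\<integral>\<^sup>+x. ennreal (fmax F c x powr a * w x powr a) \<partial>lebesgue)
       \<le> ennreal (K powr (a * a') * C2 * C1) * (\<integral>\<^sup>+x. ennreal (f x powr a * w x powr a) \<partial>lebesgue)"
      by (simp add: ennreal_mult C1_def C2_def mult.assoc)
  qed
qed

section \<open>Morrey norms and Koethe duals\<close>

lemma epowr_ennreal: "0 \<le> x \<Longrightarrow> epowr (ennreal x) c = ennreal (x powr c)"
  by (simp add: epowr_def)

lemma epowr_top [simp]: "epowr top c = top"
  by (simp add: epowr_def)

lemma epowr_mono:
  assumes "0 \<le> c" "x \<le> y"
  shows "epowr x c \<le> epowr y c"
proof (cases y)
  case (real y')
  then obtain x' where "x = ennreal x'" "0 \<le> x'" using assms by (cases x) (auto simp: top_unique)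
  with real assms show ?thesis by (auto simp: epowr_ennreal intro!: ennreal_leI powr_mono2)
qed simp

lemma epowr_epowr: "0 < c \<Longrightarrow> epowr (epowr x c) d = epowr x (c * d)"
  by (cases x) (auto simp: epowr_ennreal powr_powr)

lemma epowr_1 [simp]: "epowr x 1 = x"
  by (cases x) (auto simp: epowr_ennreal)

lemma epowr_le_iff:
  assumes "0 < c"
  shows "epowr x c \<le> y \<longleftrightarrow> x \<le> epowr y (1 / c)"
  using epowr_mono[of "1 / c" "epowr x c" y] epowr_mono[of c x "epowr y (1 / c)"] assms
  by (auto simp: epowr_epowr)

text \<open>All Morrey estimates are made in this form, one inequality between integrals per cube,
  free of roots and quotients of extended numbers.\<close>

lemma morrey_norm_le_iff:
  assumes p: "0 < p" and q: "0 < q" and K: "0 \<le> K"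
  shows "morrey_norm p q v f \<le> ennreal K \<longleftrightarrow>
    (\<forall>Q. 0 < snd Q \<longrightarrow> nint (\<lambda>x. \<bar>f x * v x\<bar> powr p) Q \<le> ennreal ((K * vol Q powr (1 / p - 1 / q)) powr p))"
proof -
  have "epowr (emeasure lebesgue (cube Q)) (1 / q) *
          epowr (nint (\<lambda>x. \<bar>f x * v x\<bar> powr p) Q / emeasure lebesgue (cube Q)) (1 / p) \<le> ennreal K \<longleftrightarrow>
        nint (\<lambda>x. \<bar>f x * v x\<bar> powr p) Q \<le> ennreal ((K * vol Q powr (1 / p - 1 / q)) powr p)"
    (is "?L \<longleftrightarrow> ?R") if Q: "0 < snd Q" for Q :: "'a \<times> real"
  proof -
    define V where "V = vol Q"
    have V: "0 < V" "emeasure lebesgue (cube Q) = ennreal V"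
      using vol_pos[OF Q] emeasure_cube[OF Q] by (auto simp: V_def)
    show ?thesis
    proof (cases "nint (\<lambda>x. \<bar>f x * v x\<bar> powr p) Q")
      case (real J)
      have "?L \<longleftrightarrow> V powr (1 / q) * (J / V) powr (1 / p) \<le> K"
        using V real K by (simp add: epowr_ennreal divide_ennreal ennreal_mult[symmetric])
      also have "\<dots> \<longleftrightarrow> J powr (1 / p) \<le> K * V powr (1 / p - 1 / q)"
        using V real by (simp add: powr_divide powr_diff field_simps)
      also have "\<dots> \<longleftrightarrow> J \<le> (K * V powr (1 / p - 1 / q)) powr p"
        using powr_mono2[of p "J powr (1 / p)" "K * V powr (1 / p - 1 / q)"]
          powr_mono2[of "1 / p" J "(K * V powr (1 / p - 1 / q)) powr p"] p real K V
        by (auto simp: powr_powr)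
      finally show ?thesis using real by (simp add: V_def)
    next
      case top
      then show ?thesis using V p by (simp add: ennreal_top_divide ennreal_mult_top epowr_ennreal top_unique)
    qed
  qed
  note key = this
  have "morrey_norm p q v f \<le> ennreal K \<longleftrightarrow>
    (\<forall>Q\<in>{Q. 0 < snd Q}. epowr (emeasure lebesgue (cube Q)) (1 / q) *
      epowr (nint (\<lambda>x. \<bar>f x * v x\<bar> powr p) Q / emeasure lebesgue (cube Q)) (1 / p) \<le> ennreal K)"
    unfolding morrey_norm_def cubes_eq SUP_le_iff nint_def by (simp only: ball_simps)
  then show ?thesis by (simp only: key mem_Collect_eq Ball_def cong: imp_cong)
qed

lemma morrey_normD:
  assumes "0 < p" "0 < q" "morrey_norm p q v f < \<infinity>" "0 < snd Q"
  shows "nint (\<lambda>x. \<bar>f x * v x\<bar> powr p) Q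
    \<le> ennreal ((enn2real (morrey_norm p q v f) * vol Q powr (1 / p - 1 / q)) powr p)"
  using morrey_norm_le_iff[of p q "enn2real (morrey_norm p q v f)" v f] assms by simp

text \<open>The dual norm is a supremum over functions of norm exactly 1. Scaling reaches every
  function of positive finite norm, and definiteness disposes of those of norm 0; together they give
  Hoelder's inequality between a space and its dual.\<close>

definition homogeneous :: "'a::euclidean_space fspace \<Rightarrow> bool" where
  "homogeneous X \<longleftrightarrow> elems X \<subseteq> L0 \<and>
     (\<forall>f\<in>elems X. qnorm X f < \<infinity> \<and> (qnorm X f = 0 \<longrightarrow> (AE x in lebesgue. f x = 0)) \<and>
        (\<forall>c>0. (\<lambda>x. c * f x) \<in> elems X \<and> qnorm X (\<lambda>x. c * f x) = ennreal c * qnorm X f))"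

text \<open>A substitute for completeness that makes no mention of a triangle inequality: the
  functions \<open>|f j| / 2 ^ j\<close> have a common majorant in the space.\<close>

definition dominated :: "'a::euclidean_space fspace \<Rightarrow> bool" where
  "dominated X \<longleftrightarrow> elems X \<subseteq> L0 \<and>
     (\<forall>f::nat \<Rightarrow> _. (\<forall>j. f j \<in> elems X \<and> qnorm X (f j) = 1) \<longrightarrow>
        (\<exists>F\<in>elems X. \<forall>j. AE x in lebesgue. \<bar>f j x\<bar> \<le> 2 ^ j * \<bar>F x\<bar>))"

lemma kothe_holder:
  assumes X: "homogeneous X" and f: "f \<in> elems X" and g: "g \<in> L0"
  shows "(\<integral>\<^sup>+x. ennreal \<bar>f x * g x\<bar> \<partial>lebesgue) \<le> qnorm X f * qnorm (kothe_dual X) g"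
proof -
  have [measurable]: "f \<in> borel_measurable lebesgue" "g \<in> borel_measurable lebesgue"
    using X f g by (auto simp: homogeneous_def L0_def)
  obtain k where k: "qnorm X f = ennreal k" "0 \<le> k"
    using X f unfolding homogeneous_def by (metis ennreal_cases infinity_ennreal_def less_irrefl)
  show ?thesis
  proof (cases "k = 0")
    case True
    then have "AE x in lebesgue. f x = 0" using X f k unfolding homogeneous_def by auto
    then have "(\<integral>\<^sup>+x. ennreal \<bar>f x * g x\<bar> \<partial>lebesgue) = (\<integral>\<^sup>+x. 0 \<partial>(lebesgue :: 'a measure))"
      by (intro nn_integral_cong_AE) (auto elim!: eventually_mono)
    then show ?thesis by simp
  next
    case False
    with k have k0: "0 < k" by simp
    define h where "h x = (1 / k) * f x" for x
    have "h \<in> elems X" "qnorm X h = ennreal (1 / k) * qnorm X f"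
      using X f k0 zero_less_divide_1_iff unfolding homogeneous_def h_def by blast+
    moreover from this have "qnorm X h = 1" using k k0 by (simp add: ennreal_mult[symmetric])
    ultimately have le: "(\<integral>\<^sup>+x. ennreal \<bar>h x * g x\<bar> \<partial>lebesgue) \<le> qnorm (kothe_dual X) g"
      by (auto simp: kothe_dual_def intro!: SUP_upper)
    have [measurable]: "h \<in> borel_measurable lebesgue" unfolding h_def by measurable
    have "(\<integral>\<^sup>+x. ennreal \<bar>f x * g x\<bar> \<partial>lebesgue) = (\<integral>\<^sup>+x. ennreal k * ennreal \<bar>h x * g x\<bar> \<partial>lebesgue)"
      using k0 by (intro nn_integral_cong) (simp add: h_def ennreal_mult[symmetric] abs_mult)
    also have "\<dots> = ennreal k * (\<integral>\<^sup>+x. ennreal \<bar>h x * g x\<bar> \<partial>lebesgue)"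
      by (rule nn_integral_cmult) measurable
    also have "\<dots> \<le> ennreal k * qnorm (kothe_dual X) g" by (intro mult_left_mono le) simp
    finally show ?thesis using k by simp
  qed
qed

text \<open>Gliding hump: if the dual norm were infinite, the multiples \<open>2\<^sup>-\<^sup>j f\<^sub>j\<close> of suitable unit vectors
  would have a common majorant in \<open>X\<close> whose product with \<open>g\<close> is not integrable.\<close>

lemma kothe_dual_finite:
  assumes X: "dominated X" and g: "g \<in> elems (kothe_dual X)"
  shows "qnorm (kothe_dual X) g < \<infinity>"
proof (rule ccontr)
  assume "\<not> qnorm (kothe_dual X) g < \<infinity>"
  then have "qnorm (kothe_dual X) g = \<infinity>" by (metis infinity_ennreal_def less_top)
  then have inf: "(SUP f\<in>{f \<in> elems X. qnorm X f = 1}. \<integral>\<^sup>+x. ennreal \<bar>f x * g x\<bar> \<partial>lebesgue) = \<infinity>"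
    by (simp add: kothe_dual_def)
  \<comment> \<open>With growth \<open>4 ^ j\<close> against the factor \<open>2 ^ j\<close> of the
    majorant, the integral of \<open>|F * g|\<close> has to be at least \<open>2 ^ j\<close> for
    every \<open>j\<close>.\<close>
  have "\<exists>f. f \<in> elems X \<and> qnorm X f = 1 \<and> ennreal (4 ^ j) < (\<integral>\<^sup>+x. ennreal \<bar>f x * g x\<bar> \<partial>lebesgue)" for j :: nat
  proof -
    have "ennreal (4 ^ j) < (SUP f\<in>{f \<in> elems X. qnorm X f = 1}. \<integral>\<^sup>+x. ennreal \<bar>f x * g x\<bar> \<partial>lebesgue)"
      unfolding inf by (simp add: ennreal_less_top)
    then show ?thesis unfolding less_SUP_iff by auto
  qed
  then obtain f where f: "\<And>j. f j \<in> elems X" "\<And>j. qnorm X (f j) = 1"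
      "\<And>j. ennreal (4 ^ j) < (\<integral>\<^sup>+x. ennreal \<bar>f j x * g x\<bar> \<partial>lebesgue)"
    by metis
  then obtain F where F: "F \<in> elems X" "\<And>j. AE x in lebesgue. \<bar>f j x\<bar> \<le> 2 ^ j * \<bar>F x\<bar>"
    using X unfolding dominated_def by metis
  have int: "integrable lebesgue (\<lambda>x. F x * g x)" using g F by (auto simp: kothe_dual_def)
  then have [measurable]: "(\<lambda>x. F x * g x) \<in> borel_measurable lebesgue" by auto
  obtain I where I: "(\<integral>\<^sup>+x. ennreal \<bar>F x * g x\<bar> \<partial>lebesgue) = ennreal I" "0 \<le> I"
    using int unfolding integrable_iff_bounded real_norm_def
    by (metis ennreal_cases infinity_ennreal_def less_irrefl)
  have "4 ^ j \<le> 2 ^ j * I" for j :: nat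
  proof -
    have "ennreal (4 ^ j) \<le> (\<integral>\<^sup>+x. ennreal \<bar>f j x * g x\<bar> \<partial>lebesgue)" using f(3)[of j] by simp
    also have "\<dots> \<le> (\<integral>\<^sup>+x. ennreal (2 ^ j) * ennreal \<bar>F x * g x\<bar> \<partial>lebesgue)"
    proof (intro nn_integral_mono_AE)
      show "AE x in lebesgue. ennreal \<bar>f j x * g x\<bar> \<le> ennreal (2 ^ j) * ennreal \<bar>F x * g x\<bar>"
        using F(2)[of j]
      proof eventually_elim
        case (elim x)
        then have "\<bar>f j x\<bar> * \<bar>g x\<bar> \<le> (2 ^ j * \<bar>F x\<bar>) * \<bar>g x\<bar>" by (intro mult_right_mono) auto
        then show ?case by (simp add: ennreal_mult[symmetric] abs_mult mult.assoc ennreal_leI)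
      qed
    qed
    also have "\<dots> = ennreal (2 ^ j) * ennreal I" by (subst nn_integral_cmult) (auto simp: I)
    finally show ?thesis using I by (simp add: ennreal_mult[symmetric])
  qed
  then have "2 ^ j * 2 ^ j \<le> 2 ^ j * I" for j :: nat
    by (simp add: power_mult_distrib[symmetric])
  then have "2 ^ j \<le> I" for j :: nat by simp
  moreover obtain j :: nat where "I < 2 ^ j" using real_arch_pow[of 2 I] by auto
  ultimately show False by (meson not_less)
qed

text \<open>\<open>F\<close> is the supremum of \<open>|f j| / 2 ^ j\<close>. Bounding
  \<open>F powr e\<close> by the sum of the \<open>e\<close>-th powers yields the geometric constant
  for every positive \<open>e\<close>, also below 1. \<open>F\<close> is chosen before
  \<open>e\<close>, \<open>m\<close> and \<open>K\<close>, so a single function serves all cubes of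
  a Morrey norm and all test functions of a dual norm.\<close>

lemma dominating_function:
  fixes f :: "nat \<Rightarrow> 'a::euclidean_space \<Rightarrow> real"
  assumes [measurable]: "\<And>j. f j \<in> borel_measurable lebesgue"
  obtains F where "F \<in> borel_measurable lebesgue" "\<And>x. 0 \<le> F x"
    "\<And>e m K. 0 < e \<Longrightarrow> m \<in> borel_measurable lebesgue \<Longrightarrow> (\<And>x. 0 \<le> m x) \<Longrightarrow> 0 \<le> K \<Longrightarrow>
       (\<And>j. (\<integral>\<^sup>+x. ennreal (\<bar>f j x\<bar> powr e * m x) \<partial>lebesgue) \<le> ennreal K) \<Longrightarrow>
       (\<integral>\<^sup>+x. ennreal (F x powr e * m x) \<partial>lebesgue) \<le> ennreal (K / (1 - 2 powr - e)) \<and>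
       (AE x in lebesgue. 0 < m x \<longrightarrow> (\<forall>j. \<bar>f j x\<bar> \<le> 2 ^ j * F x))"
proof
  define G where "G x = (SUP j. ennreal (\<bar>f j x\<bar> / 2 ^ j))" for x
  \<comment> \<open>An infinite supremum becomes 0 here; the majorisation is therefore claimed only
    almost everywhere on \<open>m > 0\<close>, where the supremum is shown to be finite.\<close>
  define F where "F x = enn2real (G x)" for x
  have [measurable]: "G \<in> borel_measurable lebesgue" unfolding G_def by measurable
  show [measurable]: "F \<in> borel_measurable lebesgue" unfolding F_def by measurable
  show "0 \<le> F x" for x by (simp add: F_def)
  fix e :: real and m :: "'a \<Rightarrow> real" and K :: real
  assume e: "0 < e" and [measurable]: "m \<in> borel_measurable lebesgue" and m0: "\<And>x. 0 \<le> m x" and K: "0 \<le> K"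
    and bound: "\<And>j. (\<integral>\<^sup>+x. ennreal (\<bar>f j x\<bar> powr e * m x) \<partial>lebesgue) \<le> ennreal K"
  define s where "s x = (\<Sum>j. ennreal ((\<bar>f j x\<bar> / 2 ^ j) powr e))" for x
  have [measurable]: "s \<in> borel_measurable lebesgue"
  proof -
    have [measurable]: "(\<lambda>x. ennreal ((\<bar>f j x\<bar> / 2 ^ j) powr e)) \<in> borel_measurable lebesgue" for j
      by measurable
    show ?thesis
      unfolding s_def by (rule borel_measurable_suminf_order) fact
  qed
  have G: "G x \<le> epowr (s x) (1 / e)" for x
    unfolding G_def
  proof (rule SUP_least)
    fix j
    have "ennreal ((\<bar>f j x\<bar> / 2 ^ j) powr e) \<le> s x"
    proof -
      have "sum (\<lambda>j. ennreal ((\<bar>f j x\<bar> / 2 ^ j) powr e)) {j} \<le> s x"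
        unfolding s_def by (rule sum_le_suminf) auto
      then show ?thesis by simp
    qed
    then have "epowr (ennreal ((\<bar>f j x\<bar> / 2 ^ j) powr e)) (1 / e) \<le> epowr (s x) (1 / e)"
      using e by (intro epowr_mono) auto
    then show "ennreal (\<bar>f j x\<bar> / 2 ^ j) \<le> epowr (s x) (1 / e)"
      using e by (simp add: epowr_ennreal powr_powr)
  qed
  have Fs: "ennreal (F x powr e) \<le> s x" for x
  proof (cases "G x")
    case (real r)
    have "epowr (G x) e \<le> epowr (epowr (s x) (1 / e)) e" using e by (intro epowr_mono G) auto
    then show ?thesis using real e by (simp add: F_def epowr_ennreal epowr_epowr)
  qed (use e in \<open>simp add: F_def\<close>)
  have geom: "(\<lambda>j. (2 powr - e) ^ j) sums (1 / (1 - 2 powr - e))"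
    using e by (intro geometric_sums) (simp add: powr_minus_divide)
  have 1: "1 - 2 powr - e > 0" using e by (simp add: powr_minus_divide)
  have "(\<integral>\<^sup>+x. s x * ennreal (m x) \<partial>lebesgue)
      = (\<integral>\<^sup>+x. (\<Sum>j. ennreal ((2 powr - e) ^ j) * ennreal (\<bar>f j x\<bar> powr e * m x)) \<partial>lebesgue)"
  proof (intro nn_integral_cong)
    fix x
    have "(\<bar>f j x\<bar> / 2 ^ j) powr e = (2 powr - e) ^ j * \<bar>f j x\<bar> powr e" for j
    proof -
      have "(2 ^ j) powr e = (2 powr e :: real) ^ j"
        by (simp add: powr_realpow[symmetric] powr_powr mult.commute)
      moreover have "(\<bar>f j x\<bar> / 2 ^ j) powr e = \<bar>f j x\<bar> powr e / (2 ^ j) powr e"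
        by (rule powr_divide)
      ultimately show ?thesis by (simp add: powr_minus power_inverse divide_inverse)
    qed
    then show "s x * ennreal (m x) = (\<Sum>j. ennreal ((2 powr - e) ^ j) * ennreal (\<bar>f j x\<bar> powr e * m x))"
      unfolding s_def ennreal_suminf_multc[symmetric] using m0[of x]
      by (intro suminf_cong) (simp add: ennreal_mult[symmetric] mult.assoc)
  qed
  also have "\<dots> = (\<Sum>j. ennreal ((2 powr - e) ^ j) * (\<integral>\<^sup>+x. ennreal (\<bar>f j x\<bar> powr e * m x) \<partial>lebesgue))"
  proof -
    have [measurable]: "(\<lambda>x. ennreal (\<bar>f j x\<bar> powr e * m x)) \<in> borel_measurable lebesgue" for j by measurable
    have "(\<integral>\<^sup>+x. (\<Sum>j. ennreal ((2 powr - e) ^ j) * ennreal (\<bar>f j x\<bar> powr e * m x)) \<partial>lebesgue)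
        = (\<Sum>j. \<integral>\<^sup>+x. ennreal ((2 powr - e) ^ j) * ennreal (\<bar>f j x\<bar> powr e * m x) \<partial>lebesgue)"
      by (rule nn_integral_suminf) measurable
    also have "\<dots> = (\<Sum>j. ennreal ((2 powr - e) ^ j) * (\<integral>\<^sup>+x. ennreal (\<bar>f j x\<bar> powr e * m x) \<partial>lebesgue))"
      by (intro suminf_cong nn_integral_cmult) measurable
    finally show ?thesis .
  qed
  also have "\<dots> \<le> (\<Sum>j. ennreal ((2 powr - e) ^ j) * ennreal K)"
    by (intro suminf_le mult_left_mono bound) auto
  also have "\<dots> = (\<Sum>j. ennreal ((2 powr - e) ^ j * K))"
    using K by (simp add: ennreal_mult)
  also have "\<dots> = ennreal (K / (1 - 2 powr - e))"
    using sums_mult2[OF geom, of K] K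
    by (subst suminf_ennreal_eq[where x="K / (1 - 2 powr - e)"]) auto
  finally have S: "(\<integral>\<^sup>+x. s x * ennreal (m x) \<partial>lebesgue) \<le> ennreal (K / (1 - 2 powr - e))" .
  have "(\<integral>\<^sup>+x. ennreal (F x powr e * m x) \<partial>lebesgue) \<le> (\<integral>\<^sup>+x. s x * ennreal (m x) \<partial>lebesgue)"
    using m0 Fs by (intro nn_integral_mono) (simp add: ennreal_mult mult_right_mono)
  note this S
  moreover have "AE x in lebesgue. s x * ennreal (m x) \<noteq> \<infinity>"
  proof (rule nn_integral_PInf_AE)
    show "(\<integral>\<^sup>+x. s x * ennreal (m x) \<partial>lebesgue) \<noteq> \<infinity>" using S by (auto simp: top_unique)
  qed measurable
  then have "AE x in lebesgue. 0 < m x \<longrightarrow> (\<forall>j. \<bar>f j x\<bar> \<le> 2 ^ j * F x)"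
  proof eventually_elim
    case (elim x)
    show ?case
    proof (intro impI allI)
      fix j assume "0 < m x"
      with elim have "s x \<noteq> top" by (auto simp: ennreal_top_mult)
      then have "epowr (s x) (1 / e) < top" by (cases "s x") (auto simp: epowr_ennreal)
      with G[of x] have "G x < top" by (rule le_less_trans)
      moreover have "ennreal (\<bar>f j x\<bar> / 2 ^ j) \<le> G x" unfolding G_def by (rule SUP_upper) simp
      ultimately have "\<bar>f j x\<bar> / 2 ^ j \<le> F x" unfolding F_def by (metis enn2real_ennreal enn2real_mono abs_ge_zero zero_le_divide_iff zero_le_numeral zero_le_power)
      then show "\<bar>f j x\<bar> \<le> 2 ^ j * F x" by (simp add: field_simps)
    qed
  qed
  ultimately show "(\<integral>\<^sup>+x. ennreal (F x powr e * m x) \<partial>lebesgue) \<le> ennreal (K / (1 - 2 powr - e)) \<and>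
       (AE x in lebesgue. 0 < m x \<longrightarrow> (\<forall>j. \<bar>f j x\<bar> \<le> 2 ^ j * F x))"
    by auto
qed

text \<open>Carries bounds for finite families of cubes over to the maximal operator. The points
  where the limit is infinite, and \<open>enn2real\<close> falls back to 0, form a null set within
  \<open>m > 0\<close> as soon as the bound is finite.\<close>

lemma monotone_limit_bound:
  fixes \<phi> :: "nat \<Rightarrow> 'a::euclidean_space \<Rightarrow> real"
  assumes [measurable]: "\<And>n. \<phi> n \<in> borel_measurable lebesgue" "m \<in> borel_measurable lebesgue"
    and nn: "\<And>n x. 0 \<le> \<phi> n x" "\<And>x. 0 \<le> m x" and inc: "\<And>n x. \<phi> n x \<le> \<phi> (Suc n) x" and e: "0 < e"
    and bound: "\<And>n. (\<integral>\<^sup>+x. ennreal (\<phi> n x powr e * m x) \<partial>lebesgue) \<le> B"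
  shows "(\<integral>\<^sup>+x. ennreal (enn2real (SUP n. ennreal (\<phi> n x)) powr e * m x) \<partial>lebesgue) \<le> B"
    and "B < \<infinity> \<Longrightarrow> AE x in lebesgue. 0 < m x \<longrightarrow> (SUP n. ennreal (\<phi> n x)) < \<infinity>"
proof -
  define s where "s x = (SUP n. ennreal (\<phi> n x powr e * m x))" for x
  have [measurable]: "s \<in> borel_measurable lebesgue" unfolding s_def by measurable
  have "(\<integral>\<^sup>+x. s x \<partial>lebesgue) = (SUP n. \<integral>\<^sup>+x. ennreal (\<phi> n x powr e * m x) \<partial>lebesgue)"
    unfolding s_def using nn inc e
    by (intro nn_integral_monotone_convergence_SUP incseq_SucI le_funI ennreal_leI mult_right_mono powr_mono2) auto
  also have "\<dots> \<le> B" by (intro SUP_least bound)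
  finally have S: "(\<integral>\<^sup>+x. s x \<partial>lebesgue) \<le> B" .
  have key: "epowr (SUP n. ennreal (\<phi> n x)) e * ennreal (m x) \<le> s x" if mx: "0 < m x" for x
  proof -
    have "ennreal (\<phi> n x) \<le> epowr (s x / ennreal (m x)) (1 / e)" for n
    proof -
      have "ennreal (\<phi> n x powr e * m x) \<le> s x" unfolding s_def by (rule SUP_upper) simp
      then have "ennreal (\<phi> n x powr e * m x) / ennreal (m x) \<le> s x / ennreal (m x)" by (rule divide_right_mono_ennreal)
      then have "epowr (ennreal (\<phi> n x)) e \<le> s x / ennreal (m x)"
        using mx nn by (simp add: divide_ennreal epowr_ennreal)
      then show ?thesis using epowr_le_iff[OF e] by blast
    qed
    then have "(SUP n. ennreal (\<phi> n x)) \<le> epowr (s x / ennreal (m x)) (1 / e)" by (intro SUP_least)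
    then have "epowr (SUP n. ennreal (\<phi> n x)) e \<le> s x / ennreal (m x)" using epowr_le_iff[OF e] by blast
    then have "epowr (SUP n. ennreal (\<phi> n x)) e * ennreal (m x) \<le> s x / ennreal (m x) * ennreal (m x)"
      by (rule mult_right_mono) simp
    also have "\<dots> = s x" using mx by (simp add: ennreal_divide_times ennreal_mult_divide_eq)
    finally show ?thesis .
  qed
  have "ennreal (enn2real (SUP n. ennreal (\<phi> n x)) powr e * m x) \<le> s x" for x
  proof (cases "0 < m x")
    case True
    show ?thesis
    proof (cases "SUP n. ennreal (\<phi> n x)")
      case (real r)
      then show ?thesis using key[OF True] nn e by (simp add: epowr_ennreal ennreal_mult)
    next
      case top
      show ?thesis unfolding top by simp
    qed
  next
    case False
    then have "m x = 0" using nn(2)[of x] by simp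
    then show ?thesis by simp
  qed
  then show "(\<integral>\<^sup>+x. ennreal (enn2real (SUP n. ennreal (\<phi> n x)) powr e * m x) \<partial>lebesgue) \<le> B"
    by (intro order_trans[OF nn_integral_mono S])
  assume B: "B < \<infinity>"
  have "AE x in lebesgue. s x \<noteq> \<infinity>"
  proof (rule nn_integral_PInf_AE)
    show "(\<integral>\<^sup>+x. s x \<partial>lebesgue) \<noteq> \<infinity>" using S B by (auto simp: top_unique)
  qed measurable
  then show "AE x in lebesgue. 0 < m x \<longrightarrow> (SUP n. ennreal (\<phi> n x)) < \<infinity>"
  proof eventually_elim
    case (elim x)
    show ?case
    proof (intro impI)
      assume mx: "0 < m x"
      show "(SUP n. ennreal (\<phi> n x)) < \<infinity>"
      proof (rule ccontr)
        assume "\<not> (SUP n. ennreal (\<phi> n x)) < \<infinity>"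
        then have "(SUP n. ennreal (\<phi> n x)) = top" by (metis infinity_ennreal_def less_top)
        then have "top \<le> s x" using key[OF mx] mx by (simp only: epowr_top) (simp add: ennreal_top_mult)
        then have "s x = top" by (simp add: top_unique)
        then show False using elim by simp
      qed
    qed
  qed
qed

section \<open>The maximal operator as a limit\<close>

text \<open>Every cube is enclosed in one of countably many, at the price of a factor arbitrarily
  close to 1 in volume. Enclosing, rather than merely approximating, keeps every point of the cube
  and does not decrease the integral of a nonnegative function.\<close>

lemma rational_cubes:
  obtains R :: "nat \<Rightarrow> 'a::euclidean_space \<times> real" where "\<And>n. 0 < snd (R n)"
    "\<And>Q \<epsilon>. 0 < snd Q \<Longrightarrow> 0 < \<epsilon> \<Longrightarrow> \<exists>n. cube Q \<subseteq> cube (R n) \<and> vol (R n) \<le> (1 + \<epsilon>) * vol Q"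
proof -
  define T :: "('a \<times> real) set" where
    "T = (\<lambda>(f, s). (\<Sum>i\<in>Basis. f i *\<^sub>R i, s)) ` ((Basis \<rightarrow>\<^sub>E \<rat>) \<times> {s \<in> \<rat>. 0 < s})"
  have "countable ((Basis \<rightarrow>\<^sub>E \<rat>) :: ('a \<Rightarrow> real) set)" by (intro countable_PiE) (auto simp: countable_rat)
  moreover have "countable {s \<in> \<rat>. (0::real) < s}" by (rule countable_subset[OF _ countable_rat]) auto
  ultimately have cT: "countable T" unfolding T_def by (intro countable_image countable_SIGMA)
  have dense: "\<exists>P\<in>T. cube Q \<subseteq> cube P \<and> vol P \<le> (1 + \<epsilon>) * vol Q" if Q: "0 < snd Q" and \<epsilon>: "0 < \<epsilon>" for Q \<epsilon>
  proof -
    define l where "l = snd Q"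
    have l: "0 < l" "l ^ DIM('a) < (1 + \<epsilon>) * l ^ DIM('a)" using Q \<epsilon> by (auto simp: l_def)
    have "((\<lambda>d. (l + 2 * d) ^ DIM('a)) \<longlongrightarrow> (l + 2 * 0) ^ DIM('a)) (at_right 0)"
      by (intro tendsto_intros)
    then have "eventually (\<lambda>d. (l + 2 * d) ^ DIM('a) < (1 + \<epsilon>) * l ^ DIM('a)) (at_right 0)"
      using l by (intro order_tendstoD(2)) auto
    then obtain d where d: "0 < d" "(l + 2 * d) ^ DIM('a) < (1 + \<epsilon>) * l ^ DIM('a)"
      unfolding eventually_at_right_field by (metis field_lbound_gt_zero zero_less_one dense)
    obtain s where s: "s \<in> \<rat>" "l + d < s" "s < l + 2 * d"
      using Rats_dense_in_real[of "l + d" "l + 2 * d"] d by auto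
    have "\<exists>y. y \<in> \<rat> \<and> fst Q \<bullet> i - d < y \<and> y < fst Q \<bullet> i" for i
      using Rats_dense_in_real[of "fst Q \<bullet> i - d" "fst Q \<bullet> i"] d by auto
    then obtain y where y: "\<And>i. y i \<in> \<rat>" "\<And>i. fst Q \<bullet> i - d < y i" "\<And>i. y i < fst Q \<bullet> i" by metis
    define P where "P = (\<Sum>i\<in>Basis. restrict y Basis i *\<^sub>R i, s)"
    have "P \<in> T" unfolding T_def P_def
    proof (rule image_eqI[of _ _ "(restrict y Basis, s)"])
      show "(restrict y Basis, s) \<in> (Basis \<rightarrow>\<^sub>E \<rat>) \<times> {s \<in> \<rat>. 0 < s}" using y s l d by auto
    qed simp
    moreover have P: "fst P \<bullet> i = y i" if "i \<in> Basis" for i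
      using that by (simp add: P_def inner_sum_left inner_Basis if_distrib cong: if_cong)
    have "cube Q \<subseteq> cube P"
    proof
      fix x assume x: "x \<in> cube Q"
      show "x \<in> cube P" unfolding mem_cube
      proof
        fix i :: 'a assume i: "i \<in> Basis"
        show "fst P \<bullet> i \<le> x \<bullet> i \<and> x \<bullet> i \<le> fst P \<bullet> i + snd P"
          using bspec[OF x[unfolded mem_cube] i] y(2)[of i] y(3)[of i] s
          by (simp add: P[OF i]) (simp add: P_def l_def)
      qed
    qed
    moreover have "vol P \<le> (l + 2 * d) ^ DIM('a)"
      unfolding vol_def P_def using s l d by (intro power_mono) auto
    then have "vol P \<le> (1 + \<epsilon>) * vol Q" using d(2) by (simp add: vol_def l_def)
    ultimately show ?thesis by blast
  qed
  from dense[of "(0, 1)" 1] have "T \<noteq> {}" by auto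
  with cT obtain R :: "nat \<Rightarrow> 'a \<times> real" where R: "range R = T" by (metis uncountable_def)
  show thesis
  proof
    show "0 < snd (R n)" for n
    proof -
      have "R n \<in> T" using R by auto
      then show ?thesis by (auto simp: T_def)
    qed
    show "\<exists>n. cube Q \<subseteq> cube (R n) \<and> vol (R n) \<le> (1 + \<epsilon>) * vol Q" if "0 < snd Q" "0 < \<epsilon>" for Q \<epsilon>
      using dense[OF that] R by (metis rangeE)
  qed
qed

definition avg :: "('a::euclidean_space \<Rightarrow> real) \<Rightarrow> 'a \<times> real \<Rightarrow> real" where
  "avg f Q = mass (\<lambda>x. \<bar>f x\<bar>) Q / vol Q"

text \<open>\<open>F n\<close> consists of the first \<open>n\<close> rational cubes and does not
  depend on the function. A sequence gives measurability of the supremum, its growth gives monotone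
  convergence; local integrability makes \<open>avg\<close> the true average.\<close>

lemma maximal_as_limit:
  obtains F :: "nat \<Rightarrow> ('a::euclidean_space \<times> real) set" where
    "\<And>n. finite (F n)" "\<And>n Q. Q \<in> F n \<Longrightarrow> 0 < snd Q" "\<And>n. F n \<subseteq> F (Suc n)"
    "\<And>f x. (\<And>Q. 0 < snd Q \<Longrightarrow> nint (\<lambda>x. \<bar>f x\<bar>) Q < \<infinity>) \<Longrightarrow> maximal f x = (SUP n. ennreal (fmax (F n) (avg f) x))"
proof -
  obtain R :: "nat \<Rightarrow> 'a \<times> real" where R: "\<And>n. 0 < snd (R n)"
    "\<And>Q \<epsilon>. 0 < snd Q \<Longrightarrow> 0 < \<epsilon> \<Longrightarrow> \<exists>n. cube Q \<subseteq> cube (R n) \<and> vol (R n) \<le> (1 + \<epsilon>) * vol Q"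
    using rational_cubes[where 'a='a] by metis
  define F where "F n = R ` {..<n}" for n
  have F: "finite (F n)" "\<And>Q. Q \<in> F n \<Longrightarrow> 0 < snd Q" "F n \<subseteq> F (Suc n)" for n
    using R(1) by (auto simp: F_def)
  have "maximal f x = (SUP n. ennreal (fmax (F n) (avg f) x))"
    if fin: "\<And>Q. 0 < snd Q \<Longrightarrow> nint (\<lambda>x. \<bar>f x\<bar>) Q < \<infinity>" for f :: "'a \<Rightarrow> real" and x
  proof (rule antisym)
    have avg: "nint (\<lambda>x. \<bar>f x\<bar>) Q / emeasure lebesgue (cube Q) = ennreal (avg f Q)" if "0 < snd Q" for Q
      using fin[OF that] vol_pos[OF that] emeasure_cube[OF that]
      by (simp add: nint_mass avg_def divide_ennreal)
    have mx: "maximal f x = (SUP Q\<in>{Q. 0 < snd Q \<and> x \<in> cube Q}. ennreal (avg f Q))"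
    proof -
      have "{Q \<in> cubes. x \<in> Q} = cube ` {Q. 0 < snd Q \<and> x \<in> cube Q}" by (auto simp: cubes_eq)
      then have "maximal f x = (SUP Q\<in>{Q. 0 < snd Q \<and> x \<in> cube Q}. nint (\<lambda>x. \<bar>f x\<bar>) Q / emeasure lebesgue (cube Q))"
        by (simp add: maximal_def nint_def image_image)
      also have "\<dots> = (SUP Q\<in>{Q. 0 < snd Q \<and> x \<in> cube Q}. ennreal (avg f Q))"
        using avg by (intro SUP_cong) auto
      finally show ?thesis .
    qed
    show "(SUP n. ennreal (fmax (F n) (avg f) x)) \<le> maximal f x"
    proof (intro SUP_least)
      fix n
      show "ennreal (fmax (F n) (avg f) x) \<le> maximal f x"
      proof (cases rule: fmax_cases[OF F(1), of n "avg f" x])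
        case (2 Q)
        then show ?thesis unfolding mx using F(2)[OF 2(1)] by (auto intro!: SUP_upper)
      qed simp
    qed
    let ?S = "SUP n. ennreal (fmax (F n) (avg f) x)"
    show "maximal f x \<le> ?S"
      unfolding mx
    proof (rule SUP_least)
      fix Q assume "Q \<in> {Q. 0 < snd Q \<and> x \<in> cube Q}"
      then have Q: "0 < snd Q" "x \<in> cube Q" by auto
      show "ennreal (avg f Q) \<le> ?S"
      proof (cases ?S)
        case (real r)
        have "avg f Q \<le> (1 + e) * r" if e: "0 < e" for e
        proof -
          obtain n where n: "cube Q \<subseteq> cube (R n)" "vol (R n) \<le> (1 + e) * vol Q" using R(2)[OF Q(1) e] by blast
          have "mass (\<lambda>x. \<bar>f x\<bar>) Q \<le> mass (\<lambda>x. \<bar>f x\<bar>) (R n)"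
            using nint_mono_cube[OF n(1), of "\<lambda>x. \<bar>f x\<bar>"] fin[OF Q(1)] fin[OF R(1)] by (simp add: nint_mass)
          also have "\<dots> = avg f (R n) * vol (R n)" using vol_pos[OF R(1)[of n]] by (simp add: avg_def)
          also have "\<dots> \<le> r * ((1 + e) * vol Q)"
          proof (intro mult_mono n)
            have "avg f (R n) \<le> fmax (F (Suc n)) (avg f) x"
              using n(1) Q(2) by (intro fmax_ge F) (auto simp: F_def)
            moreover have "ennreal (fmax (F (Suc n)) (avg f) x) \<le> ennreal r"
              unfolding real(2)[symmetric] by (rule SUP_upper) simp
            ultimately show "avg f (R n) \<le> r" using real(1) by simp
          qed (use real vol_pos[OF R(1)[of n]] in auto)
          finally show ?thesis using vol_pos[OF Q(1)] by (simp add: avg_def field_simps)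
        qed
        then have *: "avg f Q \<le> (1 + e) * r" if "0 < e" for e using that .
        have "((\<lambda>e. (1 + e) * r) \<longlongrightarrow> (1 + 0) * r) (at_right 0)" by (intro tendsto_intros)
        then have "avg f Q \<le> (1 + 0) * r"
          by (rule tendsto_lowerbound) (auto simp: eventually_at_right_field intro!: exI[of _ 1] *)
        then show ?thesis using real by (simp add: ennreal_leI)
      next
        case top
        show ?thesis unfolding top by simp
      qed
    qed
  qed
  with F show thesis by (intro that) auto
qed

section \<open>Morrey spaces as function spaces\<close>

lemma AE_cubes:
  assumes "\<And>Q :: 'a::euclidean_space \<times> real. 0 < snd Q \<Longrightarrow> AE x in lebesgue. x \<in> cube Q \<longrightarrow> P x"
  shows "AE x in lebesgue. P x"
proof -
  define R :: "nat \<Rightarrow> 'a \<times> real" where "R n = (- (real n + 1) *\<^sub>R One, 2 * (real n + 1))" for n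
  have "AE x in lebesgue. \<forall>n. x \<in> cube (R n) \<longrightarrow> P x"
    unfolding AE_all_countable by (intro allI assms) (simp add: R_def)
  then show ?thesis
  proof eventually_elim
    case (elim x)
    obtain n :: nat where n: "norm x < real n" using reals_Archimedean2 by blast
    have "x \<in> cube (R n)"
      unfolding mem_cube
    proof
      fix i :: 'a assume i: "i \<in> Basis"
      have "\<bar>x \<bullet> i\<bar> \<le> norm x" using i by (rule Basis_le_norm)
      then have "- real n \<le> x \<bullet> i" "x \<bullet> i \<le> real n" using n by linarith+
      then show "fst (R n) \<bullet> i \<le> x \<bullet> i \<and> x \<bullet> i \<le> fst (R n) \<bullet> i + snd (R n)"
        using n i by (simp add: R_def)
    qed
    then show ?case using elim by blast
  qed
qed

lemma nint_eq_0D: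
  assumes [measurable]: "m \<in> borel_measurable lebesgue" and "nint m Q = 0"
  shows "AE x in lebesgue. x \<in> cube Q \<longrightarrow> m x \<le> 0"
proof -
  have "AE x in lebesgue. ennreal (m x) * indicator (cube Q) x = 0"
    using assms(2) unfolding nint_def by (subst (asm) nn_integral_0_iff_AE) auto
  then show ?thesis by eventually_elim (auto simp: indicator_def ennreal_eq_0_iff split: if_splits)
qed

lemma morrey_norm_scale_le:
  fixes f v :: "'a::euclidean_space \<Rightarrow> real"
  assumes pq: "0 < p" "0 < q" and [measurable]: "f \<in> borel_measurable lebesgue" "v \<in> borel_measurable lebesgue"
    and c: "0 < c" and fin: "morrey_norm p q v f < \<infinity>"
  shows "morrey_norm p q v (\<lambda>x. c * f x) \<le> ennreal c * morrey_norm p q v f"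
proof -
  obtain N where N: "morrey_norm p q v f = ennreal N" "0 \<le> N"
    using fin by (metis ennreal_cases infinity_ennreal_def less_irrefl)
  have "morrey_norm p q v (\<lambda>x. c * f x) \<le> ennreal (c * N)"
  proof (subst morrey_norm_le_iff[OF pq], use c N in simp, intro allI impI)
    fix Q :: "'a \<times> real" assume Q: "0 < snd Q"
    have "nint (\<lambda>x. \<bar>c * f x * v x\<bar> powr p) Q
       = (\<integral>\<^sup>+x. ennreal (c powr p) * (ennreal (\<bar>f x * v x\<bar> powr p) * indicator (cube Q) x) \<partial>lebesgue)"
      unfolding nint_def using c
      by (intro nn_integral_cong) (simp add: abs_mult powr_mult ennreal_mult mult.assoc)
    also have "\<dots> = ennreal (c powr p) * nint (\<lambda>x. \<bar>f x * v x\<bar> powr p) Q"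
      unfolding nint_def by (rule nn_integral_cmult) measurable
    also have "\<dots> \<le> ennreal (c powr p) * ennreal ((N * vol Q powr (1 / p - 1 / q)) powr p)"
      using morrey_normD[OF pq fin Q] N by (intro mult_left_mono) auto
    also have "\<dots> = ennreal ((c * N * vol Q powr (1 / p - 1 / q)) powr p)"
      using c N by (simp add: ennreal_mult[symmetric] powr_mult[symmetric] mult.assoc)
    finally show "nint (\<lambda>x. \<bar>c * f x * v x\<bar> powr p) Q \<le> ennreal ((c * N * vol Q powr (1 / p - 1 / q)) powr p)" .
  qed
  then show ?thesis using c N by (simp add: ennreal_mult)
qed

lemma morrey_homogeneous:
  fixes v :: "'a::euclidean_space \<Rightarrow> real"
  assumes pq: "0 < p" "0 < q" and v[measurable]: "v \<in> borel_measurable lebesgue" and v0: "AE x in lebesgue. v x \<noteq> 0"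
  shows "homogeneous (morrey p q v)"
  unfolding homogeneous_def
proof (intro conjI ballI allI impI)
  show "elems (morrey p q v) \<subseteq> L0" by (auto simp: morrey_def)
  fix f assume f: "f \<in> elems (morrey p q v)"
  then have [measurable]: "f \<in> borel_measurable lebesgue" and fin: "morrey_norm p q v f < \<infinity>"
    by (auto simp: morrey_def L0_def)
  show "qnorm (morrey p q v) f < \<infinity>" using fin by (simp add: morrey_def)
  show "AE x in lebesgue. f x = 0" if "qnorm (morrey p q v) f = 0"
  proof -
    have "morrey_norm p q v f = 0" using that by (simp add: morrey_def)
    then have *: "nint (\<lambda>x. \<bar>f x * v x\<bar> powr p) Q = 0" if "0 < snd Q" for Q
      using morrey_normD[OF pq fin that] pq by simp
    have "AE x in lebesgue. \<bar>f x * v x\<bar> powr p \<le> 0"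
      by (rule AE_cubes, rule nint_eq_0D) (auto simp: *)
    then show ?thesis using v0 by eventually_elim auto
  qed
  fix c :: real assume c: "0 < c"
  have le: "morrey_norm p q v (\<lambda>x. c * f x) \<le> ennreal c * morrey_norm p q v f"
    by (rule morrey_norm_scale_le[OF pq _ _ c fin]) measurable
  then have cfin: "morrey_norm p q v (\<lambda>x. c * f x) < \<infinity>"
    using fin by (auto simp: ennreal_mult_less_top intro: le_less_trans)
  then show "(\<lambda>x. c * f x) \<in> elems (morrey p q v)" by (auto simp: morrey_def L0_def)
  have "morrey_norm p q v (\<lambda>x. 1 / c * (c * f x)) \<le> ennreal (1 / c) * morrey_norm p q v (\<lambda>x. c * f x)"
    using c by (intro morrey_norm_scale_le[OF pq _ _ _ cfin]) auto
  then have "ennreal c * morrey_norm p q v f \<le> ennreal c * (ennreal (1 / c) * morrey_norm p q v (\<lambda>x. c * f x))"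
    using c by (intro mult_left_mono) auto
  also have "\<dots> = morrey_norm p q v (\<lambda>x. c * f x)"
    using c by (simp add: mult.assoc[symmetric] ennreal_mult[symmetric])
  finally show "qnorm (morrey p q v) (\<lambda>x. c * f x) = ennreal c * qnorm (morrey p q v) f"
    using le by (simp add: morrey_def)
qed

text \<open>The function of \<open>dominating_function\<close> is tested with \<open>e = p\<close>
  and \<open>m = |v| powr p\<close> on each cube. The bound worsens only by the factor
  \<open>1 / (1 - 2 powr - p)\<close>, which is the same for all cubes.\<close>

lemma morrey_dominated:
  fixes v :: "'a::euclidean_space \<Rightarrow> real"
  assumes pq: "0 < p" "0 < q" and v[measurable]: "v \<in> borel_measurable lebesgue" and v0: "AE x in lebesgue. v x \<noteq> 0"
  shows "dominated (morrey p q v)"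
  unfolding dominated_def
proof (intro conjI allI impI)
  show "elems (morrey p q v) \<subseteq> L0" by (auto simp: morrey_def)
  fix f :: "nat \<Rightarrow> 'a \<Rightarrow> real"
  assume f: "\<forall>j. f j \<in> elems (morrey p q v) \<and> qnorm (morrey p q v) (f j) = 1"
  then have [measurable]: "f j \<in> borel_measurable lebesgue" and f1: "morrey_norm p q v (f j) = 1" for j
    by (auto simp: morrey_def L0_def)
  show "\<exists>F\<in>elems (morrey p q v). \<forall>j. AE x in lebesgue. \<bar>f j x\<bar> \<le> 2 ^ j * \<bar>F x\<bar>"
  proof (rule dominating_function[of f, OF \<open>\<And>j. f j \<in> borel_measurable lebesgue\<close>])
    fix F assume F: "F \<in> borel_measurable lebesgue" "\<And>x. 0 \<le> F x"
    "\<And>e m K. 0 < e \<Longrightarrow> m \<in> borel_measurable lebesgue \<Longrightarrow> (\<And>x. 0 \<le> m x) \<Longrightarrow> 0 \<le> K \<Longrightarrow>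
       (\<And>j. (\<integral>\<^sup>+x. ennreal (\<bar>f j x\<bar> powr e * m x) \<partial>lebesgue) \<le> ennreal K) \<Longrightarrow>
       (\<integral>\<^sup>+x. ennreal (F x powr e * m x) \<partial>lebesgue) \<le> ennreal (K / (1 - 2 powr - e)) \<and>
       (AE x in lebesgue. 0 < m x \<longrightarrow> (\<forall>j. \<bar>f j x\<bar> \<le> 2 ^ j * F x))"
  have eq: "ennreal (\<bar>g x\<bar> powr p * (\<bar>v x\<bar> powr p * indicator (cube Q) x)) = ennreal (\<bar>g x * v x\<bar> powr p) * indicator (cube Q) x"
    for g :: "'a \<Rightarrow> real" and Q x
    by (auto simp: indicator_def abs_mult powr_mult)
  have main: "nint (\<lambda>x. \<bar>F x * v x\<bar> powr p) Q \<le> ennreal ((vol Q powr (1 / p - 1 / q)) powr p / (1 - 2 powr - p)) \<and>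
     (AE x in lebesgue. x \<in> cube Q \<longrightarrow> (\<forall>j. \<bar>f j x\<bar> \<le> 2 ^ j * F x))" if Q: "0 < snd Q" for Q
  proof -
    have "(\<integral>\<^sup>+x. ennreal (F x powr p * (\<bar>v x\<bar> powr p * indicator (cube Q) x)) \<partial>lebesgue) \<le> ennreal ((vol Q powr (1 / p - 1 / q)) powr p / (1 - 2 powr - p)) \<and>
       (AE x in lebesgue. 0 < \<bar>v x\<bar> powr p * indicator (cube Q) x \<longrightarrow> (\<forall>j. \<bar>f j x\<bar> \<le> 2 ^ j * F x))"
    proof (rule F(3)[OF pq(1)])
      fix j
      have "(\<integral>\<^sup>+x. ennreal (\<bar>f j x\<bar> powr p * (\<bar>v x\<bar> powr p * indicator (cube Q) x)) \<partial>lebesgue) = nint (\<lambda>x. \<bar>f j x * v x\<bar> powr p) Q"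
        by (simp only: eq nint_def)
      also have "\<dots> \<le> ennreal ((vol Q powr (1 / p - 1 / q)) powr p)"
        using morrey_normD[OF pq _ Q, of v "f j"] f1[of j] by simp
      finally show "(\<integral>\<^sup>+x. ennreal (\<bar>f j x\<bar> powr p * (\<bar>v x\<bar> powr p * indicator (cube Q) x)) \<partial>lebesgue)
        \<le> ennreal ((vol Q powr (1 / p - 1 / q)) powr p)" .
    qed auto
    moreover have "(\<integral>\<^sup>+x. ennreal (F x powr p * (\<bar>v x\<bar> powr p * indicator (cube Q) x)) \<partial>lebesgue) = nint (\<lambda>x. \<bar>F x * v x\<bar> powr p) Q"
      using eq[of F] F(2) by (simp add: nint_def)
    ultimately have 1: "nint (\<lambda>x. \<bar>F x * v x\<bar> powr p) Q \<le> ennreal ((vol Q powr (1 / p - 1 / q)) powr p / (1 - 2 powr - p))"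
      and 2: "AE x in lebesgue. 0 < \<bar>v x\<bar> powr p * indicator (cube Q) x \<longrightarrow> (\<forall>j. \<bar>f j x\<bar> \<le> 2 ^ j * F x)"
      by auto
    from 2 v0 have "AE x in lebesgue. x \<in> cube Q \<longrightarrow> (\<forall>j. \<bar>f j x\<bar> \<le> 2 ^ j * F x)"
      by eventually_elim auto
    with 1 show ?thesis by blast
  qed
  define C where "C = (1 / (1 - 2 powr - p)) powr (1 / p)"
  have p1: "1 - 2 powr - p > 0" using pq by (simp add: powr_minus_divide)
  have "morrey_norm p q v F \<le> ennreal C"
  proof (subst morrey_norm_le_iff[OF pq], simp add: C_def, intro allI impI)
    fix Q :: "'a \<times> real" assume Q: "0 < snd Q"
    have "(C * vol Q powr (1 / p - 1 / q)) powr p = (vol Q powr (1 / p - 1 / q)) powr p / (1 - 2 powr - p)"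
      unfolding powr_mult using pq p1 by (simp add: C_def powr_powr)
    then show "nint (\<lambda>x. \<bar>F x * v x\<bar> powr p) Q \<le> ennreal ((C * vol Q powr (1 / p - 1 / q)) powr p)"
      using main[OF Q] by simp
  qed
  then have "F \<in> elems (morrey p q v)"
    using F(1) by (auto simp: morrey_def L0_def intro: le_less_trans)
  moreover have "AE x in lebesgue. \<forall>j. \<bar>f j x\<bar> \<le> 2 ^ j * F x"
  proof (rule AE_cubes)
    fix Q :: "'a \<times> real" assume "0 < snd Q"
    from main[OF this] show "AE x in lebesgue. x \<in> cube Q \<longrightarrow> (\<forall>j. \<bar>f j x\<bar> \<le> 2 ^ j * F x)" ..
  qed
  then have "AE x in lebesgue. \<bar>f j x\<bar> \<le> 2 ^ j * \<bar>F x\<bar>" for j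
    using F(2) by (auto elim!: eventually_mono)
  ultimately show "\<exists>F\<in>elems (morrey p q v). \<forall>j. AE x in lebesgue. \<bar>f j x\<bar> \<le> 2 ^ j * \<bar>F x\<bar>" by (intro bexI allI)
  qed
qed

text \<open>Hoelder with exponents \<open>b / a\<close> and \<open>b / (b - a)\<close> against the
  constant 1. It converts a bound in the outer exponent of a Morrey norm into one in the inner
  exponent.\<close>

lemma nint_powr_le:
  fixes h :: "'a::euclidean_space \<Rightarrow> real"
  assumes ab: "1 < a" "a \<le> b" and [measurable]: "h \<in> borel_measurable lebesgue" and h: "\<And>x. 0 \<le> h x"
    and B: "0 \<le> B" and Q: "0 < snd Q" and le: "nint (\<lambda>x. h x powr b) Q \<le> ennreal (B powr b)"
  shows "nint (\<lambda>x. h x powr a) Q \<le> ennreal ((B * vol Q powr (1 / a - 1 / b)) powr a)"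
proof (cases "a = b")
  case True
  then show ?thesis using le vol_pos[OF Q] by simp
next
  case False
  then have ab': "a < b" using ab by simp
  have v: "0 < vol Q" by (rule vol_pos[OF Q])
  have "nint (\<lambda>x. h x powr a * 1) Q \<le> ennreal (B powr a * vol Q powr (1 - a / b))"
  proof (rule holder_cube[of "b / a" "b / (b - a)"])
    show "1 / (b / a) + 1 / (b / (b - a)) = 1" "1 < b / a" using ab ab' by (auto simp: field_simps)
    show "nint (\<lambda>x. (h x powr a) powr (b / a)) Q \<le> ennreal ((B powr a) powr (b / a))"
      using le ab by (simp add: powr_powr)
    have "(vol Q powr (1 - a / b)) powr (b / (b - a)) = vol Q"
      using ab ab' v by (simp add: powr_powr field_simps)
    then show "nint (\<lambda>x. 1 powr (b / (b - a))) Q \<le> ennreal ((vol Q powr (1 - a / b)) powr (b / (b - a)))"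
      using emeasure_cube[OF Q] by (simp add: nint_def)
  qed auto
  moreover have "(1 / a - 1 / b) * a = 1 - a / b" using ab by (simp add: field_simps)
  then have "(B * vol Q powr (1 / a - 1 / b)) powr a = B powr a * vol Q powr (1 - a / b)"
    by (simp add: powr_mult powr_powr)
  ultimately show ?thesis by simp
qed

section \<open>Linearisation of finite maximal functions; iterated dilates\<close>

lemma sum_disjoint_cases:
  fixes g :: "'i \<Rightarrow> 'b::semiring_1"
  assumes "finite G" "disjoint_family_on E G"
  obtains "(\<Sum>R\<in>G. g R * indicator (E R) x) = 0" | R where "R \<in> G" "x \<in> E R" "(\<Sum>R\<in>G. g R * indicator (E R) x) = g R"
proof (cases "\<exists>R\<in>G. x \<in> E R")
  case True
  then obtain R where R: "R \<in> G" "x \<in> E R" by blast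
  have "(\<Sum>R\<in>G. g R * indicator (E R) x) = (\<Sum>R\<in>{R}. g R * indicator (E R) x)"
    using R assms(2)[unfolded disjoint_family_on_def] by (intro sum.mono_neutral_right[OF assms(1)]) (auto simp: indicator_def)
  then show ?thesis using R that(2) by simp
next
  case False
  then show ?thesis by (intro that(1)) (simp add: indicator_def)
qed

text \<open>Each point where the maximum is positive is assigned to one cube attaining it. A newly
  added cube takes the points where its coefficient strictly exceeds the previous maximum; ties stay
  with the earlier cube, which keeps the sets disjoint.\<close>

lemma fmax_linearize:
  assumes "finite F" "\<And>R. R \<in> F \<Longrightarrow> 0 \<le> c R"
  obtains E where "\<And>R. R \<in> F \<Longrightarrow> E R \<in> sets lebesgue" "\<And>R. R \<in> F \<Longrightarrow> E R \<subseteq> cube R"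
    "disjoint_family_on E F" "\<And>x. fmax F c x = (\<Sum>R\<in>F. c R * indicator (E R) x)"
proof -
  have "\<exists>E. (\<forall>R\<in>F. E R \<in> sets lebesgue) \<and> (\<forall>R\<in>F. E R \<subseteq> cube R) \<and>
    (\<forall>R\<in>F. \<forall>S\<in>F. R \<noteq> S \<longrightarrow> E R \<inter> E S = {}) \<and> (\<forall>x. fmax F c x = (\<Sum>R\<in>F. c R * indicator (E R) x))"
    using assms
  proof (induction F)
    case (insert Q F)
    then obtain E where E: "\<forall>R\<in>F. E R \<in> sets lebesgue" "\<forall>R\<in>F. E R \<subseteq> cube R"
      "\<forall>R\<in>F. \<forall>S\<in>F. R \<noteq> S \<longrightarrow> E R \<inter> E S = {}" "\<forall>x. fmax F c x = (\<Sum>R\<in>F. c R * indicator (E R) x)"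
      by auto
    define A where "A = {x \<in> cube Q. fmax F c x < c Q}"
    have [measurable]: "fmax F c \<in> borel_measurable lebesgue" by (rule fmax_measurable[OF insert.hyps(1)])
    have A: "A \<in> sets lebesgue"
    proof -
      have "A = cube Q \<inter> {x \<in> space lebesgue. fmax F c x < c Q}" by (auto simp: A_def)
      also have "\<dots> \<in> sets lebesgue" by measurable
      finally show ?thesis .
    qed
    define E' where "E' R = (if R = Q then A else E R - A)" for R
    have "fmax (insert Q F) c x = (\<Sum>R\<in>insert Q F. c R * indicator (E' R) x)" for x
    proof -
      have "(\<Sum>R\<in>F. c R * indicator (E' R) x) = (\<Sum>R\<in>F. c R * indicator (E R - A) x)"
        using insert.hyps by (intro sum.cong) (auto simp: E'_def)
      then have "(\<Sum>R\<in>insert Q F. c R * indicator (E' R) x) = c Q * indicator A x + (\<Sum>R\<in>F. c R * indicator (E R - A) x)"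
        by (subst sum.insert[OF insert.hyps]) (simp add: E'_def)
      also have "\<dots> = (if x \<in> A then c Q else fmax F c x)"
        using E(4) by (auto simp: indicator_def)
      also have "\<dots> = fmax (insert Q F) c x"
        by (auto simp: fmax_insert[OF insert.hyps(1)] A_def)
      finally show ?thesis by simp
    qed
    moreover have "\<forall>R\<in>insert Q F. E' R \<in> sets lebesgue" using E(1) A by (auto simp: E'_def)
    moreover have "\<forall>R\<in>insert Q F. E' R \<subseteq> cube R" using E(2) by (auto simp: E'_def A_def)
    moreover have "\<forall>R\<in>insert Q F. \<forall>S\<in>insert Q F. R \<noteq> S \<longrightarrow> E' R \<inter> E' S = {}"
    proof (intro ballI impI)
      fix R S assume *: "R \<in> insert Q F" "S \<in> insert Q F" "R \<noteq> S"
      show "E' R \<inter> E' S = {}"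
      proof (cases "R = Q \<or> S = Q")
        case False
        then have "E R \<inter> E S = {}" using * E(3) by blast
        then show ?thesis using False by (auto simp: E'_def)
      qed (use * in \<open>auto simp: E'_def\<close>)
    qed
    ultimately show ?case by (intro exI[of _ E']) blast
  qed auto
  then obtain E where "\<forall>R\<in>F. E R \<in> sets lebesgue" "\<forall>R\<in>F. E R \<subseteq> cube R"
    "\<forall>R\<in>F. \<forall>S\<in>F. R \<noteq> S \<longrightarrow> E R \<inter> E S = {}" "\<forall>x. fmax F c x = (\<Sum>R\<in>F. c R * indicator (E R) x)"
    by (elim exE conjE)
  then show thesis by (intro that[of E]) (auto simp: disjoint_family_on_def)
qed

lemma triple_funpow: "snd ((triple ^^ k) Q) = 3 ^ k * snd Q"
  "vol ((triple ^^ k) (Q :: 'a::euclidean_space \<times> real)) = (3 ^ DIM('a)) ^ k * vol Q"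
  by (induction k) (auto simp: vol_triple)

lemma triple_funpow_subset: "0 < snd Q \<Longrightarrow> cube Q \<subseteq> cube ((triple ^^ k) Q)"
proof (induction k)
  case (Suc k)
  have "cube ((triple ^^ k) Q) \<subseteq> cube (triple ((triple ^^ k) Q))"
    using Suc by (intro cube_subset_triple) (simp add: triple_funpow)
  then show ?case using Suc by simp
qed simp

section \<open>The maximal operator on weighted Morrey spaces\<close>

text \<open>The situation after the reduction to (1, \<infinity>). The volume exponent
  \<open>1 / a' + 1 / b\<close> is \<open>1 - \<delta>\<close>; for \<open>a = b\<close> the
  condition is Muckenhoupt's. Nonnegativity of \<open>w\<close> everywhere lets its powers be
  multiplied without exceptional sets.\<close>

locale morrey_weight =
  fixes a a' b K :: real and w :: "'a::euclidean_space \<Rightarrow> real"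
  assumes a: "1 < a" "1 / a + 1 / a' = 1" and ab: "a \<le> b" and K: "0 < K"
    and w[measurable]: "w \<in> borel_measurable lebesgue" and wnn: "\<And>x. 0 \<le> w x" and wpos: "AE x in lebesgue. 0 < w x"
    and fin_b: "\<And>Q. 0 < snd Q \<Longrightarrow> nint (\<lambda>x. w x powr b) Q < \<infinity>"
    and fin_a': "\<And>Q. 0 < snd Q \<Longrightarrow> nint (\<lambda>x. w x powr - a') Q < \<infinity>"
    and cond: "\<And>Q. 0 < snd Q \<Longrightarrow> mass (\<lambda>x. w x powr b) Q powr (1 / b) * mass (\<lambda>x. w x powr - a') Q powr (1 / a')
        \<le> K * vol Q powr (1 / a' + 1 / b)"
begin

definition \<delta> :: real where "\<delta> = 1 / a - 1 / b"

text \<open>The norm of \<open>w\<close> on \<open>Q\<close> in the exponent \<open>b\<close>. It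
  bounds the Morrey norm of the indicator of \<open>Q\<close>, and its reciprocal bounds averages of
  Morrey functions over \<open>Q\<close>.\<close>

definition Wb :: "'a \<times> real \<Rightarrow> real" where "Wb Q = mass (\<lambda>x. w x powr b) Q powr (1 / b)"

definition Sa :: "'a \<times> real \<Rightarrow> real" where "Sa Q = mass (\<lambda>x. w x powr - a') Q powr (1 / a')"

text \<open>For nonnegative \<open>f\<close> and \<open>N\<close> this is the bound \<open>N\<close>
  on the Morrey norm, stated cube by cube so that no extended number appears on the right.\<close>

definition mor :: "('a \<Rightarrow> real) \<Rightarrow> real \<Rightarrow> bool" where
  "mor f N \<longleftrightarrow> (\<forall>Q. 0 < snd Q \<longrightarrow> nint (\<lambda>x. (f x * w x) powr a) Q \<le> ennreal ((N * vol Q powr \<delta>) powr a))"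

definition d3 :: real where "d3 = 3 ^ DIM('a)"

lemma d3: "1 < d3" "0 < d3" "0 \<le> d3" unfolding d3_def by (simp_all add: one_less_power)

lemma vol_triple': "vol (triple Q) = d3 * vol (Q :: 'a \<times> real)"
  by (simp add: vol_triple d3_def)

lemma exps: "1 < a'" "0 < a" "0 < a'" "1 < b" "0 < b" "0 \<le> \<delta>" "1 / a' + 1 / b = 1 - \<delta>" "1 / a' + 1 / a = 1"
proof -
  show "1 < a'" by (rule conjugate_exponent(1)[OF a])
  then show "0 < a" "0 < a'" "1 < b" "0 < b" using a ab by auto
  then show "0 \<le> \<delta>" using ab by (simp add: \<delta>_def frac_le)
  show "1 / a' + 1 / b = 1 - \<delta>" "1 / a' + 1 / a = 1" using a(2) by (simp_all add: \<delta>_def)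
qed

lemma w_inverse: "inverse (w x) powr c = w x powr - c"
  by (metis inverse_powr wnn powr_minus)

lemma w_powr_pos: "AE x in lebesgue. 0 < w x powr e"
  using wpos by (auto elim!: eventually_mono)

lemma Wb_pos: "0 < snd Q \<Longrightarrow> 0 < Wb Q"
proof -
  assume Q: "0 < snd Q"
  have "0 < nint (\<lambda>x. w x powr b) Q" by (rule nint_pos[OF _ w_powr_pos Q]) measurable
  then have "0 < mass (\<lambda>x. w x powr b) Q" using fin_b[OF Q] by (simp add: mass_def enn2real_positive_iff)
  then show ?thesis by (simp add: Wb_def)
qed

lemma Sa_pos: "0 < snd Q \<Longrightarrow> 0 < Sa Q"
proof -
  assume Q: "0 < snd Q"
  have "0 < nint (\<lambda>x. w x powr - a') Q" by (rule nint_pos[OF _ w_powr_pos Q]) measurable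
  then have "0 < mass (\<lambda>x. w x powr - a') Q" using fin_a'[OF Q] by (simp add: mass_def enn2real_positive_iff)
  then show ?thesis by (simp add: Sa_def)
qed

lemma nint_wb: "0 < snd Q \<Longrightarrow> nint (\<lambda>x. w x powr b) Q = ennreal (Wb Q powr b)"
  using exps fin_b[of Q] by (simp add: Wb_def powr_powr nint_mass)

lemma nint_wa': "0 < snd Q \<Longrightarrow> nint (\<lambda>x. w x powr - a') Q = ennreal (Sa Q powr a')"
  using exps fin_a'[of Q] by (simp add: Sa_def powr_powr nint_mass)

lemma nint_wa: "0 < snd Q \<Longrightarrow> nint (\<lambda>x. w x powr a) Q \<le> ennreal ((Wb Q * vol Q powr \<delta>) powr a)"
  unfolding \<delta>_def using wnn nint_wb[of Q] Wb_pos[of Q] by (intro nint_powr_le a ab) auto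

lemma cond': "0 < snd Q \<Longrightarrow> Wb Q * Sa Q \<le> K * vol Q powr (1 - \<delta>)"
  using cond[of Q] exps by (simp add: Wb_def Sa_def)

lemma vol_split: "0 < snd Q \<Longrightarrow> vol Q powr (1 - \<delta>) * vol Q powr \<delta> = vol Q"
  using vol_pos[of Q] by (simp add: powr_add[symmetric])

text \<open>On a cube, the passage from exponent \<open>b\<close> to \<open>a\<close> costs
  \<open>vol Q powr \<delta>\<close>, exactly the power that separates the hypothesis from the
  Muckenhoupt condition.\<close>

lemma muck: "muckenhoupt a a' K w"
  unfolding muckenhoupt_def
proof (intro conjI allI impI w wnn wpos)
  fix Q :: "'a \<times> real" assume Q: "0 < snd Q"
  show fa: "nint (\<lambda>x. w x powr a) Q < \<infinity>" using nint_wa[OF Q] by (auto intro: le_less_trans)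
  show "nint (\<lambda>x. w x powr - a') Q < \<infinity>" by (rule fin_a'[OF Q])
  have "mass (\<lambda>x. w x powr a) Q \<le> (Wb Q * vol Q powr \<delta>) powr a"
    using nint_wa[OF Q] fa by (simp add: nint_mass)
  then have "mass (\<lambda>x. w x powr a) Q powr (1 / a) \<le> ((Wb Q * vol Q powr \<delta>) powr a) powr (1 / a)"
    using exps by (intro powr_mono2) auto
  also have "\<dots> = Wb Q * vol Q powr \<delta>"
    using exps Wb_pos[OF Q] by (simp add: powr_powr)
  finally have "mass (\<lambda>x. w x powr a) Q powr (1 / a) * Sa Q \<le> Wb Q * vol Q powr \<delta> * Sa Q"
    using Sa_pos[OF Q] by (intro mult_right_mono) auto
  also have "\<dots> = Wb Q * Sa Q * vol Q powr \<delta>" by simp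
  also have "\<dots> \<le> K * vol Q powr (1 - \<delta>) * vol Q powr \<delta>" by (intro mult_right_mono cond' Q) simp
  also have "\<dots> = K * vol Q" using vol_split[OF Q] by simp
  finally show "mass (\<lambda>x. w x powr a) Q powr (1 / a) * mass (\<lambda>x. w x powr - a') Q powr (1 / a') \<le> K * vol Q"
    by (simp add: Sa_def)
qed

lemma Wb_mono:
  assumes "cube Q \<subseteq> cube R" "0 < snd Q" "0 < snd R"
  shows "Wb Q \<le> Wb R"
proof -
  have "mass (\<lambda>x. w x powr b) Q \<le> mass (\<lambda>x. w x powr b) R"
    using nint_mono_cube[OF assms(1), of "\<lambda>x. w x powr b"] fin_b[OF assms(2)] fin_b[OF assms(3)] by (simp add: nint_mass)
  then show ?thesis unfolding Wb_def using exps by (intro powr_mono2) auto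
qed

lemma Sa_mono:
  assumes "cube Q \<subseteq> cube R" "0 < snd Q" "0 < snd R"
  shows "Sa Q \<le> Sa R"
proof -
  have "mass (\<lambda>x. w x powr - a') Q \<le> mass (\<lambda>x. w x powr - a') R"
    using nint_mono_cube[OF assms(1), of "\<lambda>x. w x powr - a'"] fin_a'[OF assms(2)] fin_a'[OF assms(3)] by (simp add: nint_mass)
  then show ?thesis unfolding Sa_def using exps by (intro powr_mono2) auto
qed

lemma Sa_le: "0 < snd Q \<Longrightarrow> Sa Q * vol Q powr \<delta> \<le> K * vol Q / Wb Q"
proof -
  assume Q: "0 < snd Q"
  have "Wb Q * Sa Q * vol Q powr \<delta> \<le> K * vol Q powr (1 - \<delta>) * vol Q powr \<delta>" by (intro mult_right_mono cond' Q) simp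
  also have "\<dots> = K * vol Q" using vol_split[OF Q] by simp
  finally show ?thesis using Wb_pos[OF Q] by (simp add: field_simps)
qed

text \<open>Hoelder for \<open>f * w\<close> and the inverse of \<open>w\<close> produces
  \<open>Sa Q\<close>, which the hypothesis exchanges for the reciprocal of \<open>Wb Q\<close>.
  That averages decrease as \<open>Wb\<close> grows is the source of all estimates for far
  cubes.\<close>

lemma nint_le:
  assumes [measurable]: "f \<in> borel_measurable lebesgue" and f: "\<And>x. 0 \<le> f x" and N: "0 \<le> N" and m: "mor f N" and Q: "0 < snd Q"
  shows "nint f Q \<le> ennreal (N * K * vol Q / Wb Q)"
proof -
  have "nint f Q = nint (\<lambda>x. (f x * w x) * inverse (w x)) Q"
    unfolding nint_def using wpos by (intro nn_integral_cong_AE) (auto simp: mult.assoc elim!: eventually_mono)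
  also have "\<dots> \<le> ennreal ((N * vol Q powr \<delta>) * Sa Q)"
  proof (rule holder_cube[OF a])
    show "nint (\<lambda>x. (f x * w x) powr a) Q \<le> ennreal ((N * vol Q powr \<delta>) powr a)" using m Q by (simp add: mor_def)
    show "nint (\<lambda>x. inverse (w x) powr a') Q \<le> ennreal (Sa Q powr a')" unfolding w_inverse by (simp add: nint_wa'[OF Q])
  qed (use f wnn N Sa_pos[OF Q] in auto)
  also have "\<dots> \<le> ennreal (N * K * vol Q / Wb Q)"
    using mult_left_mono[OF Sa_le[OF Q] N] by (intro ennreal_leI) (simp add: mult.assoc mult.commute mult.left_commute)
  finally show ?thesis .
qed

lemma mass_le:
  assumes "f \<in> borel_measurable lebesgue" "\<And>x. 0 \<le> f x" "0 \<le> N" "mor f N" "0 < snd Q"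
  shows "nint f Q = ennreal (mass f Q)" "mass f Q \<le> N * K * vol Q / Wb Q"
proof -
  note le = nint_le[OF assms]
  then show "nint f Q = ennreal (mass f Q)" by (intro nint_mass) (auto intro: le_less_trans)
  with le show "mass f Q \<le> N * K * vol Q / Wb Q"
    using assms(3) K vol_pos[OF assms(5)] Wb_pos[OF assms(5)] by simp
qed

section \<open>Doubling and reverse doubling of the weight\<close>

definition Db :: real where "Db = K * d3 powr (1 - \<delta>)"

lemma Db_pos: "0 < Db" using K d3 by (simp add: Db_def)

text \<open>The cancellation of \<open>Sa (triple Q)\<close> known from the Muckenhoupt case, with
  the norm of exponent \<open>b\<close> instead: the power \<open>\<delta>\<close> of the volume is
  split off first, which leaves \<open>d3 powr (1 - \<delta>)\<close> in the constant.\<close>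

lemma Wb_triple: "0 < snd Q \<Longrightarrow> Wb (triple Q) \<le> Db * Wb Q"
proof -
  assume Q: "0 < snd Q"
  then have Q3: "0 < snd (triple Q)" by simp
  have fa: "nint (\<lambda>x. w x powr a) Q < \<infinity>" using nint_wa[OF Q] by (auto intro: le_less_trans)
  have "mass (\<lambda>x. w x powr a) Q \<le> (Wb Q * vol Q powr \<delta>) powr a"
    using nint_wa[OF Q] fa by (simp add: nint_mass)
  then have "mass (\<lambda>x. w x powr a) Q powr (1 / a) \<le> ((Wb Q * vol Q powr \<delta>) powr a) powr (1 / a)"
    using exps by (intro powr_mono2) auto
  also have "\<dots> = Wb Q * vol Q powr \<delta>"
    using exps Wb_pos[OF Q] by (simp add: powr_powr)
  finally have 1: "mass (\<lambda>x. w x powr a) Q powr (1 / a) \<le> Wb Q * vol Q powr \<delta>" .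
  have "vol Q powr (1 - \<delta>) * vol Q powr \<delta> \<le> mass (\<lambda>x. w x powr a) Q powr (1 / a) * Sa Q"
    unfolding vol_split[OF Q] Sa_def by (intro vol_le_mass_mult w wnn wpos a Q fa fin_a')
  also have "\<dots> \<le> (Wb Q * vol Q powr \<delta>) * Sa (triple Q)"
    using Q Q3 Sa_pos[OF Q] Wb_pos[OF Q] by (intro mult_mono 1 Sa_mono cube_subset_triple) auto
  also have "\<dots> = (Wb Q * Sa (triple Q)) * vol Q powr \<delta>" by simp
  finally have "vol Q powr (1 - \<delta>) \<le> Wb Q * Sa (triple Q)"
    by (rule mult_right_le_imp_le) (use vol_pos[OF Q] in simp)
  then have "Wb (triple Q) * vol Q powr (1 - \<delta>) \<le> Wb (triple Q) * (Wb Q * Sa (triple Q))"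
    using Wb_pos[OF Q3] by (intro mult_left_mono) auto
  also have "\<dots> = (Wb (triple Q) * Sa (triple Q)) * Wb Q" by simp
  also have "\<dots> \<le> K * vol (triple Q) powr (1 - \<delta>) * Wb Q"
    using Wb_pos[OF Q] by (intro mult_right_mono cond' Q3) auto
  also have "\<dots> = Db * Wb Q * vol Q powr (1 - \<delta>)"
    by (simp add: vol_triple' powr_mult Db_def)
  finally show ?thesis by (rule mult_right_le_imp_le) (use vol_pos[OF Q] in simp)
qed

text \<open>The value that comes out of \<open>Wb_triple_ge\<close>: its corner cube
  \<open>P\<close> satisfies \<open>Wb Q \<le> Db * (Db * Wb P)\<close>, and the \<open>b\<close>-th
  powers of \<open>Wb\<close> add over the disjoint cubes \<open>Q\<close> and \<open>P\<close>
  inside 3Q, so that the \<open>b\<close>-th power grows at least by the factor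
  \<open>1 + Db powr (- 2 * b)\<close>.\<close>

definition \<theta> :: real where "\<theta> = (1 + Db powr (- 2 * b)) powr (1 / b)"

lemma \<theta>: "1 < \<theta>"
  unfolding \<theta>_def using Db_pos exps by (intro gr_one_powr) auto

text \<open>Reverse doubling: the corner cube of half the side length inside \<open>3Q \<setminus> Q\<close> carries a fixed
  proportion of the mass of \<open>Q\<close>, because its ninefold dilate contains \<open>Q\<close>.\<close>

lemma Wb_triple_ge: "0 < snd Q \<Longrightarrow> \<theta> * Wb Q \<le> Wb (triple Q)"
proof -
  assume Q: "0 < snd Q"
  define l where "l = snd Q"
  have l: "0 < l" using Q by (simp add: l_def)
  \<comment> \<open>In units of \<open>l\<close> from the lower corner of \<open>Q\<close>, each
    side of \<open>P\<close> is [3/2, 2], inside [-1, 2] and disjoint from [0, 1]; the ninefold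
    dilate has sides [-1/2, 4], which contain those of \<open>Q\<close>.\<close>
  define P where "P = (fst Q + (3 / 2 * l) *\<^sub>R One, l / 2)"
  have P: "0 < snd P" "0 < snd (triple P)" "0 < snd (triple (triple P))" using l by (auto simp: P_def)
  have disj: "cube Q \<inter> cube P = {}"
  proof (rule ccontr)
    assume "cube Q \<inter> cube P \<noteq> {}"
    then obtain x where x: "x \<in> cube Q" "x \<in> cube P" by blast
    obtain i :: 'a where i: "i \<in> Basis" using nonempty_Basis by blast
    show False
      using bspec[OF x(1)[unfolded mem_cube] i] bspec[OF x(2)[unfolded mem_cube] i] l i
      by (simp add: P_def inner_simps l_def)
  qed
  have PQ: "cube P \<subseteq> cube (triple Q)"
  proof
    fix x assume x: "x \<in> cube P"
    show "x \<in> cube (triple Q)" unfolding mem_triple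
    proof
      fix i :: 'a assume i: "i \<in> Basis"
      show "fst Q \<bullet> i - snd Q \<le> x \<bullet> i \<and> x \<bullet> i \<le> fst Q \<bullet> i + 2 * snd Q"
        using bspec[OF x[unfolded mem_cube] i] i l by (simp add: P_def inner_simps l_def)
    qed
  qed
  have QP: "cube Q \<subseteq> cube (triple (triple P))"
  proof
    fix x assume x: "x \<in> cube Q"
    show "x \<in> cube (triple (triple P))" unfolding mem_cube
    proof
      fix i :: 'a assume i: "i \<in> Basis"
      show "fst (triple (triple P)) \<bullet> i \<le> x \<bullet> i \<and> x \<bullet> i \<le> fst (triple (triple P)) \<bullet> i + snd (triple (triple P))"
        using bspec[OF x[unfolded mem_cube] i] i l by (simp add: P_def triple_def inner_simps l_def)
    qed
  qed
  have "Wb Q \<le> Wb (triple (triple P))" by (rule Wb_mono[OF QP Q P(3)])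
  also have "\<dots> \<le> Db * Wb (triple P)" by (rule Wb_triple[OF P(2)])
  also have "\<dots> \<le> Db * (Db * Wb P)" using Db_pos by (intro mult_left_mono Wb_triple P) auto
  finally have "Wb Q powr b \<le> (Db * (Db * Wb P)) powr b"
    using exps Wb_pos[OF Q] by (intro powr_mono2) auto
  also have "\<dots> = Db powr (2 * b) * Wb P powr b"
    using powr_add[of Db b b] by (simp add: powr_mult mult.assoc[symmetric])
  finally have "Db powr (- 2 * b) * Wb Q powr b \<le> Db powr (- 2 * b) * (Db powr (2 * b) * Wb P powr b)"
    by (intro mult_left_mono) auto
  also have "\<dots> = Wb P powr b" using Db_pos by (simp add: mult.assoc[symmetric] powr_add[symmetric])
  finally have 1: "Db powr (- 2 * b) * Wb Q powr b \<le> Wb P powr b" .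
  have "ennreal (Wb Q powr b) + ennreal (Wb P powr b) = (\<integral>\<^sup>+x. ennreal (w x powr b) * indicator (cube Q) x + ennreal (w x powr b) * indicator (cube P) x \<partial>lebesgue)"
    unfolding nint_wb[OF Q, symmetric] nint_wb[OF P(1), symmetric] nint_def
    by (rule nn_integral_add[symmetric]) measurable
  also have "\<dots> \<le> nint (\<lambda>x. w x powr b) (triple Q)"
    unfolding nint_def
  proof (intro nn_integral_mono)
    fix x
    show "ennreal (w x powr b) * indicator (cube Q) x + ennreal (w x powr b) * indicator (cube P) x
       \<le> ennreal (w x powr b) * indicator (cube (triple Q)) x"
      using disj PQ cube_subset_triple[OF Q] by (auto simp: indicator_def)
  qed
  also have "\<dots> = ennreal (Wb (triple Q) powr b)" using Q by (intro nint_wb) simp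
  finally have "Wb Q powr b + Wb P powr b \<le> Wb (triple Q) powr b"
    by (simp add: ennreal_plus[symmetric] del: ennreal_plus)
  with 1 have "(1 + Db powr (- 2 * b)) * Wb Q powr b \<le> Wb (triple Q) powr b" by (simp add: algebra_simps)
  then have "((1 + Db powr (- 2 * b)) * Wb Q powr b) powr (1 / b) \<le> (Wb (triple Q) powr b) powr (1 / b)"
    using exps by (intro powr_mono2) auto
  moreover have "((1 + Db powr (- 2 * b)) * Wb Q powr b) powr (1 / b) = \<theta> * Wb Q"
    unfolding powr_mult \<theta>_def using exps Wb_pos[OF Q] by (simp add: powr_powr)
  moreover have "(Wb (triple Q) powr b) powr (1 / b) = Wb (triple Q)"
    using exps Wb_pos[of "triple Q"] Q by (simp add: powr_powr)
  ultimately show ?thesis by simp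
qed

lemma Wb_funpow_ge: "0 < snd Q \<Longrightarrow> \<theta> ^ k * Wb Q \<le> Wb ((triple ^^ k) Q)"
proof (induction k)
  case (Suc k)
  have "\<theta> * (\<theta> ^ k * Wb Q) \<le> \<theta> * Wb ((triple ^^ k) Q)" using Suc \<theta> by (intro mult_left_mono) auto
  also have "\<dots> \<le> Wb (triple ((triple ^^ k) Q))" using Suc by (intro Wb_triple_ge) (simp add: triple_funpow)
  finally show ?case by (simp add: mult.assoc)
qed simp

text \<open>For a maximum, all far cubes together cost a single constant on \<open>Q\<close>: no
  summation over scales occurs, and monotonicity of \<open>Wb\<close> controls them.\<close>

lemma fmax_morrey:
  obtains C where "0 < C" "\<And>F f N. finite F \<Longrightarrow> (\<And>Q. Q \<in> F \<Longrightarrow> 0 < snd Q) \<Longrightarrow> f \<in> borel_measurable lebesgue \<Longrightarrow>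
    (\<And>x. 0 \<le> f x) \<Longrightarrow> 0 \<le> N \<Longrightarrow> mor f N \<Longrightarrow> mor (fmax F (avg f)) (C * N)"
proof -
  obtain C0 where C0: "0 \<le> C0" "\<forall>F c f. finite F \<longrightarrow> (\<forall>Q\<in>F. 0 < snd Q) \<longrightarrow> (\<forall>Q\<in>F. 0 \<le> c Q) \<longrightarrow> f \<in> borel_measurable lebesgue \<longrightarrow>
     (\<forall>x. 0 \<le> f x) \<longrightarrow> (\<forall>Q\<in>F. ennreal (c Q * vol Q) \<le> nint f Q) \<longrightarrow>
     (\<integral>\<^sup>+x. ennreal (fmax F c x powr a * w x powr a) \<partial>lebesgue)
       \<le> ennreal C0 * (\<integral>\<^sup>+x. ennreal (f x powr a * w x powr a) \<partial>lebesgue)"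
    using muckenhoupt_fmax[OF muck a K] by blast
  define C1 where "C1 = C0 * (d3 powr \<delta>) powr a + (K * d3) powr a"
  have C1: "0 < C1" using C0(1) K d3 by (auto simp: C1_def intro!: add_nonneg_pos)
  show thesis
  proof
    show "0 < C1 powr (1 / a)" using C1 by simp
    fix F :: "('a \<times> real) set" and f :: "'a \<Rightarrow> real" and N
    assume F: "finite F" "\<And>Q. Q \<in> F \<Longrightarrow> 0 < snd Q" and [measurable]: "f \<in> borel_measurable lebesgue"
      and f: "\<And>x. 0 \<le> f x" and N: "0 \<le> N" and m: "mor f N"
    note fm = \<open>f \<in> borel_measurable lebesgue\<close>
    note ml = mass_le[OF fm f N m]
    have avg: "avg f R = mass f R / vol R" for R using f by (simp add: avg_def)
    show "mor (fmax F (avg f)) (C1 powr (1 / a) * N)"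
      unfolding mor_def
    proof (intro allI impI)
      fix Q :: "'a \<times> real" assume Q: "0 < snd Q"
      define P where "P = triple Q"
      have P: "0 < snd P" "vol P = d3 * vol Q" using Q by (auto simp: P_def vol_triple')
      define f1 where "f1 x = f x * indicator (cube P) x" for x
      \<comment> \<open>Dropping the cubes outside \<open>P\<close> allows \<open>f\<close> to be
        cut off to \<open>P\<close>, so that the global theorem for \<open>fmax\<close> sees only
        the Morrey bound of \<open>f\<close> on \<open>P\<close>.\<close>
      define c1 where "c1 R = (if cube R \<subseteq> cube P then avg f R else 0)" for R
      define E where "E = N * K * d3 / Wb Q"
      have E: "0 \<le> E" using N K d3 Wb_pos[OF Q] by (simp add: E_def)
      have avg0: "0 \<le> avg f R" if "R \<in> F" for R using vol_pos[OF F(2)[OF that]] by (simp add: avg)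
      have point: "fmax F (avg f) x \<le> max (fmax F c1 x) E" if x: "x \<in> cube Q" for x
      proof (cases rule: fmax_cases[OF F(1), of "avg f" x])
        case (2 R)
        show ?thesis
        proof (cases "cube R \<subseteq> cube P")
          case True
          then have "avg f R \<le> fmax F c1 x" using fmax_ge[OF F(1) 2(1,2), of c1] by (simp add: c1_def)
          then show ?thesis using 2 by simp
        next
          case False
          then have "snd Q < snd R" using cube_meets_subset_triple[OF x 2(2)] unfolding P_def by force
          then have QR: "cube Q \<subseteq> cube (triple R)" using cube_meets_subset_triple[OF 2(2) x] by simp
          have R: "0 < snd R" "0 < snd (triple R)" using F(2)[OF 2(1)] by auto
          \<comment> \<open>\<open>Q\<close> need not lie in \<open>R\<close>, but it lies in
            \<open>triple R\<close>; the detour makes \<open>Wb Q\<close> available through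
            monotonicity and costs the factor \<open>d3\<close>.\<close>
          have "mass f R \<le> mass f (triple R)"
            using nint_mono_cube[OF cube_subset_triple[OF R(1)], of f] ml(1)[OF R(1)] ml(1)[OF R(2)] by simp
          also have "\<dots> \<le> N * K * (d3 * vol R) / Wb (triple R)" using ml(2)[OF R(2)] by (simp add: vol_triple')
          also have "\<dots> \<le> N * K * (d3 * vol R) / Wb Q"
            using Wb_mono[OF QR Q R(2)] Wb_pos[OF Q] Wb_pos[OF R(2)] N K d3 vol_pos[OF R(1)] by (intro divide_left_mono) auto
          finally have "avg f R \<le> E" using vol_pos[OF R(1)] by (simp add: avg E_def field_simps)
          then show ?thesis using 2 by simp
        qed
      qed (use E in simp)
      have [measurable]: "fmax F c1 \<in> borel_measurable lebesgue" by (rule fmax_measurable[OF F(1)])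
      have [measurable]: "f1 \<in> borel_measurable lebesgue" unfolding f1_def by measurable
      have "nint (\<lambda>x. (fmax F (avg f) x * w x) powr a) Q
        \<le> (\<integral>\<^sup>+x. ennreal (fmax F c1 x powr a * w x powr a) + ennreal (E powr a) * (ennreal (w x powr a) * indicator (cube Q) x) \<partial>lebesgue)"
        unfolding nint_def
      proof (intro nn_integral_mono)
        fix x
        show "ennreal ((fmax F (avg f) x * w x) powr a) * indicator (cube Q) x
          \<le> ennreal (fmax F c1 x powr a * w x powr a) + ennreal (E powr a) * (ennreal (w x powr a) * indicator (cube Q) x)"
        proof (cases "x \<in> cube Q")
          case True
          have "fmax F (avg f) x powr a \<le> max (fmax F c1 x) E powr a"
            using point[OF True] exps fmax_nonneg[OF F(1)] by (intro powr_mono2) auto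
          also have "\<dots> \<le> fmax F c1 x powr a + E powr a" by (simp add: max_def)
          finally have "(fmax F (avg f) x * w x) powr a \<le> (fmax F c1 x powr a + E powr a) * w x powr a"
            by (simp add: powr_mult mult_right_mono)
          then show ?thesis using True
            by (simp add: ennreal_mult[symmetric] ennreal_plus[symmetric] distrib_right ennreal_leI del: ennreal_plus)
        qed simp
      qed
      also have "\<dots> = (\<integral>\<^sup>+x. ennreal (fmax F c1 x powr a * w x powr a) \<partial>lebesgue) + ennreal (E powr a) * nint (\<lambda>x. w x powr a) Q"
        unfolding nint_def by (subst nn_integral_add) (auto intro!: nn_integral_cmult)
      also have "\<dots> \<le> ennreal C0 * (\<integral>\<^sup>+x. ennreal (f1 x powr a * w x powr a) \<partial>lebesgue) + ennreal (E powr a) * ennreal ((Wb Q * vol Q powr \<delta>) powr a)"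
      proof (intro add_mono mult_left_mono nint_wa Q)
        have "\<forall>R\<in>F. ennreal (c1 R * vol R) \<le> nint f1 R"
        proof
          fix R assume R: "R \<in> F"
          show "ennreal (c1 R * vol R) \<le> nint f1 R"
          proof (cases "cube R \<subseteq> cube P")
            case True
            have "nint f1 R = nint f R"
              unfolding nint_def f1_def using True by (intro nn_integral_cong) (auto simp: indicator_def)
            then show ?thesis using True ml(1)[OF F(2)[OF R]] vol_pos[OF F(2)[OF R]] by (simp add: c1_def avg)
          qed (simp add: c1_def)
        qed
        moreover have "\<forall>R\<in>F. 0 \<le> c1 R" using avg0 by (simp add: c1_def)
        moreover have "\<forall>x. 0 \<le> f1 x" using f by (simp add: f1_def)
        moreover have "\<forall>R\<in>F. 0 < snd R" using F(2) by blast
        ultimately show "(\<integral>\<^sup>+x. ennreal (fmax F c1 x powr a * w x powr a) \<partial>lebesgue)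
          \<le> ennreal C0 * (\<integral>\<^sup>+x. ennreal (f1 x powr a * w x powr a) \<partial>lebesgue)"
          using C0(2)[rule_format, of F c1 f1] F(1) \<open>f1 \<in> borel_measurable lebesgue\<close> by blast
      qed auto
      also have "(\<integral>\<^sup>+x. ennreal (f1 x powr a * w x powr a) \<partial>lebesgue) = nint (\<lambda>x. (f x * w x) powr a) P"
        unfolding nint_def f1_def by (intro nn_integral_cong) (auto simp: indicator_def powr_mult)
      also have "ennreal C0 * \<dots> + ennreal (E powr a) * ennreal ((Wb Q * vol Q powr \<delta>) powr a)
        \<le> ennreal C0 * ennreal ((N * vol P powr \<delta>) powr a) + ennreal (E powr a) * ennreal ((Wb Q * vol Q powr \<delta>) powr a)"
        using m P by (intro add_mono mult_left_mono) (auto simp: mor_def)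
      also have "\<dots> = ennreal (C0 * (N * vol P powr \<delta>) powr a + (E * (Wb Q * vol Q powr \<delta>)) powr a)"
        using C0(1) by (simp add: ennreal_mult[symmetric] powr_mult)
      also have "C0 * (N * vol P powr \<delta>) powr a + (E * (Wb Q * vol Q powr \<delta>)) powr a = (C1 powr (1 / a) * N * vol Q powr \<delta>) powr a"
      proof -
        have "E * (Wb Q * vol Q powr \<delta>) = (K * d3) * (N * vol Q powr \<delta>)"
          using Wb_pos[OF Q] by (simp add: E_def)
        moreover have "N * vol P powr \<delta> = d3 powr \<delta> * (N * vol Q powr \<delta>)" by (simp add: P powr_mult)
        ultimately have "C0 * (N * vol P powr \<delta>) powr a + (E * (Wb Q * vol Q powr \<delta>)) powr a
          = C0 * ((d3 powr \<delta>) powr a * (N * vol Q powr \<delta>) powr a) + (K * d3) powr a * (N * vol Q powr \<delta>) powr a"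
          by (simp only: powr_mult)
        also have "\<dots> = C1 * (N * vol Q powr \<delta>) powr a" by (simp add: C1_def algebra_simps)
        also have "\<dots> = (C1 powr (1 / a)) powr a * (N * vol Q powr \<delta>) powr a" using C1 exps by (simp add: powr_powr)
        finally show ?thesis by (simp add: powr_mult mult.assoc)
      qed
      finally show "nint (\<lambda>x. (fmax F (avg f) x * w x) powr a) Q \<le> ennreal ((C1 powr (1 / a) * N * vol Q powr \<delta>) powr a)" .
    qed
  qed
qed

section \<open>The maximal operator on the Koethe dual\<close>

text \<open>The sum is the transpose of the linearised maximal operator, applied to
  \<open>f\<close>. Paired with \<open>w * u\<close>, it becomes the pairing of \<open>f\<close>
  with a function below the maximal function of \<open>w * u\<close>, and the latter is bounded in
  exponent \<open>a'\<close> by Muckenhoupt's theorem for the inverse of \<open>w\<close>. As the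
  sets \<open>E R\<close> lie in \<open>P\<close>, only the local norm of \<open>f\<close> on
  \<open>P\<close> enters.\<close>

lemma transpose_local:
  obtains C where "0 \<le> C" "\<And>F E f N P. finite F \<Longrightarrow> (\<And>R. R \<in> F \<Longrightarrow> 0 < snd R) \<Longrightarrow>
    (\<And>R. R \<in> F \<Longrightarrow> E R \<in> sets lebesgue) \<Longrightarrow> (\<And>R. R \<in> F \<Longrightarrow> E R \<subseteq> cube P) \<Longrightarrow>
    (\<And>R. R \<in> F \<Longrightarrow> E R \<subseteq> cube R) \<Longrightarrow>
    disjoint_family_on E F \<Longrightarrow>
    f \<in> borel_measurable lebesgue \<Longrightarrow> (\<And>x. 0 \<le> f x) \<Longrightarrow> 0 \<le> N \<Longrightarrow> mor f N \<Longrightarrow> 0 < snd P \<Longrightarrow>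
    (\<integral>\<^sup>+y. ennreal (((\<Sum>R\<in>F. enn2real (\<integral>\<^sup>+x\<in>E R. ennreal (f x) \<partial>lebesgue) / vol R * indicator (cube R) y) * w y) powr a) \<partial>lebesgue)
      \<le> ennreal ((C * N * vol P powr \<delta>) powr a)"
proof -
  have aa: "1 / a' + 1 / a = 1" by (rule exps)
  obtain C0 where C0: "0 \<le> C0" "\<forall>F c f. finite F \<longrightarrow> (\<forall>Q\<in>F. 0 < snd Q) \<longrightarrow> (\<forall>Q\<in>F. 0 \<le> c Q) \<longrightarrow> f \<in> borel_measurable lebesgue \<longrightarrow>
     (\<forall>x. 0 \<le> f x) \<longrightarrow> (\<forall>Q\<in>F. ennreal (c Q * vol Q) \<le> nint f Q) \<longrightarrow>
     (\<integral>\<^sup>+x. ennreal (fmax F c x powr a' * inverse (w x) powr a') \<partial>lebesgue)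
       \<le> ennreal C0 * (\<integral>\<^sup>+x. ennreal (f x powr a' * inverse (w x) powr a') \<partial>lebesgue)"
    using muckenhoupt_fmax[OF muckenhoupt_inverse[OF muck] exps(1) aa K] by blast
  show thesis
  proof
    show "0 \<le> C0 powr (1 / a')" by simp
    fix F :: "('a \<times> real) set" and E and f :: "'a \<Rightarrow> real" and N and P :: "'a \<times> real"
    assume F: "finite F" "\<And>R. R \<in> F \<Longrightarrow> 0 < snd R" and E: "\<And>R. R \<in> F \<Longrightarrow> E R \<in> sets lebesgue"
      "\<And>R. R \<in> F \<Longrightarrow> E R \<subseteq> cube P" "\<And>R. R \<in> F \<Longrightarrow> E R \<subseteq> cube R"
      "disjoint_family_on E F"
      and fm[measurable]: "f \<in> borel_measurable lebesgue"
      and f: "\<And>x. 0 \<le> f x" and N: "0 \<le> N" and m: "mor f N" and P: "0 < snd P"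
    define e where "e R = enn2real (\<integral>\<^sup>+x\<in>E R. ennreal (f x) \<partial>lebesgue)" for R
    define T where "T y = (\<Sum>R\<in>F. e R / vol R * indicator (cube R) y)" for y
    have e: "ennreal (e R) = (\<integral>\<^sup>+x\<in>E R. ennreal (f x) \<partial>lebesgue)" if "R \<in> F" for R
    proof -
      have "(\<integral>\<^sup>+x\<in>E R. ennreal (f x) \<partial>lebesgue) \<le> nint f R"
        unfolding nint_def using E(3)[OF that] by (intro nn_integral_mono) (auto simp: indicator_def)
      also have "\<dots> < \<infinity>" using mass_le(1)[OF fm f N m F(2)[OF that]] by simp
      finally show ?thesis by (simp add: e_def)
    qed
    have e0: "0 \<le> e R" for R by (simp add: e_def)
    have ev0: "0 \<le> e R / vol R" if "R \<in> F" for R using e0 vol_pos[OF F(2)[OF that]] by simp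
    have T0: "0 \<le> T y" for y unfolding T_def by (intro sum_nonneg mult_nonneg_nonneg ev0) simp_all
    have [measurable]: "T \<in> borel_measurable lebesgue" unfolding T_def by measurable
    have "(\<integral>\<^sup>+y. ennreal ((T y * w y) powr a) \<partial>lebesgue) \<le> ennreal ((N * vol P powr \<delta> * C0 powr (1 / a')) powr a)"
    proof (rule converse_holder[OF a])
      show "0 \<le> T y * w y" for y using T0 wnn by simp
      fix u :: "'a \<Rightarrow> real"
      assume um[measurable]: "u \<in> borel_measurable lebesgue" and u0: "\<And>x. 0 \<le> u x"
        and u1: "(\<integral>\<^sup>+x. ennreal (u x powr a') \<partial>lebesgue) \<le> 1"
      define h where "h x = w x * u x" for x
      have h0: "0 \<le> h x" for x using wnn u0 by (simp add: h_def)
      have hm[measurable]: "h \<in> borel_measurable lebesgue" unfolding h_def by measurable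
      have hR: "nint h R = ennreal (mass h R)" if "0 < snd R" for R
      proof -
        have "nint h R \<le> ennreal ((Wb R * vol R powr \<delta>) * 1)"
          unfolding h_def
        proof (rule holder_cube[OF a])
          have "nint (\<lambda>x. u x powr a') R \<le> (\<integral>\<^sup>+x. ennreal (u x powr a') \<partial>lebesgue)"
            unfolding nint_def by (intro nn_integral_mono) (auto simp: indicator_def)
          then show "nint (\<lambda>x. u x powr a') R \<le> ennreal (1 powr a')" using u1 by simp
        qed (use wnn u0 Wb_pos[OF that] nint_wa[OF that] in auto)
        then show ?thesis by (intro nint_mass) (auto intro: le_less_trans)
      qed
      have avg_h: "avg h R = mass h R / vol R" for R using h0 by (simp add: avg_def)
      have avg0: "0 \<le> avg h R" if "R \<in> F" for R using vol_pos[OF F(2)[OF that]] by (simp add: avg_h)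
      define \<Phi> where "\<Phi> = fmax F (avg h)"
      have \<Phi>0: "0 \<le> \<Phi> x" for x unfolding \<Phi>_def by (rule fmax_nonneg[OF F(1)])
      have [measurable]: "\<Phi> \<in> borel_measurable lebesgue" unfolding \<Phi>_def by (rule fmax_measurable[OF F(1)])
      have "(\<integral>\<^sup>+y. ennreal (T y * w y * u y) \<partial>lebesgue)
        = (\<integral>\<^sup>+y. (\<Sum>R\<in>F. ennreal (e R / vol R) * (ennreal (h y) * indicator (cube R) y)) \<partial>lebesgue)"
      proof (intro nn_integral_cong)
        fix y
        have "T y * w y * u y = (\<Sum>R\<in>F. e R / vol R * (h y * indicator (cube R) y))"
          unfolding T_def sum_distrib_right by (intro sum.cong) (simp_all add: h_def)
        also have "ennreal \<dots> = (\<Sum>R\<in>F. ennreal (e R / vol R * (h y * indicator (cube R) y)))"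
          by (intro sum_ennreal[symmetric] mult_nonneg_nonneg ev0 h0) simp_all
        also have "\<dots> = (\<Sum>R\<in>F. ennreal (e R / vol R) * (ennreal (h y) * indicator (cube R) y))"
        proof (intro sum.cong refl)
          fix R assume "R \<in> F"
          then have "0 \<le> e R / vol R" by (rule ev0)
          then show "ennreal (e R / vol R * (h y * indicator (cube R) y)) = ennreal (e R / vol R) * (ennreal (h y) * indicator (cube R) y)"
            using ennreal_mult[OF _ h0[of y], of "e R / vol R"] by (simp add: indicator_def)
        qed
        finally show "ennreal (T y * w y * u y) = (\<Sum>R\<in>F. ennreal (e R / vol R) * (ennreal (h y) * indicator (cube R) y))" .
      qed
      also have "\<dots> = (\<Sum>R\<in>F. ennreal (e R / vol R) * nint h R)"
        unfolding nint_def by (subst nn_integral_sum) (auto intro!: sum.cong nn_integral_cmult)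
      also have "\<dots> = (\<Sum>R\<in>F. ennreal (avg h R) * ennreal (e R))"
      proof (intro sum.cong refl)
        fix R assume "R \<in> F"
        then have "0 < vol R" "nint h R = ennreal (mass h R)" using vol_pos[OF F(2)] hR[OF F(2)] by auto
        then show "ennreal (e R / vol R) * nint h R = ennreal (avg h R) * ennreal (e R)"
          using e0[of R] by (simp add: ennreal_mult[symmetric] avg_h mult.commute)
      qed
      also have "\<dots> = (\<integral>\<^sup>+x. (\<Sum>R\<in>F. ennreal (avg h R) * (ennreal (f x) * indicator (E R) x)) \<partial>lebesgue)"
        using E(1) e by (subst nn_integral_sum) (auto intro!: sum.cong simp: nn_integral_cmult)
      \<comment> \<open>At each point at most one set \<open>E R\<close> is active, and the average
        over its cube is at most \<open>\<Phi>\<close>.\<close>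
      also have "\<dots> \<le> (\<integral>\<^sup>+x. ennreal ((f x * w x * indicator (cube P) x) * (\<Phi> x * inverse (w x))) \<partial>lebesgue)"
      proof (intro nn_integral_mono_AE)
        show "AE x in lebesgue. (\<Sum>R\<in>F. ennreal (avg h R) * (ennreal (f x) * indicator (E R) x))
            \<le> ennreal ((f x * w x * indicator (cube P) x) * (\<Phi> x * inverse (w x)))"
          using wpos
        proof eventually_elim
          case (elim x)
          have "(\<Sum>R\<in>F. (ennreal (avg h R) * ennreal (f x)) * indicator (E R) x) \<le> ennreal (f x * indicator (cube P) x * \<Phi> x)"
          proof (cases rule: sum_disjoint_cases[OF F(1) E(4), where g="\<lambda>R. ennreal (avg h R) * ennreal (f x)" and x=x])
            case (2 R)
            have "avg h R \<le> \<Phi> x" unfolding \<Phi>_def using E(3)[OF 2(1)] 2 by (intro fmax_ge F(1)) auto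
            then have "avg h R * f x \<le> f x * indicator (cube P) x * \<Phi> x"
              using subsetD[OF E(2)[OF 2(1)] 2(2)] mult_right_mono[OF \<open>avg h R \<le> \<Phi> x\<close> f[of x]]
              by (simp add: mult.commute)
            then show ?thesis unfolding 2(3) using avg0[OF 2(1)] f[of x] by (simp add: ennreal_mult[symmetric] ennreal_leI)
          qed auto
          then show ?case using elim by (simp add: field_simps)
        qed
      qed
      also have "\<dots> \<le> ennreal ((N * vol P powr \<delta>) * C0 powr (1 / a'))"
      proof (rule nn_holder[OF a(1) exps(1) a(2)])
        have "(\<integral>\<^sup>+x. ennreal ((f x * w x * indicator (cube P) x) powr a) \<partial>lebesgue) = nint (\<lambda>x. (f x * w x) powr a) P"
          unfolding nint_def by (intro nn_integral_cong) (auto simp: indicator_def)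
        then show "(\<integral>\<^sup>+x. ennreal ((f x * w x * indicator (cube P) x) powr a) \<partial>lebesgue) \<le> ennreal ((N * vol P powr \<delta>) powr a)"
          using m P by (simp add: mor_def)
        have "(\<integral>\<^sup>+x. ennreal ((\<Phi> x * inverse (w x)) powr a') \<partial>lebesgue) = (\<integral>\<^sup>+x. ennreal (\<Phi> x powr a' * inverse (w x) powr a') \<partial>lebesgue)"
          by (simp add: powr_mult)
        also have "\<dots> \<le> ennreal C0 * (\<integral>\<^sup>+x. ennreal (h x powr a' * inverse (w x) powr a') \<partial>lebesgue)"
          unfolding \<Phi>_def
        proof (intro C0(2)[rule_format] F(1) hm h0)
          fix R assume R: "R \<in> F"
          show "ennreal (avg h R * vol R) \<le> nint h R"
            using hR[OF F(2)[OF R]] vol_pos[OF F(2)[OF R]] by (simp add: avg_h)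
        qed (use F(2) avg0 in auto)
        also have "(\<integral>\<^sup>+x. ennreal (h x powr a' * inverse (w x) powr a') \<partial>lebesgue) = (\<integral>\<^sup>+x. ennreal (u x powr a') \<partial>lebesgue)"
        proof (intro nn_integral_cong_AE)
          show "AE x in lebesgue. ennreal (h x powr a' * inverse (w x) powr a') = ennreal (u x powr a')"
            using wpos
          proof eventually_elim
            case (elim x)
            have "h x powr a' * inverse (w x) powr a' = (h x * inverse (w x)) powr a'" by (simp add: powr_mult)
            also have "h x * inverse (w x) = u x" using elim by (simp add: h_def)
            finally show ?case by simp
          qed
        qed
        also have "ennreal C0 * \<dots> \<le> ennreal C0 * 1" by (intro mult_left_mono u1) simp
        finally show "(\<integral>\<^sup>+x. ennreal ((\<Phi> x * inverse (w x)) powr a') \<partial>lebesgue) \<le> ennreal ((C0 powr (1 / a')) powr a')"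
          using C0(1) exps by (simp add: powr_powr)
      qed (use f wnn \<Phi>0 N in auto)
      finally show "(\<integral>\<^sup>+y. ennreal (T y * w y * u y) \<partial>lebesgue) \<le> ennreal (N * vol P powr \<delta> * C0 powr (1 / a'))" .
    qed (use N in auto)
    then show "(\<integral>\<^sup>+y. ennreal (((\<Sum>R\<in>F. enn2real (\<integral>\<^sup>+x\<in>E R. ennreal (f x) \<partial>lebesgue) / vol R * indicator (cube R) y) * w y) powr a) \<partial>lebesgue)
      \<le> ennreal ((C0 powr (1 / a') * N * vol P powr \<delta>) powr a)"
      by (simp add: T_def e_def mult.commute mult.left_commute)
  qed
qed

text \<open>The far cubes through \<open>y\<close> are grouped by scale in powers of 3. Their number
  at one scale is not controlled, but the sets \<open>E R\<close> are disjoint, so together they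
  count the mass of \<open>f\<close> on one dilate of \<open>Q\<close> at most once. Dividing by the
  volume leaves the reciprocal of \<open>Wb\<close> on that dilate, which decays geometrically in
  the scale by reverse doubling.\<close>

lemma transpose_far:
  assumes F: "finite F" "\<And>R. R \<in> F \<Longrightarrow> 0 < snd R" and E: "\<And>R. R \<in> F \<Longrightarrow> E R \<in> sets lebesgue"
      "\<And>R. R \<in> F \<Longrightarrow> E R \<subseteq> cube R"
      "disjoint_family_on E F"
    and fm[measurable]: "f \<in> borel_measurable lebesgue"
    and f: "\<And>x. 0 \<le> f x" and N: "0 \<le> N" and m: "mor f N" and Q: "0 < snd Q"
    and large: "\<And>R. R \<in> F \<Longrightarrow> y \<in> cube R \<and> snd Q \<le> snd R" and y: "y \<in> cube Q"
  shows "(\<Sum>R\<in>F. enn2real (\<integral>\<^sup>+x\<in>E R. ennreal (f x) \<partial>lebesgue) / vol R) \<le> d3\<^sup>2 * N * K / (1 - 1 / \<theta>) / Wb Q"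
proof -
  define e where "e R = enn2real (\<integral>\<^sup>+x\<in>E R. ennreal (f x) \<partial>lebesgue)" for R
  have e: "ennreal (e R) = (\<integral>\<^sup>+x\<in>E R. ennreal (f x) \<partial>lebesgue)" if "R \<in> F" for R
  proof -
    have "(\<integral>\<^sup>+x\<in>E R. ennreal (f x) \<partial>lebesgue) \<le> nint f R"
      unfolding nint_def using E(2)[OF that] by (intro nn_integral_mono) (auto simp: indicator_def)
    also have "\<dots> < \<infinity>" using mass_le(1)[OF fm f N m F(2)[OF that]] by simp
    finally show ?thesis by (simp add: e_def)
  qed
  have e0: "0 \<le> e R" for R by (simp add: e_def)
  define l where "l = snd Q"
  define G where "G = d3\<^sup>2 * N * K / Wb Q"
  have G: "0 \<le> G" using N K d3 Wb_pos[OF Q] by (simp add: G_def)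
  have "\<exists>k::nat. 3 ^ k * l \<le> snd R \<and> snd R < 3 ^ (Suc k) * l" if "R \<in> F" for R
  proof -
    obtain n :: nat where n: "snd R / l < 3 ^ n" using real_arch_pow[of 3 "snd R / l"] by auto
    have l: "0 < l" "l \<le> snd R" using Q large[OF that] by (auto simp: l_def)
    have "snd R < 3 ^ (LEAST n. snd R < 3 ^ n * l) * l" (is "_ < 3 ^ ?n * l")
      by (rule LeastI[of _ n]) (use n l in \<open>simp add: field_simps\<close>)
    moreover from this l have "?n \<noteq> 0" by (metis mult_1 not_less power_0)
    then obtain k where k: "?n = Suc k" using not0_implies_Suc by blast
    then have "\<not> snd R < 3 ^ k * l" using not_less_Least[of k "\<lambda>n. snd R < 3 ^ n * l"] by simp
    ultimately show ?thesis using k by (intro exI[of _ k]) simp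
  qed
  then obtain \<kappa> :: "_ \<Rightarrow> nat" where \<kappa>: "\<And>R. R \<in> F \<Longrightarrow> 3 ^ \<kappa> R * l \<le> snd R \<and> snd R < 3 ^ (Suc (\<kappa> R)) * l"
    by metis
  have level: "(\<Sum>R\<in>{R \<in> F. \<kappa> R = k}. e R / vol R) \<le> G * (1 / \<theta>) ^ k" for k
  proof -
    define Fk where "Fk = {R \<in> F. \<kappa> R = k}"
    \<comment> \<open>One triple beyond the scale \<open>k\<close>: every \<open>R\<close> of this
      level is no larger than \<open>P\<close> and shares \<open>y\<close> with it, hence lies in
      \<open>triple P\<close>. The two extra triples account for \<open>d3\<^sup>2\<close> in the
      constant.\<close>
    define P where "P = (triple ^^ (Suc k)) Q"
    define V where "V = vol ((triple ^^ k) Q)"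
    have V: "0 < V" unfolding V_def using Q by (intro vol_pos) (simp add: triple_funpow)
    have P: "0 < snd P" "0 < snd (triple P)" using Q by (auto simp: P_def triple_funpow)
    have vP: "vol (triple P) = d3\<^sup>2 * V"
      by (simp add: P_def V_def vol_triple' power2_eq_square)
    have Fk: "finite Fk" "Fk \<subseteq> F" using F(1) by (auto simp: Fk_def)
    have sub: "cube R \<subseteq> cube (triple P)" if "R \<in> Fk" for R
    proof (rule cube_meets_subset_triple)
      show "y \<in> cube P" unfolding P_def using triple_funpow_subset[OF Q] y by blast
      show "y \<in> cube R" using that large Fk by blast
      show "snd R \<le> snd P" using \<kappa>[of R] that Fk by (auto simp: P_def triple_funpow l_def Fk_def mult.assoc)
    qed
    have volR: "V \<le> vol R" if "R \<in> Fk" for R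
    proof -
      have "(3 ^ k * l) ^ DIM('a) \<le> snd R ^ DIM('a)"
        using \<kappa>[of R] that Q by (intro power_mono) (auto simp: Fk_def l_def)
      then show ?thesis by (simp add: V_def vol_def triple_funpow l_def)
    qed
    have "ennreal (\<Sum>R\<in>Fk. e R) = (\<Sum>R\<in>Fk. ennreal (e R))" using e0 by (intro sum_ennreal[symmetric]) auto
    also have "\<dots> = (\<Sum>R\<in>Fk. \<integral>\<^sup>+x\<in>E R. ennreal (f x) \<partial>lebesgue)" using e Fk by (intro sum.cong) auto
    also have "\<dots> = (\<integral>\<^sup>+x. (\<Sum>R\<in>Fk. ennreal (f x) * indicator (E R) x) \<partial>lebesgue)"
      using E(1) Fk by (intro nn_integral_sum[symmetric]) auto
    also have "\<dots> \<le> nint f (triple P)"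
      unfolding nint_def
    proof (intro nn_integral_mono)
      fix x
      have disj: "disjoint_family_on E Fk" by (rule disjoint_family_on_mono[OF Fk(2) E(3)])
      show "(\<Sum>R\<in>Fk. ennreal (f x) * indicator (E R) x) \<le> ennreal (f x) * indicator (cube (triple P)) x"
      proof (cases rule: sum_disjoint_cases[OF Fk(1) disj, where g="\<lambda>R. ennreal (f x)" and x=x])
        case (2 R)
        then have "x \<in> cube (triple P)" using E(2)[of R] sub[OF 2(1)] Fk by blast
        then show ?thesis using 2 by simp
      qed auto
    qed
    also have "\<dots> = ennreal (mass f (triple P))" by (rule mass_le(1)[OF fm f N m P(2)])
    finally have "(\<Sum>R\<in>Fk. e R) \<le> mass f (triple P)" by simp
    also have "\<dots> \<le> N * K * (d3\<^sup>2 * V) / Wb (triple P)"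
      using mass_le(2)[OF fm f N m P(2)] by (simp add: vP)
    also have "\<dots> \<le> N * K * (d3\<^sup>2 * V) / (\<theta> ^ k * Wb Q)"
    proof (rule divide_left_mono)
      have "\<theta> ^ k * Wb Q \<le> Wb ((triple ^^ k) Q)" by (rule Wb_funpow_ge[OF Q])
      also have "\<dots> \<le> Wb (triple P)"
      proof (rule Wb_mono)
        have "cube ((triple ^^ k) Q) \<subseteq> cube ((triple ^^ 2) ((triple ^^ k) Q))"
          using Q by (intro triple_funpow_subset) (simp add: triple_funpow)
        then show "cube ((triple ^^ k) Q) \<subseteq> cube (triple P)" by (simp add: P_def numeral_2_eq_2)
      qed (use Q P in \<open>auto simp: triple_funpow\<close>)
      finally show "\<theta> ^ k * Wb Q \<le> Wb (triple P)" .
    qed (use N K d3 V \<theta> Wb_pos[OF Q] Wb_pos[OF P(2)] in auto)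
    finally have sum: "(\<Sum>R\<in>Fk. e R) \<le> V * (G * (1 / \<theta>) ^ k)"
      using \<theta> Wb_pos[OF Q] by (simp add: G_def field_simps)
    have "(\<Sum>R\<in>Fk. e R / vol R) \<le> (\<Sum>R\<in>Fk. e R / V)"
      using e0 volR V by (intro sum_mono divide_left_mono) (auto intro: mult_pos_pos less_le_trans)
    also have "\<dots> = (\<Sum>R\<in>Fk. e R) / V" by (simp add: sum_divide_distrib)
    also have "\<dots> \<le> G * (1 / \<theta>) ^ k" using sum V by (simp add: field_simps)
    finally show ?thesis by (simp add: Fk_def)
  qed
  have "(\<Sum>R\<in>F. e R / vol R) = (\<Sum>k\<in>\<kappa> ` F. \<Sum>R\<in>{R \<in> F. \<kappa> R = k}. e R / vol R)"
    using F(1) by (rule sum.image_gen)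
  also have "\<dots> \<le> (\<Sum>k\<in>\<kappa> ` F. G * (1 / \<theta>) ^ k)" by (intro sum_mono level)
  also have "\<dots> = G * (\<Sum>k\<in>\<kappa> ` F. (1 / \<theta>) ^ k)" by (simp add: sum_distrib_left)
  also have "\<dots> \<le> G * (1 / (1 - 1 / \<theta>))"
  proof (intro mult_left_mono G)
    have s: "(\<lambda>k. (1 / \<theta>) ^ k) sums (1 / (1 - 1 / \<theta>))" using \<theta> by (intro geometric_sums) simp
    have "(\<Sum>k\<in>\<kappa> ` F. (1 / \<theta>) ^ k) \<le> (\<Sum>k. (1 / \<theta>) ^ k)"
      using s F(1) \<theta> by (intro sum_le_suminf) (auto simp: sums_iff)
    then show "(\<Sum>k\<in>\<kappa> ` F. (1 / \<theta>) ^ k) \<le> 1 / (1 - 1 / \<theta>)" using s by (simp add: sums_iff)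
  qed
  finally show ?thesis by (simp add: e_def G_def mult.commute)
qed

lemma transpose_morrey:
  obtains C where "0 \<le> C" "\<And>F E f N. finite F \<Longrightarrow> (\<And>R. R \<in> F \<Longrightarrow> 0 < snd R) \<Longrightarrow>
    (\<And>R. R \<in> F \<Longrightarrow> E R \<in> sets lebesgue) \<Longrightarrow> (\<And>R. R \<in> F \<Longrightarrow> E R \<subseteq> cube R) \<Longrightarrow>
    disjoint_family_on E F \<Longrightarrow>
    f \<in> borel_measurable lebesgue \<Longrightarrow> (\<And>x. 0 \<le> f x) \<Longrightarrow> 0 \<le> N \<Longrightarrow> mor f N \<Longrightarrow>
    mor (\<lambda>y. \<Sum>R\<in>F. enn2real (\<integral>\<^sup>+x\<in>E R. ennreal (f x) \<partial>lebesgue) / vol R * indicator (cube R) y) (C * N)"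
proof (rule transpose_local)
  fix C0 assume C0: "0 \<le> C0" "\<And>F E f N P. finite F \<Longrightarrow> (\<And>R. R \<in> F \<Longrightarrow> 0 < snd R) \<Longrightarrow>
    (\<And>R. R \<in> F \<Longrightarrow> E R \<in> sets lebesgue) \<Longrightarrow> (\<And>R. R \<in> F \<Longrightarrow> E R \<subseteq> cube P) \<Longrightarrow>
    (\<And>R. R \<in> F \<Longrightarrow> E R \<subseteq> cube R) \<Longrightarrow>
    disjoint_family_on E F \<Longrightarrow>
    f \<in> borel_measurable lebesgue \<Longrightarrow> (\<And>x. 0 \<le> f x) \<Longrightarrow> 0 \<le> N \<Longrightarrow> mor f N \<Longrightarrow> 0 < snd P \<Longrightarrow>
    (\<integral>\<^sup>+y. ennreal (((\<Sum>R\<in>F. enn2real (\<integral>\<^sup>+x\<in>E R. ennreal (f x) \<partial>lebesgue) / vol R * indicator (cube R) y) * w y) powr a) \<partial>lebesgue)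
      \<le> ennreal ((C0 * N * vol P powr \<delta>) powr a)"
  define C2 where "C2 = d3\<^sup>2 * K / (1 - 1 / \<theta>)"
  have C2: "0 < C2" using d3 K \<theta> by (simp add: C2_def)
  \<comment> \<open>The local and the far part are added here, and
    \<open>T + M \<le> 2 * max T M\<close> brings in \<open>2 powr a\<close>.\<close>
  define C1 where "C1 = 2 powr a * ((C0 * d3 powr \<delta>) powr a + C2 powr a)"
  have C1: "0 < C1" using C2 by (auto simp: C1_def intro!: mult_pos_pos add_nonneg_pos)
  show thesis
  proof
    show "0 \<le> C1 powr (1 / a)" by simp
    fix F :: "('a \<times> real) set" and E and f :: "'a \<Rightarrow> real" and N
    assume F: "finite F" "\<And>R. R \<in> F \<Longrightarrow> 0 < snd R" and E: "\<And>R. R \<in> F \<Longrightarrow> E R \<in> sets lebesgue"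
      "\<And>R. R \<in> F \<Longrightarrow> E R \<subseteq> cube R"
      "disjoint_family_on E F"
      and fm[measurable]: "f \<in> borel_measurable lebesgue"
      and f: "\<And>x. 0 \<le> f x" and N: "0 \<le> N" and m: "mor f N"
    define e where "e R = enn2real (\<integral>\<^sup>+x\<in>E R. ennreal (f x) \<partial>lebesgue) / vol R" for R
    have e0: "0 \<le> e R" if "R \<in> F" for R using vol_pos[OF F(2)[OF that]] by (simp add: e_def)
    have "mor (\<lambda>y. \<Sum>R\<in>F. e R * indicator (cube R) y) (C1 powr (1 / a) * N)"
      unfolding mor_def
    proof (intro allI impI)
      fix Q :: "'a \<times> real" assume Q: "0 < snd Q"
      define P where "P = triple Q"
      have P: "0 < snd P" "vol P = d3 * vol Q" using Q by (auto simp: P_def vol_triple')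
      define F1 where "F1 = {R \<in> F. cube R \<subseteq> cube P}"
      have F1: "finite F1" "F1 \<subseteq> F" "\<And>R. R \<in> F1 \<Longrightarrow> cube R \<subseteq> cube P" using F(1) by (auto simp: F1_def)
      define T where "T y = (\<Sum>R\<in>F1. e R * indicator (cube R) y)" for y
      define M where "M = C2 * N / Wb Q"
      have M: "0 \<le> M" using C2 N Wb_pos[OF Q] by (simp add: M_def)
      have T0: "0 \<le> T y" for y unfolding T_def using F1(2) by (intro sum_nonneg mult_nonneg_nonneg e0) auto
      have [measurable]: "T \<in> borel_measurable lebesgue" unfolding T_def by measurable
      have local: "(\<integral>\<^sup>+y. ennreal ((T y * w y) powr a) \<partial>lebesgue) \<le> ennreal ((C0 * N * vol P powr \<delta>) powr a)"
        unfolding T_def e_def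
      proof (rule C0(2)[OF F1(1) _ _ _ _ disjoint_family_on_mono[OF F1(2) E(3)] fm f N m P(1)])
        show "E R \<subseteq> cube P" if "R \<in> F1" for R using E(2)[of R] F1(2) F1(3)[OF that] that by blast
      qed (use F E F1(2) in blast)+
      have point: "(\<Sum>R\<in>F. e R * indicator (cube R) y) \<le> T y + M" if y: "y \<in> cube Q" for y
      proof -
        define F2 where "F2 = {R \<in> F. \<not> cube R \<subseteq> cube P \<and> y \<in> cube R}"
        have F2: "finite F2" "F2 \<subseteq> F" using F(1) by (auto simp: F2_def)
        have "(\<Sum>R\<in>F. e R * indicator (cube R) y) = T y + (\<Sum>R\<in>F - F1. e R * indicator (cube R) y)"
          by (subst sum.subset_diff[OF F1(2) F(1)]) (simp add: T_def)
        also have "(\<Sum>R\<in>F - F1. e R * indicator (cube R) y) = (\<Sum>R\<in>F2. e R * indicator (cube R) y)"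
          using F(1) by (intro sum.mono_neutral_right) (auto simp: F1_def F2_def indicator_def)
        also have "\<dots> = (\<Sum>R\<in>F2. e R)" by (intro sum.cong) (auto simp: F2_def)
        also have "\<dots> \<le> d3\<^sup>2 * N * K / (1 - 1 / \<theta>) / Wb Q"
          unfolding e_def
        proof (rule transpose_far[OF F2(1) _ _ _ disjoint_family_on_mono[OF F2(2) E(3)] fm f N m Q _ y])
          fix R assume R: "R \<in> F2"
          then have "\<not> cube R \<subseteq> cube P" "y \<in> cube R" by (auto simp: F2_def)
          then show "y \<in> cube R \<and> snd Q \<le> snd R" using cube_meets_subset_triple[OF y, of R] unfolding P_def by force
        qed (use F E F2(2) in blast)+
        also have "\<dots> = M" by (simp add: M_def C2_def)
        finally show ?thesis by simp
      qed
      have "nint (\<lambda>y. ((\<Sum>R\<in>F. e R * indicator (cube R) y) * w y) powr a) Q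
        \<le> (\<integral>\<^sup>+y. ennreal (2 powr a) * ennreal ((T y * w y) powr a) + ennreal ((2 * M) powr a) * (ennreal (w y powr a) * indicator (cube Q) y) \<partial>lebesgue)"
        unfolding nint_def
      proof (intro nn_integral_mono)
        fix y
        show "ennreal (((\<Sum>R\<in>F. e R * indicator (cube R) y) * w y) powr a) * indicator (cube Q) y
          \<le> ennreal (2 powr a) * ennreal ((T y * w y) powr a) + ennreal ((2 * M) powr a) * (ennreal (w y powr a) * indicator (cube Q) y)"
        proof (cases "y \<in> cube Q")
          case True
          have s0: "0 \<le> (\<Sum>R\<in>F. e R * indicator (cube R) y)" by (intro sum_nonneg mult_nonneg_nonneg e0) simp_all
          have "(\<Sum>R\<in>F. e R * indicator (cube R) y) powr a \<le> (2 * max (T y) M) powr a"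
            using point[OF True] exps s0 by (intro powr_mono2) auto
          also have "\<dots> \<le> (2 * T y) powr a + (2 * M) powr a" by (simp add: max_def)
          finally have "((\<Sum>R\<in>F. e R * indicator (cube R) y) * w y) powr a \<le> ((2 * T y) powr a + (2 * M) powr a) * w y powr a"
            by (simp add: powr_mult mult_right_mono)
          also have "\<dots> = 2 powr a * (T y * w y) powr a + (2 * M) powr a * w y powr a"
            by (simp add: powr_mult distrib_right)
          finally show ?thesis using True
            by (simp add: ennreal_mult[symmetric] ennreal_plus[symmetric] ennreal_leI del: ennreal_plus)
        qed simp
      qed
      also have "\<dots> = ennreal (2 powr a) * (\<integral>\<^sup>+y. ennreal ((T y * w y) powr a) \<partial>lebesgue) + ennreal ((2 * M) powr a) * nint (\<lambda>x. w x powr a) Q"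
        unfolding nint_def by (subst nn_integral_add) (auto simp: nn_integral_cmult)
      also have "\<dots> \<le> ennreal (2 powr a) * ennreal ((C0 * N * vol P powr \<delta>) powr a) + ennreal ((2 * M) powr a) * ennreal ((Wb Q * vol Q powr \<delta>) powr a)"
        by (intro add_mono mult_left_mono nint_wa Q local) auto
      also have "\<dots> = ennreal (2 powr a * (C0 * N * vol P powr \<delta>) powr a + 2 powr a * (M * (Wb Q * vol Q powr \<delta>)) powr a)"
        by (simp add: ennreal_mult[symmetric] powr_mult mult.assoc)
      also have "2 powr a * (C0 * N * vol P powr \<delta>) powr a + 2 powr a * (M * (Wb Q * vol Q powr \<delta>)) powr a = (C1 powr (1 / a) * N * vol Q powr \<delta>) powr a"
      proof -
        have "M * (Wb Q * vol Q powr \<delta>) = C2 * (N * vol Q powr \<delta>)"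
          using Wb_pos[OF Q] by (simp add: M_def)
        moreover have "C0 * N * vol P powr \<delta> = (C0 * d3 powr \<delta>) * (N * vol Q powr \<delta>)" by (simp add: P powr_mult)
        ultimately have "2 powr a * (C0 * N * vol P powr \<delta>) powr a + 2 powr a * (M * (Wb Q * vol Q powr \<delta>)) powr a
          = 2 powr a * ((C0 * d3 powr \<delta>) powr a * (N * vol Q powr \<delta>) powr a) + 2 powr a * (C2 powr a * (N * vol Q powr \<delta>) powr a)"
          by (simp only: powr_mult[of "C0 * d3 powr \<delta>"] powr_mult[of C2])
        also have "\<dots> = C1 * (N * vol Q powr \<delta>) powr a" by (simp add: C1_def algebra_simps)
        also have "\<dots> = (C1 powr (1 / a)) powr a * (N * vol Q powr \<delta>) powr a" using C1 exps by (simp add: powr_powr)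
        finally show ?thesis by (simp add: powr_mult mult.assoc)
      qed
      finally show "nint (\<lambda>y. ((\<Sum>R\<in>F. e R * indicator (cube R) y) * w y) powr a) Q \<le> ennreal ((C1 powr (1 / a) * N * vol Q powr \<delta>) powr a)" .
    qed
    then show "mor (\<lambda>y. \<Sum>R\<in>F. enn2real (\<integral>\<^sup>+x\<in>E R. ennreal (f x) \<partial>lebesgue) / vol R * indicator (cube R) y) (C1 powr (1 / a) * N)"
      by (simp add: e_def)
  qed
qed

lemma mor_of_elems:
  assumes "f \<in> elems (morrey a b w)"
  shows "mor (\<lambda>x. \<bar>f x\<bar>) (enn2real (morrey_norm a b w f))"
  unfolding mor_def \<delta>_def
proof (intro allI impI)
  fix Q :: "'a \<times> real" assume Q: "0 < snd Q"
  have "morrey_norm a b w f < \<infinity>" using assms by (simp add: morrey_def)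
  from morrey_normD[OF exps(2) exps(5) this Q] wnn
  show "nint (\<lambda>x. (\<bar>f x\<bar> * w x) powr a) Q \<le> ennreal ((enn2real (morrey_norm a b w f) * vol Q powr (1 / a - 1 / b)) powr a)"
    by (simp add: abs_mult)
qed

lemma morrey_norm_le:
  assumes "mor f N" "\<And>x. 0 \<le> f x" "0 \<le> N"
  shows "morrey_norm a b w f \<le> ennreal N"
  using assms(1) unfolding morrey_norm_le_iff[OF exps(2) exps(5) assms(3)] mor_def \<delta>_def
  by (simp add: abs_mult assms(2) wnn)

lemma morrey_locally_integrable:
  assumes f: "f \<in> elems (morrey a b w)" and Q: "0 < snd Q"
  shows "nint (\<lambda>x. \<bar>f x\<bar>) Q < \<infinity>"
proof -
  have [measurable]: "f \<in> borel_measurable lebesgue" using f by (simp add: morrey_def L0_def)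
  have "nint (\<lambda>x. \<bar>f x\<bar>) Q = ennreal (mass (\<lambda>x. \<bar>f x\<bar>) Q)"
    by (rule mass_le(1)[OF _ _ _ mor_of_elems[OF f] Q]) auto
  then show ?thesis by simp
qed

text \<open>Indicators of cubes serve as test functions: pairing with them shows that elements of
  the Koethe dual are locally integrable and that their maximal functions are finite almost
  everywhere.\<close>

lemma indicator_in_morrey:
  assumes Q: "0 < snd Q"
  shows "(\<lambda>x. indicator (cube Q) x) \<in> elems (morrey a b w)"
proof -
  have "mor (\<lambda>x. indicator (cube Q) x) (Wb Q)"
    unfolding mor_def \<delta>_def
  proof (intro allI impI nint_powr_le[OF a(1) ab])
    fix P :: "'a \<times> real" assume P: "0 < snd P"
    have "nint (\<lambda>x. (indicator (cube Q) x * w x) powr b) P \<le> nint (\<lambda>x. w x powr b) Q"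
      unfolding nint_def by (intro nn_integral_mono) (auto simp: indicator_def)
    then show "nint (\<lambda>x. (indicator (cube Q) x * w x) powr b) P \<le> ennreal (Wb Q powr b)"
      by (simp add: nint_wb[OF Q])
  qed (use wnn Wb_pos[OF Q] in auto)
  then have "morrey_norm a b w (\<lambda>x. indicator (cube Q) x) \<le> ennreal (Wb Q)"
    using Wb_pos[OF Q] by (intro morrey_norm_le) auto
  then have "morrey_norm a b w (\<lambda>x. indicator (cube Q) x) < \<infinity>"
    by (rule le_less_trans) simp
  then show ?thesis by (simp add: morrey_def L0_def)
qed

lemma homogeneous: "homogeneous (morrey a b w)" and dominated: "dominated (morrey a b w)"
proof -
  have "AE x in lebesgue. w x \<noteq> 0" using wpos by (auto elim!: eventually_mono)
  then show "homogeneous (morrey a b w)" "dominated (morrey a b w)"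
    by (auto intro!: morrey_homogeneous morrey_dominated exps)
qed

lemma maximal_bounded_morrey: "maximal_bounded (morrey a b w)"
proof (rule fmax_morrey)
  fix C assume C: "0 < C" "\<And>F f N. finite F \<Longrightarrow> (\<And>Q. Q \<in> F \<Longrightarrow> 0 < snd Q) \<Longrightarrow> f \<in> borel_measurable lebesgue \<Longrightarrow>
    (\<And>x. 0 \<le> f x) \<Longrightarrow> 0 \<le> N \<Longrightarrow> mor f N \<Longrightarrow> mor (fmax F (avg f)) (C * N)"
  show ?thesis
    unfolding maximal_bounded_def
  proof (intro exI[of _ C] ballI)
    fix f assume f: "f \<in> elems (morrey a b w)"
    have [measurable]: "f \<in> borel_measurable lebesgue" using f by (simp add: morrey_def L0_def)
    define N where "N = enn2real (morrey_norm a b w f)"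
    have N: "0 \<le> N" "morrey_norm a b w f = ennreal N" using f by (auto simp: N_def morrey_def)
    show "(AE x in lebesgue. maximal f x < \<infinity>) \<and> (\<lambda>x. enn2real (maximal f x)) \<in> elems (morrey a b w) \<and>
      qnorm (morrey a b w) (\<lambda>x. enn2real (maximal f x)) \<le> ennreal C * qnorm (morrey a b w) f"
    proof (rule maximal_as_limit)
      fix F :: "nat \<Rightarrow> ('a \<times> real) set"
      assume F: "\<And>n. finite (F n)" "\<And>n Q. Q \<in> F n \<Longrightarrow> 0 < snd Q" "\<And>n. F n \<subseteq> F (Suc n)"
        and "\<And>f x. (\<And>Q. 0 < snd Q \<Longrightarrow> nint (\<lambda>x. \<bar>f x\<bar>) Q < \<infinity>) \<Longrightarrow> maximal f x = (SUP n. ennreal (fmax (F n) (avg f) x))"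
      then have Mf: "maximal f x = (SUP n. ennreal (fmax (F n) (avg f) x))" for x
        using morrey_locally_integrable[OF f] by blast
      have [measurable]: "fmax (F n) (avg f) \<in> borel_measurable lebesgue" for n by (rule fmax_measurable[OF F(1)])
      have meas: "(\<lambda>x. enn2real (maximal f x)) \<in> borel_measurable lebesgue" unfolding Mf by measurable
      have m: "mor (fmax (F n) (avg f)) (C * N)" for n
      proof -
        have "mor (fmax (F n) (avg (\<lambda>x. \<bar>f x\<bar>))) (C * N)"
          by (rule C(2)[OF F(1) F(2) _ _ N(1)]) (auto simp: N_def mor_of_elems[OF f])
        then show ?thesis by (simp add: avg_def[abs_def])
      qed
      have main: "nint (\<lambda>x. (enn2real (maximal f x) * w x) powr a) Q \<le> ennreal ((C * N * vol Q powr \<delta>) powr a) \<and>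
        (AE x in lebesgue. x \<in> cube Q \<longrightarrow> maximal f x < \<infinity>)" if Q: "0 < snd Q" for Q
      proof -
        \<comment> \<open>Cutting the weight \<open>w powr a\<close> off to \<open>Q\<close> turns
          the local inequality in \<open>mor\<close> into a weighted integral over the whole space,
          to which the monotone limit applies.\<close>
        have eq: "ennreal (g x powr a * (w x powr a * indicator (cube Q) x)) = ennreal ((g x * w x) powr a) * indicator (cube Q) x"
          for g :: "'a \<Rightarrow> real" and x
          by (auto simp: indicator_def powr_mult)
        have inc: "fmax (F n) (avg f) x \<le> fmax (F (Suc n)) (avg f) x" for n x
          by (rule fmax_mono[OF F(3) F(1)])
        have bnd: "(\<integral>\<^sup>+x. ennreal (fmax (F n) (avg f) x powr a * (w x powr a * indicator (cube Q) x)) \<partial>lebesgue)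
            \<le> ennreal ((C * N * vol Q powr \<delta>) powr a)" for n
          using m[of n] Q unfolding eq mor_def nint_def by blast
        have m0: "0 \<le> w x powr a * indicator (cube Q) x" for x by simp
        have mm: "(\<lambda>x. w x powr a * indicator (cube Q) x) \<in> borel_measurable lebesgue" by measurable
        note lim = monotone_limit_bound[where \<phi>="\<lambda>n. fmax (F n) (avg f)", OF \<open>\<And>n. fmax (F n) (avg f) \<in> _\<close> mm fmax_nonneg[OF F(1)] m0 inc exps(2) bnd, folded Mf]
        have "nint (\<lambda>x. (enn2real (maximal f x) * w x) powr a) Q \<le> ennreal ((C * N * vol Q powr \<delta>) powr a)"
          using lim(1) by (simp only: nint_def eq[of "\<lambda>x. enn2real (maximal f x)"])
        moreover have "AE x in lebesgue. 0 < w x powr a * indicator (cube Q) x \<longrightarrow> maximal f x < \<infinity>"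
          by (rule lim(2)) simp
        then have "AE x in lebesgue. x \<in> cube Q \<longrightarrow> maximal f x < \<infinity>"
          using wpos by eventually_elim auto
        ultimately show ?thesis ..
      qed
      have le: "morrey_norm a b w (\<lambda>x. enn2real (maximal f x)) \<le> ennreal (C * N)"
        using main C(1) N(1) by (intro morrey_norm_le) (auto simp: mor_def)
      have "AE x in lebesgue. maximal f x < \<infinity>"
      proof (rule AE_cubes)
        fix Q :: "'a \<times> real" assume "0 < snd Q"
        from main[OF this] show "AE x in lebesgue. x \<in> cube Q \<longrightarrow> maximal f x < \<infinity>" ..
      qed
      moreover have "(\<lambda>x. enn2real (maximal f x)) \<in> elems (morrey a b w)"
        using meas le_less_trans[OF le, of \<infinity>] by (simp add: morrey_def L0_def)
      moreover have "qnorm (morrey a b w) (\<lambda>x. enn2real (maximal f x)) \<le> ennreal C * qnorm (morrey a b w) f"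
        using le C(1) N by (simp add: morrey_def ennreal_mult)
      ultimately show ?thesis by blast
    qed
  qed
qed

text \<open>The linearisation \<open>fmax F c = (\<Sum>R\<in>F. c R * indicator (E R))\<close> allows one to move the maximal
  operator onto the Morrey function, where \<open>transpose_morrey\<close> applies.\<close>

lemma fmax_kothe_dual:
  obtains C where "0 \<le> C" "\<And>F g f. finite F \<Longrightarrow> (\<And>Q. Q \<in> F \<Longrightarrow> 0 < snd Q) \<Longrightarrow> g \<in> elems (kothe_dual (morrey a b w)) \<Longrightarrow>
    f \<in> elems (morrey a b w) \<Longrightarrow> (\<And>Q. 0 < snd Q \<Longrightarrow> nint (\<lambda>x. \<bar>g x\<bar>) Q < \<infinity>) \<Longrightarrow>
    (\<integral>\<^sup>+x. ennreal (fmax F (avg g) x * \<bar>f x\<bar>) \<partial>lebesgue)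
      \<le> ennreal C * morrey_norm a b w f * qnorm (kothe_dual (morrey a b w)) g"
proof (rule transpose_morrey)
  fix C assume C: "0 \<le> C" "\<And>F E f N. finite F \<Longrightarrow> (\<And>R. R \<in> F \<Longrightarrow> 0 < snd R) \<Longrightarrow>
    (\<And>R. R \<in> F \<Longrightarrow> E R \<in> sets lebesgue) \<Longrightarrow> (\<And>R. R \<in> F \<Longrightarrow> E R \<subseteq> cube R) \<Longrightarrow>
    disjoint_family_on E F \<Longrightarrow>
    f \<in> borel_measurable lebesgue \<Longrightarrow> (\<And>x. 0 \<le> f x) \<Longrightarrow> 0 \<le> N \<Longrightarrow> mor f N \<Longrightarrow>
    mor (\<lambda>y. \<Sum>R\<in>F. enn2real (\<integral>\<^sup>+x\<in>E R. ennreal (f x) \<partial>lebesgue) / vol R * indicator (cube R) y) (C * N)"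
  show thesis
  proof (rule that[OF C(1)])
    fix F :: "('a \<times> real) set" and g f
    assume F: "finite F" "\<And>Q. Q \<in> F \<Longrightarrow> 0 < snd Q" and g: "g \<in> elems (kothe_dual (morrey a b w))"
      and f: "f \<in> elems (morrey a b w)" and gfin: "\<And>Q. 0 < snd Q \<Longrightarrow> nint (\<lambda>x. \<bar>g x\<bar>) Q < \<infinity>"
    have [measurable]: "f \<in> borel_measurable lebesgue" "g \<in> borel_measurable lebesgue"
      using f g by (auto simp: morrey_def kothe_dual_def L0_def)
    define N where "N = enn2real (morrey_norm a b w f)"
    have N: "0 \<le> N" "morrey_norm a b w f = ennreal N" using f by (auto simp: N_def morrey_def)
    have mf: "mor (\<lambda>x. \<bar>f x\<bar>) N" using mor_of_elems[OF f] by (simp add: N_def)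
    have avg0: "0 \<le> avg g R" if "R \<in> F" for R using vol_pos[OF F(2)[OF that]] by (simp add: avg_def)
    show "(\<integral>\<^sup>+x. ennreal (fmax F (avg g) x * \<bar>f x\<bar>) \<partial>lebesgue)
      \<le> ennreal C * morrey_norm a b w f * qnorm (kothe_dual (morrey a b w)) g"
    proof (rule fmax_linearize[of F "avg g", OF F(1)])
      show "0 \<le> avg g R" if "R \<in> F" for R by (rule avg0[OF that])
      fix E assume E: "\<And>R. R \<in> F \<Longrightarrow> E R \<in> sets lebesgue" "\<And>R. R \<in> F \<Longrightarrow> E R \<subseteq> cube R"
        "disjoint_family_on E F" "\<And>x. fmax F (avg g) x = (\<Sum>R\<in>F. avg g R * indicator (E R) x)"
      define e where "e R = enn2real (\<integral>\<^sup>+x\<in>E R. ennreal \<bar>f x\<bar> \<partial>lebesgue)" for R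
      define T where "T y = (\<Sum>R\<in>F. e R / vol R * indicator (cube R) y)" for y
      have e0: "0 \<le> e R" for R by (simp add: e_def)
      have ev0: "0 \<le> e R / vol R" if "R \<in> F" for R using e0 vol_pos[OF F(2)[OF that]] by simp
      have T0: "0 \<le> T y" for y unfolding T_def by (intro sum_nonneg mult_nonneg_nonneg ev0) simp_all
      have [measurable]: "T \<in> borel_measurable lebesgue" unfolding T_def by measurable
      have e: "ennreal (e R) = (\<integral>\<^sup>+x\<in>E R. ennreal \<bar>f x\<bar> \<partial>lebesgue)" if "R \<in> F" for R
      proof -
        have "(\<integral>\<^sup>+x\<in>E R. ennreal \<bar>f x\<bar> \<partial>lebesgue) \<le> nint (\<lambda>x. \<bar>f x\<bar>) R"
          unfolding nint_def using E(2)[OF that] by (intro nn_integral_mono) (auto simp: indicator_def)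
        also have "\<dots> < \<infinity>" by (rule morrey_locally_integrable[OF f F(2)[OF that]])
        finally show ?thesis by (simp add: e_def)
      qed
      \<comment> \<open>\<open>T\<close> is the transpose applied to \<open>|f|\<close>. Once it is
        known to be a Morrey function, the integral of \<open>T * |g|\<close> is bounded by the dual
        norm of \<open>g\<close>.\<close>
      have "mor T (C * N)" unfolding T_def e_def
        by (rule C(2)[OF F E(1,2,3) _ _ N(1) mf]) auto
      then have nT: "morrey_norm a b w T \<le> ennreal (C * N)" using T0 C(1) N by (intro morrey_norm_le) auto
      then have T: "T \<in> elems (morrey a b w)"
        using le_less_trans[OF nT, of \<infinity>] by (simp add: morrey_def L0_def)
      have "(\<integral>\<^sup>+x. ennreal (fmax F (avg g) x * \<bar>f x\<bar>) \<partial>lebesgue)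
        = (\<integral>\<^sup>+x. (\<Sum>R\<in>F. ennreal (avg g R) * (ennreal \<bar>f x\<bar> * indicator (E R) x)) \<partial>lebesgue)"
      proof (intro nn_integral_cong)
        fix x
        have "fmax F (avg g) x * \<bar>f x\<bar> = (\<Sum>R\<in>F. avg g R * (\<bar>f x\<bar> * indicator (E R) x))"
          unfolding E(4) sum_distrib_right by (intro sum.cong) simp_all
        also have "ennreal \<dots> = (\<Sum>R\<in>F. ennreal (avg g R * (\<bar>f x\<bar> * indicator (E R) x)))"
          by (intro sum_ennreal[symmetric] mult_nonneg_nonneg avg0) simp_all
        also have "\<dots> = (\<Sum>R\<in>F. ennreal (avg g R) * (ennreal \<bar>f x\<bar> * indicator (E R) x))"
          by (intro sum.cong refl) (simp add: indicator_def ennreal_mult[OF avg0])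
        finally show "ennreal (fmax F (avg g) x * \<bar>f x\<bar>) = (\<Sum>R\<in>F. ennreal (avg g R) * (ennreal \<bar>f x\<bar> * indicator (E R) x))" .
      qed
      also have "\<dots> = (\<Sum>R\<in>F. ennreal (avg g R) * ennreal (e R))"
        using E(1) e by (subst nn_integral_sum) (auto intro!: sum.cong simp: nn_integral_cmult)
      also have "\<dots> = (\<Sum>R\<in>F. ennreal (e R / vol R) * nint (\<lambda>x. \<bar>g x\<bar>) R)"
      proof (intro sum.cong refl)
        fix R assume "R \<in> F"
        then have "0 < vol R" "nint (\<lambda>x. \<bar>g x\<bar>) R = ennreal (mass (\<lambda>x. \<bar>g x\<bar>) R)"
          using vol_pos[OF F(2)] nint_mass[OF gfin[OF F(2)]] by auto
        then show "ennreal (avg g R) * ennreal (e R) = ennreal (e R / vol R) * nint (\<lambda>x. \<bar>g x\<bar>) R"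
          using e0[of R] by (simp add: ennreal_mult[symmetric] avg_def mult.commute)
      qed
      also have "\<dots> = (\<integral>\<^sup>+y. (\<Sum>R\<in>F. ennreal (e R / vol R) * (ennreal \<bar>g y\<bar> * indicator (cube R) y)) \<partial>lebesgue)"
        unfolding nint_def by (subst nn_integral_sum) (auto intro!: sum.cong nn_integral_cmult[symmetric])
      also have "\<dots> = (\<integral>\<^sup>+y. ennreal \<bar>T y * g y\<bar> \<partial>lebesgue)"
      proof (intro nn_integral_cong)
        fix y
        have "\<bar>T y * g y\<bar> = T y * \<bar>g y\<bar>" using T0[of y] by (simp add: abs_mult)
        also have "\<dots> = (\<Sum>R\<in>F. e R / vol R * (\<bar>g y\<bar> * indicator (cube R) y))"
          unfolding T_def sum_distrib_right by (intro sum.cong) simp_all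
        also have "ennreal \<dots> = (\<Sum>R\<in>F. ennreal (e R / vol R * (\<bar>g y\<bar> * indicator (cube R) y)))"
          by (intro sum_ennreal[symmetric] mult_nonneg_nonneg ev0) simp_all
        also have "\<dots> = (\<Sum>R\<in>F. ennreal (e R / vol R) * (ennreal \<bar>g y\<bar> * indicator (cube R) y))"
        proof (intro sum.cong refl)
          fix R assume "R \<in> F"
          then have "0 \<le> e R / vol R" by (rule ev0)
          then show "ennreal (e R / vol R * (\<bar>g y\<bar> * indicator (cube R) y)) = ennreal (e R / vol R) * (ennreal \<bar>g y\<bar> * indicator (cube R) y)"
            using ennreal_mult[of "e R / vol R" "\<bar>g y\<bar>"] by (simp add: indicator_def)
        qed
        finally show "(\<Sum>R\<in>F. ennreal (e R / vol R) * (ennreal \<bar>g y\<bar> * indicator (cube R) y)) = ennreal \<bar>T y * g y\<bar>" by simp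
      qed
      also have "\<dots> \<le> morrey_norm a b w T * qnorm (kothe_dual (morrey a b w)) g"
        using kothe_holder[OF homogeneous T, of g] g by (simp add: morrey_def kothe_dual_def)
      also have "\<dots> \<le> ennreal (C * N) * qnorm (kothe_dual (morrey a b w)) g"
        by (intro mult_right_mono nT) simp
      also have "ennreal (C * N) = ennreal C * morrey_norm a b w f" using C(1) N by (simp add: ennreal_mult)
      finally show "(\<integral>\<^sup>+x. ennreal (fmax F (avg g) x * \<bar>f x\<bar>) \<partial>lebesgue)
        \<le> ennreal C * morrey_norm a b w f * qnorm (kothe_dual (morrey a b w)) g" .
    qed
  qed
qed

lemma maximal_bounded_kothe_dual: "maximal_bounded (kothe_dual (morrey a b w))"
proof (rule fmax_kothe_dual)
  let ?Z = "morrey a b w"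
  fix C assume C: "0 \<le> C" "\<And>F g f. finite F \<Longrightarrow> (\<And>Q. Q \<in> F \<Longrightarrow> 0 < snd Q) \<Longrightarrow> g \<in> elems (kothe_dual ?Z) \<Longrightarrow>
    f \<in> elems ?Z \<Longrightarrow> (\<And>Q. 0 < snd Q \<Longrightarrow> nint (\<lambda>x. \<bar>g x\<bar>) Q < \<infinity>) \<Longrightarrow>
    (\<integral>\<^sup>+x. ennreal (fmax F (avg g) x * \<bar>f x\<bar>) \<partial>lebesgue)
      \<le> ennreal C * morrey_norm a b w f * qnorm (kothe_dual ?Z) g"
  show ?thesis
    unfolding maximal_bounded_def
  proof (intro exI[of _ C] ballI)
    fix g assume g: "g \<in> elems (kothe_dual ?Z)"
    then have gL: "g \<in> L0" by (simp add: kothe_dual_def)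
    then have [measurable]: "g \<in> borel_measurable lebesgue" by (simp add: L0_def)
    \<comment> \<open>Membership in the dual only says that each product is integrable. A finite
      norm is what makes the bound on the finite maximal functions survive the limit with
      content.\<close>
    have gq: "qnorm (kothe_dual ?Z) g < \<infinity>" by (rule kothe_dual_finite[OF dominated g])
    have gfin: "nint (\<lambda>x. \<bar>g x\<bar>) Q < \<infinity>" if Q: "0 < snd Q" for Q
    proof -
      have "nint (\<lambda>x. \<bar>g x\<bar>) Q = (\<integral>\<^sup>+x. ennreal \<bar>indicator (cube Q) x * g x\<bar> \<partial>lebesgue)"
        unfolding nint_def by (intro nn_integral_cong) (simp add: indicator_def)
      also have "\<dots> \<le> qnorm ?Z (\<lambda>x. indicator (cube Q) x) * qnorm (kothe_dual ?Z) g"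
        by (rule kothe_holder[OF homogeneous indicator_in_morrey[OF Q] gL])
      also have "\<dots> < \<infinity>"
        using gq indicator_in_morrey[OF Q] by (simp add: ennreal_mult_less_top morrey_def)
      finally show ?thesis .
    qed
    show "(AE x in lebesgue. maximal g x < \<infinity>) \<and> (\<lambda>x. enn2real (maximal g x)) \<in> elems (kothe_dual ?Z) \<and>
      qnorm (kothe_dual ?Z) (\<lambda>x. enn2real (maximal g x)) \<le> ennreal C * qnorm (kothe_dual ?Z) g"
    proof (rule maximal_as_limit)
      fix F :: "nat \<Rightarrow> ('a \<times> real) set"
      assume F: "\<And>n. finite (F n)" "\<And>n Q. Q \<in> F n \<Longrightarrow> 0 < snd Q" "\<And>n. F n \<subseteq> F (Suc n)"
        and "\<And>f x. (\<And>Q. 0 < snd Q \<Longrightarrow> nint (\<lambda>x. \<bar>f x\<bar>) Q < \<infinity>) \<Longrightarrow> maximal f x = (SUP n. ennreal (fmax (F n) (avg f) x))"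
      then have Mg: "maximal g x = (SUP n. ennreal (fmax (F n) (avg g) x))" for x
        using gfin by blast
      have [measurable]: "fmax (F n) (avg g) \<in> borel_measurable lebesgue" for n by (rule fmax_measurable[OF F(1)])
      have meas[measurable]: "(\<lambda>x. enn2real (maximal g x)) \<in> borel_measurable lebesgue" unfolding Mg by measurable
      have inc: "fmax (F n) (avg g) x \<le> fmax (F (Suc n)) (avg g) x" for n x
        by (rule fmax_mono[OF F(3) F(1)])
      have main: "(\<integral>\<^sup>+x. ennreal (enn2real (maximal g x) * \<bar>f x\<bar>) \<partial>lebesgue)
          \<le> ennreal C * morrey_norm a b w f * qnorm (kothe_dual ?Z) g"
        "AE x in lebesgue. 0 < \<bar>f x\<bar> \<longrightarrow> maximal g x < \<infinity>" if f: "f \<in> elems ?Z" for f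
      proof -
        let ?B = "ennreal C * morrey_norm a b w f * qnorm (kothe_dual ?Z) g"
        have [measurable]: "f \<in> borel_measurable lebesgue" using f by (simp add: morrey_def L0_def)
        have B: "?B < \<infinity>" using f gq by (simp add: morrey_def ennreal_mult_less_top)
        \<comment> \<open>The limit lemma is used with exponent 1 and the test function
          \<open>|f|\<close> as weight.\<close>
        have bnd: "(\<integral>\<^sup>+x. ennreal (fmax (F n) (avg g) x powr 1 * \<bar>f x\<bar>) \<partial>lebesgue) \<le> ?B" for n
          using C(2)[OF F(1) F(2) g f gfin] by (simp add: fmax_nonneg[OF F(1)])
        have mm: "(\<lambda>x. \<bar>f x\<bar>) \<in> borel_measurable lebesgue" by measurable
        note lim = monotone_limit_bound[where \<phi>="\<lambda>n. fmax (F n) (avg g)" and m="\<lambda>x. \<bar>f x\<bar>", OF \<open>\<And>n. fmax (F n) (avg g) \<in> _\<close> mm fmax_nonneg[OF F(1)] abs_ge_zero inc zero_less_one bnd, folded Mg]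
        show "(\<integral>\<^sup>+x. ennreal (enn2real (maximal g x) * \<bar>f x\<bar>) \<partial>lebesgue) \<le> ?B" using lim(1) by simp
        show "AE x in lebesgue. 0 < \<bar>f x\<bar> \<longrightarrow> maximal g x < \<infinity>" by (rule lim(2)[OF B])
      qed
      have "AE x in lebesgue. maximal g x < \<infinity>"
      proof (rule AE_cubes)
        fix Q :: "'a \<times> real" assume "0 < snd Q"
        from main(2)[OF indicator_in_morrey[OF this]] show "AE x in lebesgue. x \<in> cube Q \<longrightarrow> maximal g x < \<infinity>"
          by eventually_elim simp
      qed
      moreover have "(\<lambda>x. enn2real (maximal g x)) \<in> elems (kothe_dual ?Z)"
      proof -
        have "integrable lebesgue (\<lambda>x. f x * enn2real (maximal g x))" if f: "f \<in> elems ?Z" for f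
        proof (rule integrableI_bounded)
          have [measurable]: "f \<in> borel_measurable lebesgue" using f by (simp add: morrey_def L0_def)
          show "(\<lambda>x. f x * enn2real (maximal g x)) \<in> borel_measurable lebesgue" by measurable
          have "(\<integral>\<^sup>+x. ennreal (norm (f x * enn2real (maximal g x))) \<partial>lebesgue)
              \<le> ennreal C * morrey_norm a b w f * qnorm (kothe_dual ?Z) g"
            using main(1)[OF f] by (simp add: abs_mult mult.commute)
          also have "\<dots> < \<infinity>" using f gq by (simp add: morrey_def ennreal_mult_less_top)
          finally show "(\<integral>\<^sup>+x. ennreal (norm (f x * enn2real (maximal g x))) \<partial>lebesgue) < \<infinity>" .
        qed
        then show ?thesis using meas by (simp add: kothe_dual_def L0_def)
      qed
      moreover have "qnorm (kothe_dual ?Z) (\<lambda>x. enn2real (maximal g x)) \<le> ennreal C * qnorm (kothe_dual ?Z) g"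
      proof -
        have "(\<integral>\<^sup>+x. ennreal \<bar>f x * enn2real (maximal g x)\<bar> \<partial>lebesgue) \<le> ennreal C * qnorm (kothe_dual ?Z) g"
          if "f \<in> elems ?Z" "qnorm ?Z f = 1" for f
          using main(1)[OF that(1)] that(2) by (simp add: abs_mult mult.commute morrey_def)
        then have "(SUP f\<in>{f \<in> elems ?Z. qnorm ?Z f = 1}. \<integral>\<^sup>+x. ennreal \<bar>f x * enn2real (maximal g x)\<bar> \<partial>lebesgue)
          \<le> ennreal C * qnorm (kothe_dual ?Z) g"
          by (intro SUP_least) auto
        then show ?thesis by (simp add: kothe_dual_def)
      qed
      ultimately show ?thesis by blast
    qed
  qed
qed

end

section \<open>The space \<open>X\<^sub>r\<^sub>,\<^sub>s\<close> of a Morrey space\<close>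

lemma ennreal_eqI_real_bounds:
  assumes "\<And>K. 0 \<le> K \<Longrightarrow> x \<le> ennreal K \<longleftrightarrow> y \<le> ennreal K"
  shows "x = y"
proof (rule antisym)
  show "x \<le> y"
  proof (cases y)
    case (real k)
    then show ?thesis using assms[of k] by simp
  qed simp
  show "y \<le> x"
  proof (cases x)
    case (real k)
    then show ?thesis using assms[of k] by simp
  qed simp
qed

lemma epowr_less_top: "epowr x c < top \<longleftrightarrow> x < top"
  by (cases x) (auto simp: epowr_ennreal)

lemma epowr_mult: "epowr (ennreal c * x) t = epowr (ennreal c) t * epowr x t" if "0 < c"
proof (cases x)
  case (real y)
  then show ?thesis using that by (simp add: ennreal_mult[symmetric] epowr_ennreal powr_mult)
next
  case top
  then show ?thesis using that by (simp add: ennreal_mult_top epowr_ennreal)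
qed

lemma epowr_eq_0: "epowr x t = 0 \<Longrightarrow> x = 0"
  by (cases x) (auto simp: epowr_ennreal)

lemma epowr_one [simp]: "epowr 1 c = 1"
  by (simp add: epowr_def)

lemma epowr_eq_1:
  assumes "0 < t" "epowr x t = 1"
  shows "x = 1"
proof -
  have "epowr x (t * (1 / t)) = epowr (epowr x t) (1 / t)" using assms(1) by (simp only: epowr_epowr)
  then show ?thesis using assms by simp
qed

text \<open>An equality of records: the two extended norms have the same real upper bounds for every
  function, so they agree outside the space as well.\<close>

lemma power_space_morrey:
  assumes r: "0 < r" and p: "0 < p" and q: "0 < q"
  shows "power_space (morrey p q v) r = morrey (p / r) (q / r) (\<lambda>x. \<bar>v x\<bar> powr r)"
proof -
  have eq: "epowr (morrey_norm p q v (\<lambda>x. \<bar>f x\<bar> powr (1 / r))) r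
      = morrey_norm (p / r) (q / r) (\<lambda>x. \<bar>v x\<bar> powr r) f" for f :: "'a \<Rightarrow> real"
  proof (rule ennreal_eqI_real_bounds)
    fix K :: real assume K: "0 \<le> K"
    have "epowr (morrey_norm p q v (\<lambda>x. \<bar>f x\<bar> powr (1 / r))) r \<le> ennreal K
        \<longleftrightarrow> morrey_norm p q v (\<lambda>x. \<bar>f x\<bar> powr (1 / r)) \<le> ennreal (K powr (1 / r))"
      using epowr_le_iff[OF r] K by (simp add: epowr_ennreal)
    also have "\<dots> \<longleftrightarrow> (\<forall>Q. 0 < snd Q \<longrightarrow> nint (\<lambda>x. \<bar>\<bar>f x\<bar> powr (1 / r) * v x\<bar> powr p) Q
        \<le> ennreal ((K powr (1 / r) * vol Q powr (1 / p - 1 / q)) powr p))"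
      using p q by (intro morrey_norm_le_iff) auto
    also have "\<dots> \<longleftrightarrow> (\<forall>Q. 0 < snd Q \<longrightarrow> nint (\<lambda>x. \<bar>f x * \<bar>v x\<bar> powr r\<bar> powr (p / r)) Q
        \<le> ennreal ((K * vol Q powr (1 / (p / r) - 1 / (q / r))) powr (p / r)))"
    proof -
      have 1: "\<bar>\<bar>f x\<bar> powr (1 / r) * v x\<bar> powr p = \<bar>f x * \<bar>v x\<bar> powr r\<bar> powr (p / r)" for x
        using r by (simp add: abs_mult powr_mult powr_powr)
      have 2: "(K powr (1 / r) * vol Q powr (1 / p - 1 / q)) powr p
          = (K * vol Q powr (1 / (p / r) - 1 / (q / r))) powr (p / r)" if Q: "0 < snd Q" for Q :: "'a \<times> real"
      proof -
        have "(1 / p - 1 / q) * p = (1 / (p / r) - 1 / (q / r)) * (p / r)" using r p q by (simp add: field_simps)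
        then show ?thesis by (simp add: powr_mult powr_powr)
      qed
      show ?thesis unfolding 1 using 2 by auto
    qed
    also have "\<dots> \<longleftrightarrow> morrey_norm (p / r) (q / r) (\<lambda>x. \<bar>v x\<bar> powr r) f \<le> ennreal K"
      using p q r K by (intro morrey_norm_le_iff[symmetric]) auto
    finally show "epowr (morrey_norm p q v (\<lambda>x. \<bar>f x\<bar> powr (1 / r))) r \<le> ennreal K
        \<longleftrightarrow> morrey_norm (p / r) (q / r) (\<lambda>x. \<bar>v x\<bar> powr r) f \<le> ennreal K" .
  qed
  have "(\<lambda>x. \<bar>f x\<bar> powr (1 / r)) \<in> L0" if "f \<in> L0" for f :: "'a \<Rightarrow> real"
  proof -
    have [measurable]: "f \<in> borel_measurable lebesgue" using that by (simp add: L0_def)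
    show ?thesis unfolding L0_def by measurable
  qed
  moreover have "morrey_norm p q v (\<lambda>x. \<bar>f x\<bar> powr (1 / r)) < top \<longleftrightarrow>
      morrey_norm (p / r) (q / r) (\<lambda>x. \<bar>v x\<bar> powr r) f < top" for f :: "'a \<Rightarrow> real"
    unfolding eq[symmetric] epowr_less_top ..
  ultimately show ?thesis
    unfolding power_space_def morrey_def by (auto simp: eq)
qed

text \<open>No integrability of \<open>v\<close> is assumed, so indicators of cubes need not belong
  to the space. The inverse of \<open>v\<close> on a cube does, and it is nonzero wherever
  \<open>v\<close> is; it takes over as the test function.\<close>

lemma inverse_weight_in_morrey:
  fixes v :: "'a::euclidean_space \<Rightarrow> real"
  assumes pq: "1 < p" "p \<le> q" and [measurable]: "v \<in> borel_measurable lebesgue" and Q: "0 < snd Q"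
  shows "(\<lambda>x. inverse (v x) * indicator (cube Q) x) \<in> elems (morrey p q v)"
proof -
  have "morrey_norm p q v (\<lambda>x. inverse (v x) * indicator (cube Q) x) \<le> ennreal (vol Q powr (1 / q))"
  proof (subst morrey_norm_le_iff, use pq in simp, use pq in simp, simp, intro allI impI)
    fix R :: "'a \<times> real" assume R: "0 < snd R"
    have "nint (\<lambda>x. \<bar>inverse (v x) * indicator (cube Q) x * v x\<bar> powr p) R \<le> nint (\<lambda>x. indicator (cube Q) x powr p) R"
      unfolding nint_def
    proof (intro nn_integral_mono)
      fix x
      show "ennreal (\<bar>inverse (v x) * indicator (cube Q) x * v x\<bar> powr p) * indicator (cube R) x
          \<le> ennreal (indicator (cube Q) x powr p) * indicator (cube R) x"
        by (cases "v x = 0") (auto simp: indicator_def)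
    qed
    also have "\<dots> \<le> ennreal ((vol Q powr (1 / q) * vol R powr (1 / p - 1 / q)) powr p)"
    proof (rule nint_powr_le[OF pq _ _ _ R])
      have "nint (\<lambda>x. indicator (cube Q) x powr q) R \<le> (\<integral>\<^sup>+x. indicator (cube Q) x \<partial>lebesgue)"
        unfolding nint_def using pq by (intro nn_integral_mono) (auto simp: indicator_def)
      then show "nint (\<lambda>x. indicator (cube Q) x powr q) R \<le> ennreal ((vol Q powr (1 / q)) powr q)"
        using pq emeasure_cube[OF Q] vol_pos[OF Q] by (simp add: powr_powr)
    qed auto
    finally show "nint (\<lambda>x. \<bar>inverse (v x) * indicator (cube Q) x * v x\<bar> powr p) R
      \<le> ennreal ((vol Q powr (1 / q) * vol R powr (1 / p - 1 / q)) powr p)" .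
  qed
  then have "morrey_norm p q v (\<lambda>x. inverse (v x) * indicator (cube Q) x) < \<infinity>"
    by (rule le_less_trans) simp
  then show ?thesis by (simp add: morrey_def L0_def)
qed

lemma qnorm_kothe_dual_scale:
  assumes c: "0 < c" and X: "elems X \<subseteq> L0" and g: "g \<in> L0"
  shows "qnorm (kothe_dual X) (\<lambda>x. c * g x) = ennreal c * qnorm (kothe_dual X) g"
proof -
  have "(\<integral>\<^sup>+x. ennreal \<bar>f x * (c * g x)\<bar> \<partial>lebesgue) = ennreal c * (\<integral>\<^sup>+x. ennreal \<bar>f x * g x\<bar> \<partial>lebesgue)"
    if "f \<in> elems X" for f
  proof -
    have [measurable]: "f \<in> borel_measurable lebesgue" "g \<in> borel_measurable lebesgue"
      using that X g by (auto simp: L0_def)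
    have "(\<integral>\<^sup>+x. ennreal \<bar>f x * (c * g x)\<bar> \<partial>lebesgue) = (\<integral>\<^sup>+x. ennreal c * ennreal \<bar>f x * g x\<bar> \<partial>lebesgue)"
      using c by (intro nn_integral_cong) (simp add: ennreal_mult[symmetric] abs_mult mult.left_commute)
    also have "\<dots> = ennreal c * (\<integral>\<^sup>+x. ennreal \<bar>f x * g x\<bar> \<partial>lebesgue)" by (rule nn_integral_cmult) measurable
    finally show ?thesis .
  qed
  then have "qnorm (kothe_dual X) (\<lambda>x. c * g x)
     = (SUP f\<in>{f \<in> elems X. qnorm X f = 1}. ennreal c * (\<integral>\<^sup>+x. ennreal \<bar>f x * g x\<bar> \<partial>lebesgue))"
    unfolding kothe_dual_def by (auto intro!: SUP_cong)
  also have "\<dots> = ennreal c * qnorm (kothe_dual X) g"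
    by (simp add: kothe_dual_def SUP_mult_left_ennreal)
  finally show ?thesis .
qed

text \<open>To be used with \<open>P = p / r\<close>, \<open>Q\<^sub>1 = q / r\<close> and the
  weight \<open>|v| powr r\<close>, that is, for the r-th power of the given Morrey space, and with
  \<open>\<tau>\<close> equal to \<open>(s/r)'\<close>. The equation for \<open>a\<close> says
  \<open>a' = P' / \<tau>\<close>; the one for \<open>b\<close> makes the powers of the volume agree
  after raising to the power \<open>\<tau>\<close>.\<close>

locale rs_morrey =
  fixes P Q\<^sub>1 \<tau> a b :: real and v :: "'a::euclidean_space \<Rightarrow> real"
  assumes P: "1 < P" "P \<le> Q\<^sub>1" and \<tau>: "1 \<le> \<tau>" and a: "1 < a" "1 / a = 1 - \<tau> * (1 - 1 / P)"
    and b: "0 < b" "1 / a - 1 / b = \<tau> * (1 / P - 1 / Q\<^sub>1)"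
    and v[measurable]: "v \<in> borel_measurable lebesgue" and vnn: "\<And>x. 0 \<le> v x" and vpos: "AE x in lebesgue. 0 < v x"
begin

definition X :: "'a fspace" where "X = morrey P Q\<^sub>1 v"

definition S :: "'a fspace" where "S = power_space (kothe_dual X) \<tau>"

definition w :: "'a \<Rightarrow> real" where "w x = v x powr \<tau>"

lemma w_measurable [measurable]: "w \<in> borel_measurable lebesgue"
  unfolding w_def by measurable

lemma Ppos: "0 < P" "0 < Q\<^sub>1" "0 < \<tau>" "0 < a" using P \<tau> a by auto

section \<open>The space \<open>S\<close>: homogeneity, majorants and its unit ball\<close>

lemma homogeneous_X: "homogeneous X" and dominated_X: "dominated X"
proof -
  have "AE x in lebesgue. v x \<noteq> 0" using vpos by (auto elim!: eventually_mono)
  then show "homogeneous X" "dominated X"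
    unfolding X_def by (auto intro!: morrey_homogeneous morrey_dominated Ppos)
qed

lemma elems_X: "h \<in> elems X \<Longrightarrow> h \<in> borel_measurable lebesgue"
  by (simp add: X_def morrey_def L0_def)

lemma AE_of_elems_X:
  assumes "\<And>h. h \<in> elems X \<Longrightarrow> AE x in lebesgue. h x \<noteq> 0 \<longrightarrow> R x"
  shows "AE x in lebesgue. R x"
proof (rule AE_cubes)
  fix Q :: "'a \<times> real" assume "0 < snd Q"
  from assms[OF inverse_weight_in_morrey[OF P v this, folded X_def]] vpos
  show "AE x in lebesgue. x \<in> cube Q \<longrightarrow> R x" by eventually_elim auto
qed

lemma dual_X_finite: "g \<in> elems (kothe_dual X) \<Longrightarrow> qnorm (kothe_dual X) g < \<infinity>"
  by (rule kothe_dual_finite[OF dominated_X])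

lemma elems_S:
  assumes "f \<in> elems S"
  shows "f \<in> borel_measurable lebesgue" "(\<lambda>x. \<bar>f x\<bar> powr (1 / \<tau>)) \<in> elems (kothe_dual X)"
  using assms by (auto simp: S_def power_space_def L0_def)

lemma dual_X_holder:
  assumes "h \<in> elems X" "g \<in> elems (kothe_dual X)"
  shows "(\<integral>\<^sup>+x. ennreal \<bar>h x * g x\<bar> \<partial>lebesgue) \<le> qnorm X h * qnorm (kothe_dual X) g"
  using assms by (intro kothe_holder homogeneous_X) (auto simp: kothe_dual_def)

lemma homogeneous_S: "homogeneous S"
  unfolding homogeneous_def
proof (intro conjI ballI allI impI)
  show "elems S \<subseteq> L0" by (auto simp: S_def power_space_def)
  fix f assume f: "f \<in> elems S"
  define g where "g x = \<bar>f x\<bar> powr (1 / \<tau>)" for x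
  have [measurable]: "f \<in> borel_measurable lebesgue" and g: "g \<in> elems (kothe_dual X)"
    using elems_S[OF f] by (simp_all add: g_def[abs_def])
  have gL: "g \<in> L0" using g by (simp add: kothe_dual_def)
  have qf: "qnorm S f = epowr (qnorm (kothe_dual X) g) \<tau>" by (simp add: S_def power_space_def g_def[abs_def])
  show "qnorm S f < \<infinity>" using dual_X_finite[OF g] by (simp add: qf epowr_less_top)
  show "AE x in lebesgue. f x = 0" if "qnorm S f = 0"
  proof (rule AE_of_elems_X)
    fix h assume h: "h \<in> elems X"
    note elems_X[OF h, measurable]
    have [measurable]: "g \<in> borel_measurable lebesgue" using gL by (simp add: L0_def)
    have "qnorm (kothe_dual X) g = 0" using that epowr_eq_0 by (simp add: qf)
    then have "(\<integral>\<^sup>+x. ennreal \<bar>h x * g x\<bar> \<partial>lebesgue) = 0" using dual_X_holder[OF h g] by simp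
    then have "AE x in lebesgue. ennreal \<bar>h x * g x\<bar> = 0" by (subst (asm) nn_integral_0_iff_AE) auto
    then show "AE x in lebesgue. h x \<noteq> 0 \<longrightarrow> f x = 0"
      by eventually_elim (auto simp: g_def ennreal_eq_0_iff)
  qed
  fix c :: real assume c: "0 < c"
  have cg: "\<bar>c * f x\<bar> powr (1 / \<tau>) = c powr (1 / \<tau>) * g x" for x
    using c by (simp add: g_def abs_mult powr_mult)
  have "(\<lambda>x. c powr (1 / \<tau>) * g x) \<in> elems (kothe_dual X)"
  proof -
    have "integrable lebesgue (\<lambda>x. h x * (c powr (1 / \<tau>) * g x))" if "h \<in> elems X" for h
    proof -
      have "integrable lebesgue (\<lambda>x. h x * g x)" using g that by (simp add: kothe_dual_def)
      then have "integrable lebesgue (\<lambda>x. c powr (1 / \<tau>) * (h x * g x))" by (rule integrable_mult_right)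
      then show ?thesis by (simp only: mult.left_commute)
    qed
    moreover have "(\<lambda>x. c powr (1 / \<tau>) * g x) \<in> L0"
    proof -
      have [measurable]: "g \<in> borel_measurable lebesgue" using gL by (simp add: L0_def)
      show ?thesis unfolding L0_def by measurable
    qed
    ultimately show ?thesis by (simp add: kothe_dual_def)
  qed
  then show "(\<lambda>x. c * f x) \<in> elems S"
    by (simp add: S_def power_space_def cg L0_def)
  have "qnorm S (\<lambda>x. c * f x) = epowr (qnorm (kothe_dual X) (\<lambda>x. c powr (1 / \<tau>) * g x)) \<tau>"
    by (simp add: S_def power_space_def cg)
  also have "\<dots> = epowr (ennreal (c powr (1 / \<tau>)) * qnorm (kothe_dual X) g) \<tau>"
    using homogeneous_X c gL by (subst qnorm_kothe_dual_scale) (auto simp: homogeneous_def)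
  also have "\<dots> = ennreal c * qnorm S f"
    using c Ppos by (simp add: epowr_mult epowr_ennreal powr_powr qf)
  finally show "qnorm S (\<lambda>x. c * f x) = ennreal c * qnorm S f" .
qed

text \<open>The norm of \<open>S\<close> is described by pairings with all \<open>h\<close> in
  \<open>X\<close>. For each \<open>h\<close> the function of \<open>dominating_function\<close> is
  tested with exponent \<open>1 / \<tau>\<close> and weight \<open>|h|\<close>, and the same
  function works for all of them.\<close>

lemma dominated_S: "dominated S"
  unfolding dominated_def
proof (intro conjI allI impI)
  show "elems S \<subseteq> L0" by (auto simp: S_def power_space_def)
  fix f :: "nat \<Rightarrow> 'a \<Rightarrow> real"
  assume f: "\<forall>j. f j \<in> elems S \<and> qnorm S (f j) = 1"
  then have fm: "\<And>j. f j \<in> borel_measurable lebesgue" using elems_S by blast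
  note fm[measurable]
  show "\<exists>F\<in>elems S. \<forall>j. AE x in lebesgue. \<bar>f j x\<bar> \<le> 2 ^ j * \<bar>F x\<bar>"
  proof (rule dominating_function[of f, OF fm])
    fix F assume F: "F \<in> borel_measurable lebesgue" "\<And>x. 0 \<le> F x"
      "\<And>e m K. 0 < e \<Longrightarrow> m \<in> borel_measurable lebesgue \<Longrightarrow> (\<And>x. 0 \<le> m x) \<Longrightarrow> 0 \<le> K \<Longrightarrow>
       (\<And>j. (\<integral>\<^sup>+x. ennreal (\<bar>f j x\<bar> powr e * m x) \<partial>lebesgue) \<le> ennreal K) \<Longrightarrow>
       (\<integral>\<^sup>+x. ennreal (F x powr e * m x) \<partial>lebesgue) \<le> ennreal (K / (1 - 2 powr - e)) \<and>
       (AE x in lebesgue. 0 < m x \<longrightarrow> (\<forall>j. \<bar>f j x\<bar> \<le> 2 ^ j * F x))"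
    note F(1)[measurable]
    have main: "(\<integral>\<^sup>+x. ennreal (F x powr (1 / \<tau>) * \<bar>h x\<bar>) \<partial>lebesgue) \<le> ennreal (enn2real (qnorm X h) / (1 - 2 powr - (1 / \<tau>))) \<and>
       (AE x in lebesgue. 0 < \<bar>h x\<bar> \<longrightarrow> (\<forall>j. \<bar>f j x\<bar> \<le> 2 ^ j * F x))" if h: "h \<in> elems X" for h
    proof (rule F(3))
      fix j
      have fj: "f j \<in> elems S" "qnorm S (f j) = 1" using f by auto
      have "epowr (qnorm (kothe_dual X) (\<lambda>x. \<bar>f j x\<bar> powr (1 / \<tau>))) \<tau> = 1"
        using fj(2) by (simp add: S_def power_space_def)
      then have "qnorm (kothe_dual X) (\<lambda>x. \<bar>f j x\<bar> powr (1 / \<tau>)) = 1" by (rule epowr_eq_1[OF Ppos(3)])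
      then have "(\<integral>\<^sup>+x. ennreal \<bar>h x * \<bar>f j x\<bar> powr (1 / \<tau>)\<bar> \<partial>lebesgue) \<le> qnorm X h"
        using dual_X_holder[OF h elems_S(2)[OF fj(1)]] by simp
      moreover have "qnorm X h < \<infinity>" using homogeneous_X h by (simp add: homogeneous_def)
      ultimately show "(\<integral>\<^sup>+x. ennreal (\<bar>f j x\<bar> powr (1 / \<tau>) * \<bar>h x\<bar>) \<partial>lebesgue) \<le> ennreal (enn2real (qnorm X h))"
        by (simp add: abs_mult mult.commute)
    qed (use Ppos elems_X[OF h] in auto)
    have "(\<lambda>x. F x powr (1 / \<tau>)) \<in> elems (kothe_dual X)"
    proof -
      have "integrable lebesgue (\<lambda>x. h x * F x powr (1 / \<tau>))" if h: "h \<in> elems X" for h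
      proof (rule integrableI_bounded)
        note elems_X[OF h, measurable]
        show "(\<lambda>x. h x * F x powr (1 / \<tau>)) \<in> borel_measurable lebesgue" by measurable
        have "(\<integral>\<^sup>+x. ennreal (norm (h x * F x powr (1 / \<tau>))) \<partial>lebesgue) \<le> ennreal (enn2real (qnorm X h) / (1 - 2 powr - (1 / \<tau>)))"
          using main[OF h] by (simp add: abs_mult mult.commute)
        then show "(\<integral>\<^sup>+x. ennreal (norm (h x * F x powr (1 / \<tau>))) \<partial>lebesgue) < \<infinity>"
          by (rule le_less_trans) simp
      qed
      then show ?thesis by (simp add: kothe_dual_def L0_def)
    qed
    then have "F \<in> elems S" using F(1,2) by (simp add: S_def power_space_def L0_def)
    moreover have "AE x in lebesgue. \<forall>j. \<bar>f j x\<bar> \<le> 2 ^ j * F x"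
    proof (rule AE_of_elems_X)
      fix h assume "h \<in> elems X"
      from main[OF this] have "AE x in lebesgue. 0 < \<bar>h x\<bar> \<longrightarrow> (\<forall>j. \<bar>f j x\<bar> \<le> 2 ^ j * F x)" ..
      then show "AE x in lebesgue. h x \<noteq> 0 \<longrightarrow> (\<forall>j. \<bar>f j x\<bar> \<le> 2 ^ j * F x)"
        by eventually_elim auto
    qed
    then have "AE x in lebesgue. \<bar>f j x\<bar> \<le> 2 ^ j * \<bar>F x\<bar>" for j
      using F(2) by (auto elim!: eventually_mono)
    ultimately show "\<exists>F\<in>elems S. \<forall>j. AE x in lebesgue. \<bar>f j x\<bar> \<le> 2 ^ j * \<bar>F x\<bar>" by (intro bexI allI)
  qed
qed

lemma unit_ball_S:
  assumes [measurable]: "\<phi> \<in> borel_measurable lebesgue" and nn: "\<And>x. 0 \<le> \<phi> x"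
    and le: "\<forall>h\<in>elems X. (\<integral>\<^sup>+x. ennreal (\<phi> x powr (1 / \<tau>) * \<bar>h x\<bar>) \<partial>lebesgue) \<le> qnorm X h"
  shows "\<phi> \<in> elems S" "qnorm S \<phi> \<le> 1"
proof -
  have le': "(\<integral>\<^sup>+x. ennreal \<bar>h x * \<phi> x powr (1 / \<tau>)\<bar> \<partial>lebesgue) \<le> qnorm X h" if "h \<in> elems X" for h
    using le that by (simp add: abs_mult mult.commute)
  have "integrable lebesgue (\<lambda>x. h x * \<phi> x powr (1 / \<tau>))" if h: "h \<in> elems X" for h
  proof (rule integrableI_bounded)
    note elems_X[OF h, measurable]
    show "(\<lambda>x. h x * \<phi> x powr (1 / \<tau>)) \<in> borel_measurable lebesgue" by measurable
    have "qnorm X h < \<infinity>" using homogeneous_X h by (simp add: homogeneous_def)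
    then show "(\<integral>\<^sup>+x. ennreal (norm (h x * \<phi> x powr (1 / \<tau>))) \<partial>lebesgue) < \<infinity>"
      using le'[OF h] by (simp add: le_less_trans)
  qed
  then show "\<phi> \<in> elems S" using nn by (simp add: S_def power_space_def kothe_dual_def L0_def)
  have "qnorm (kothe_dual X) (\<lambda>x. \<phi> x powr (1 / \<tau>)) \<le> 1"
    unfolding kothe_dual_def by (auto intro!: SUP_least order_trans[OF le'])
  then have "epowr (qnorm (kothe_dual X) (\<lambda>x. \<phi> x powr (1 / \<tau>))) \<tau> \<le> epowr 1 \<tau>"
    using Ppos by (intro epowr_mono) auto
  then show "qnorm S \<phi> \<le> 1" using nn by (simp add: S_def power_space_def)
qed

section \<open>Duality between \<open>S\<close> and the Morrey space with exponents
  \<open>a\<close>, \<open>b\<close>\<close>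

definition P' :: real where "P' = 1 / (1 - 1 / P)"

definition a' :: real where "a' = P' / \<tau>"

lemma P': "1 / P + 1 / P' = 1" "1 / a + 1 / a' = 1"
proof -
  have p: "0 < 1 - 1 / P" using P by simp
  then show "1 / P + 1 / P' = 1" by (simp add: P'_def)
  have "1 / a' = \<tau> * (1 - 1 / P)" using p Ppos by (simp add: a'_def P'_def)
  then show "1 / a + 1 / a' = 1" using a(2) by simp
qed

text \<open>The functions \<open>u * w\<close> on one cube, scaled by a power of its volume, are
  blocks in the unit ball of \<open>S\<close>. Their power \<open>1 / \<tau>\<close> is a scaled
  \<open>u powr (1 / \<tau>) * v\<close>, and Hoelder on \<open>Q\<close> in the exponents
  \<open>P\<close>, \<open>P'\<close> applies because \<open>P' / \<tau> = a'\<close>.\<close>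

lemma test_function:
  assumes [measurable]: "u \<in> borel_measurable lebesgue" and u: "\<And>x. 0 \<le> u x"
    and u1: "(\<integral>\<^sup>+x. ennreal (u x powr a') \<partial>lebesgue) \<le> 1" and Q: "0 < snd Q" and h: "h \<in> elems X"
  shows "(\<integral>\<^sup>+x. ennreal ((u x * w x * indicator (cube Q) x * vol Q powr - (1 / a - 1 / b)) powr (1 / \<tau>) * \<bar>h x\<bar>) \<partial>lebesgue) \<le> qnorm X h"
proof -
  note elems_X[OF h, measurable]
  define V where "V = vol Q powr - (1 / P - 1 / Q\<^sub>1)"
  have eq: "ennreal ((u x * w x * indicator (cube Q) x * vol Q powr - (1 / a - 1 / b)) powr (1 / \<tau>) * \<bar>h x\<bar>)
     = ennreal V * (ennreal ((\<bar>h x\<bar> * v x) * u x powr (1 / \<tau>)) * indicator (cube Q) x)" for x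
  proof (cases "x \<in> cube Q")
    case True
    have "(u x * w x * vol Q powr - (1 / a - 1 / b)) powr (1 / \<tau>) = u x powr (1 / \<tau>) * v x * V"
      unfolding b(2) using Ppos vnn[of x] by (simp add: powr_mult powr_powr w_def V_def)
    then show ?thesis using True vnn[of x] u[of x] by (simp add: ennreal_mult[symmetric] V_def mult.commute mult.left_commute)
  qed simp
  have fin: "morrey_norm P Q\<^sub>1 v h < \<infinity>" using h by (simp add: X_def morrey_def)
  define N where "N = enn2real (morrey_norm P Q\<^sub>1 v h)"
  have N: "0 \<le> N" "morrey_norm P Q\<^sub>1 v h = ennreal N" using fin by (auto simp: N_def)
  have "nint (\<lambda>x. (\<bar>h x\<bar> * v x) * u x powr (1 / \<tau>)) Q \<le> ennreal ((N * vol Q powr (1 / P - 1 / Q\<^sub>1)) * 1)"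
  proof (rule holder_cube[OF P(1) P'(1)])
    show "nint (\<lambda>x. (\<bar>h x\<bar> * v x) powr P) Q \<le> ennreal ((N * vol Q powr (1 / P - 1 / Q\<^sub>1)) powr P)"
      using morrey_normD[OF Ppos(1,2) fin Q] vnn by (simp add: N_def abs_mult)
    have "nint (\<lambda>x. (u x powr (1 / \<tau>)) powr P') Q \<le> (\<integral>\<^sup>+x. ennreal (u x powr a') \<partial>lebesgue)"
      unfolding nint_def by (intro nn_integral_mono) (auto simp: indicator_def powr_powr a'_def)
    then show "nint (\<lambda>x. (u x powr (1 / \<tau>)) powr P') Q \<le> ennreal (1 powr P')" using u1 by simp
  qed (use vnn N in auto)
  then have "ennreal V * nint (\<lambda>x. (\<bar>h x\<bar> * v x) * u x powr (1 / \<tau>)) Q \<le> ennreal V * ennreal (N * vol Q powr (1 / P - 1 / Q\<^sub>1))"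
    by (intro mult_left_mono) auto
  also have "\<dots> = ennreal N"
  proof -
    have "V * vol Q powr (1 / P - 1 / Q\<^sub>1) = 1"
      unfolding V_def powr_add[symmetric] using vol_pos[OF Q] by simp
    then have "V * (N * vol Q powr (1 / P - 1 / Q\<^sub>1)) = N" by (simp add: mult.left_commute)
    then show ?thesis using N by (simp add: ennreal_mult[symmetric] V_def)
  qed
  also have "ennreal V * nint (\<lambda>x. (\<bar>h x\<bar> * v x) * u x powr (1 / \<tau>)) Q
    = (\<integral>\<^sup>+x. ennreal V * (ennreal ((\<bar>h x\<bar> * v x) * u x powr (1 / \<tau>)) * indicator (cube Q) x) \<partial>lebesgue)"
    unfolding nint_def by (rule nn_integral_cmult[symmetric]) measurable
  finally show ?thesis unfolding eq using N by (simp add: X_def morrey_def)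
qed

text \<open>By the converse of Hoelder's inequality, pairing \<open>g\<close> with the blocks on one
  cube already recovers the norm of \<open>g * w\<close> there in the exponent
  \<open>a\<close>.\<close>

lemma morrey_norm_le_dual:
  assumes g: "g \<in> elems (kothe_dual S)"
  shows "morrey_norm a b w g \<le> qnorm (kothe_dual S) g" "qnorm (kothe_dual S) g < \<infinity>"
proof -
  show fin: "qnorm (kothe_dual S) g < \<infinity>" by (rule kothe_dual_finite[OF dominated_S g])
  have gL: "g \<in> L0" using g by (simp add: kothe_dual_def)
  then have [measurable]: "g \<in> borel_measurable lebesgue" by (simp add: L0_def)
  define K where "K = enn2real (qnorm (kothe_dual S) g)"
  have K: "0 \<le> K" "qnorm (kothe_dual S) g = ennreal K" using fin by (auto simp: K_def)
  have wnn: "0 \<le> w x" for x by (simp add: w_def)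
  have "morrey_norm a b w g \<le> ennreal K"
  proof (subst morrey_norm_le_iff[OF Ppos(4) b(1) K(1)], intro allI impI)
    fix Q :: "'a \<times> real" assume Q: "0 < snd Q"
    define V where "V = vol Q powr - (1 / a - 1 / b)"
    have V: "0 < V" using vol_pos[OF Q] by (simp add: V_def)
    have main: "(\<integral>\<^sup>+x. ennreal ((\<bar>g x\<bar> * w x * indicator (cube Q) x * V) powr a) \<partial>lebesgue) \<le> ennreal (K powr a)"
    proof (rule converse_holder[OF a(1) P'(2) _ _ K(1)])
      fix u :: "'a \<Rightarrow> real"
      assume um[measurable]: "u \<in> borel_measurable lebesgue" and u: "\<And>x. 0 \<le> u x"
        and u1: "(\<integral>\<^sup>+x. ennreal (u x powr a') \<partial>lebesgue) \<le> 1"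
      define \<phi> where "\<phi> x = u x * w x * indicator (cube Q) x * V" for x
      have phim: "\<phi> \<in> borel_measurable lebesgue" unfolding \<phi>_def by measurable
      have phi0: "0 \<le> \<phi> x" for x using u[of x] wnn[of x] V by (simp add: \<phi>_def)
      have "\<forall>h\<in>elems X. (\<integral>\<^sup>+x. ennreal (\<phi> x powr (1 / \<tau>) * \<bar>h x\<bar>) \<partial>lebesgue) \<le> qnorm X h"
        unfolding \<phi>_def V_def by (intro ballI test_function[OF um u u1 Q])
      note ball = unit_ball_S[OF phim phi0 this]
      have "(\<integral>\<^sup>+x. ennreal (\<bar>g x\<bar> * w x * indicator (cube Q) x * V * u x) \<partial>lebesgue)
         = (\<integral>\<^sup>+x. ennreal \<bar>\<phi> x * g x\<bar> \<partial>lebesgue)"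
        using phi0 by (intro nn_integral_cong) (simp add: abs_mult \<phi>_def[symmetric], simp add: \<phi>_def mult.commute mult.left_commute)
      also have "\<dots> \<le> qnorm S \<phi> * qnorm (kothe_dual S) g"
        by (rule kothe_holder[OF homogeneous_S ball(1) gL])
      also have "\<dots> \<le> 1 * qnorm (kothe_dual S) g" by (intro mult_right_mono ball(2)) simp
      finally show "(\<integral>\<^sup>+x. ennreal (\<bar>g x\<bar> * w x * indicator (cube Q) x * V * u x) \<partial>lebesgue) \<le> ennreal K"
        using K by simp
    qed (use wnn V in auto)
    have "nint (\<lambda>x. \<bar>g x * w x\<bar> powr a) Q = (\<integral>\<^sup>+x. ennreal ((1 / V) powr a) * ennreal ((\<bar>g x\<bar> * w x * indicator (cube Q) x * V) powr a) \<partial>lebesgue)"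
      unfolding nint_def
    proof (intro nn_integral_cong)
      fix x
      show "ennreal (\<bar>g x * w x\<bar> powr a) * indicator (cube Q) x
          = ennreal ((1 / V) powr a) * ennreal ((\<bar>g x\<bar> * w x * indicator (cube Q) x * V) powr a)"
        using V wnn[of x] Ppos by (auto simp: ennreal_mult[symmetric] powr_mult[symmetric] indicator_def abs_mult)
    qed
    also have "\<dots> = ennreal ((1 / V) powr a) * (\<integral>\<^sup>+x. ennreal ((\<bar>g x\<bar> * w x * indicator (cube Q) x * V) powr a) \<partial>lebesgue)"
      by (rule nn_integral_cmult) measurable
    also have "\<dots> \<le> ennreal ((1 / V) powr a) * ennreal (K powr a)" by (intro mult_left_mono main) simp
    also have "\<dots> = ennreal ((K * vol Q powr (1 / a - 1 / b)) powr a)"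
    proof -
      have "1 / V = vol Q powr (1 / a - 1 / b)" unfolding V_def powr_minus by (simp add: divide_inverse)
      then show ?thesis by (simp add: ennreal_mult[symmetric] powr_mult mult.commute)
    qed
    finally show "nint (\<lambda>x. \<bar>g x * w x\<bar> powr a) Q \<le> ennreal ((K * vol Q powr (1 / a - 1 / b)) powr a)" .
  qed
  then show "morrey_norm a b w g \<le> qnorm (kothe_dual S) g" by (simp add: K)
qed

text \<open>Conversely, Hoelder's inequality on cubes shows that \<open>|g| powr (1 / \<tau>) * u\<close> lies in the Morrey
  space \<open>X\<close> whenever \<open>u\<close> is in the unit ball of the Lebesgue space with exponent dual to \<open>\<tau>\<close>.\<close>

lemma dual_le_morrey_norm:
  assumes g: "g \<in> elems (morrey a b w)" and f: "f \<in> elems S"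
  shows "(\<integral>\<^sup>+x. ennreal \<bar>f x * g x\<bar> \<partial>lebesgue) \<le> qnorm S f * morrey_norm a b w g"
proof -
  define G where "G x = \<bar>f x\<bar> powr (1 / \<tau>)" for x
  have fm[measurable]: "f \<in> borel_measurable lebesgue" and G: "G \<in> elems (kothe_dual X)"
    using elems_S[OF f] by (simp_all add: G_def[abs_def])
  have gm[measurable]: "g \<in> borel_measurable lebesgue" using g by (simp add: morrey_def L0_def)
  have [measurable]: "G \<in> borel_measurable lebesgue" unfolding G_def by measurable
  have G0: "0 \<le> G x" for x by (simp add: G_def)
  have qf: "qnorm S f = epowr (qnorm (kothe_dual X) G) \<tau>" by (simp add: S_def power_space_def G_def[abs_def])
  show ?thesis
  \<comment> \<open>This is the case \<open>s = \<infinity>\<close>, where the exponent dual to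
    \<open>\<tau>\<close> would be infinite. Then \<open>a = P\<close>, \<open>b = Q\<^sub>1\<close>
    and \<open>w = v\<close>, and the claim is Hoelder's inequality between \<open>X\<close> and its
    dual.\<close>
  proof (cases "\<tau> = 1")
    case True
    have "a = P" using a(2) True Ppos by simp
    moreover from this have "b = Q\<^sub>1" using b True Ppos by simp
    moreover have "w = v" by (rule ext, unfold w_def, simp add: True vnn)
    ultimately have "g \<in> elems X" "morrey_norm a b w g = qnorm X g" using g by (simp_all add: X_def morrey_def)
    moreover have "G = (\<lambda>x. \<bar>f x\<bar>)" by (rule ext) (simp add: G_def True)
    ultimately show ?thesis using dual_X_holder[of g G] G True qf by (simp add: abs_mult mult.commute)
  next
    case False
    then have \<tau>1: "1 < \<tau>" using \<tau> by simp
    define \<tau>' where "\<tau>' = 1 / (1 - 1 / \<tau>)"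
    have t: "1 / \<tau> + 1 / \<tau>' = 1" "0 < \<tau>'" using \<tau>1 by (auto simp: \<tau>'_def)
    have fin: "morrey_norm a b w g < \<infinity>" using g by (simp add: morrey_def)
    define N where "N = enn2real (morrey_norm a b w g)"
    have N: "0 \<le> N" "morrey_norm a b w g = ennreal N" using fin by (auto simp: N_def)
    define y where "y = enn2real (qnorm (kothe_dual X) G)"
    have y: "0 \<le> y" "qnorm (kothe_dual X) G = ennreal y" using dual_X_finite[OF G] by (auto simp: y_def)
    \<comment> \<open>The integrand is \<open>|f * g|\<close>. Its integral is the
      \<open>\<tau>\<close>-th power of a Lebesgue norm, computed by duality so that the test
      function \<open>u\<close> can be multiplied onto the factor with \<open>g\<close>.\<close>
    have "(\<integral>\<^sup>+x. ennreal ((G x * \<bar>g x\<bar> powr (1 / \<tau>)) powr \<tau>) \<partial>lebesgue) \<le> ennreal ((y * N powr (1 / \<tau>)) powr \<tau>)"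
    proof (rule converse_holder[OF \<tau>1 t(1)])
      fix u :: "'a \<Rightarrow> real"
      assume um[measurable]: "u \<in> borel_measurable lebesgue" and u: "\<And>x. 0 \<le> u x"
        and u1: "(\<integral>\<^sup>+x. ennreal (u x powr \<tau>') \<partial>lebesgue) \<le> 1"
      define h where "h x = \<bar>g x\<bar> powr (1 / \<tau>) * u x" for x
      have h0: "0 \<le> h x" for x using u by (simp add: h_def)
      have hm: "h \<in> borel_measurable lebesgue" unfolding h_def by measurable
      have "morrey_norm P Q\<^sub>1 v h \<le> ennreal (N powr (1 / \<tau>))"
      proof (subst morrey_norm_le_iff[OF Ppos(1,2)], simp, intro allI impI)
        fix Q :: "'a \<times> real" assume Q: "0 < snd Q"
        have "\<bar>h x * v x\<bar> powr P = \<bar>g x * w x\<bar> powr (P / \<tau>) * u x powr P" for x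
        proof -
          have "\<bar>g x * w x\<bar> powr (P / \<tau>) = \<bar>g x\<bar> powr (P / \<tau>) * v x powr P"
            using Ppos by (simp add: abs_mult powr_mult w_def powr_powr)
          moreover have "\<bar>h x * v x\<bar> powr P = \<bar>g x\<bar> powr (P / \<tau>) * u x powr P * v x powr P"
            using vnn[of x] u[of x] by (simp add: h_def abs_mult powr_mult powr_powr)
          ultimately show ?thesis by simp
        qed
        then have "nint (\<lambda>x. \<bar>h x * v x\<bar> powr P) Q = nint (\<lambda>x. \<bar>g x * w x\<bar> powr (P / \<tau>) * u x powr P) Q" by simp
        also have "\<dots> \<le> ennreal ((N * vol Q powr (1 / a - 1 / b)) powr (P / \<tau>) * 1)"
        \<comment> \<open>The two exponents are conjugate because
          \<open>1 / (a * \<tau>) + 1 / \<tau>' = 1 / P\<close>, a rewriting of the equation for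
          \<open>a\<close>.\<close>
        proof (rule holder_cube[of "a * \<tau> / P" "\<tau>' / P"])
          have "1 / (a * \<tau>) = 1 / \<tau> - (1 - 1 / P)"
          proof -
            have "1 / (a * \<tau>) = (1 / a) / \<tau>" by simp
            also have "\<dots> = 1 / \<tau> - (1 - 1 / P)" unfolding a(2) using Ppos by (simp add: diff_divide_distrib)
            finally show ?thesis .
          qed
          moreover have "1 / \<tau>' = 1 - 1 / \<tau>" using t by simp
          ultimately have "P * (1 / (a * \<tau>) + 1 / \<tau>') = 1" using Ppos by simp
          then show conj: "1 / (a * \<tau> / P) + 1 / (\<tau>' / P) = 1" using Ppos by (simp add: field_simps)
          moreover have "0 < 1 / (\<tau>' / P)" using t Ppos by simp
          ultimately have "1 / (a * \<tau> / P) < 1" by linarith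
          then show "1 < a * \<tau> / P" using Ppos by (simp add: field_simps)
          have "nint (\<lambda>x. (\<bar>g x * w x\<bar> powr (P / \<tau>)) powr (a * \<tau> / P)) Q = nint (\<lambda>x. \<bar>g x * w x\<bar> powr a) Q"
            using Ppos by (simp add: powr_powr)
          also have "\<dots> \<le> ennreal ((N * vol Q powr (1 / a - 1 / b)) powr a)"
            unfolding N_def by (rule morrey_normD[OF Ppos(4) b(1) fin Q])
          finally show "nint (\<lambda>x. (\<bar>g x * w x\<bar> powr (P / \<tau>)) powr (a * \<tau> / P)) Q
            \<le> ennreal (((N * vol Q powr (1 / a - 1 / b)) powr (P / \<tau>)) powr (a * \<tau> / P))"
            using Ppos by (simp add: powr_powr)
          have "nint (\<lambda>x. (u x powr P) powr (\<tau>' / P)) Q \<le> (\<integral>\<^sup>+x. ennreal (u x powr \<tau>') \<partial>lebesgue)"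
            unfolding nint_def using Ppos by (intro nn_integral_mono) (auto simp: indicator_def powr_powr)
          then show "nint (\<lambda>x. (u x powr P) powr (\<tau>' / P)) Q \<le> ennreal (1 powr (\<tau>' / P))" using u1 by simp
        qed auto
        also have "(N * vol Q powr (1 / a - 1 / b)) powr (P / \<tau>) * 1 = (N powr (1 / \<tau>) * vol Q powr (1 / P - 1 / Q\<^sub>1)) powr P"
          unfolding b(2) using Ppos by (simp add: powr_mult powr_powr)
        finally show "nint (\<lambda>x. \<bar>h x * v x\<bar> powr P) Q \<le> ennreal ((N powr (1 / \<tau>) * vol Q powr (1 / P - 1 / Q\<^sub>1)) powr P)" .
      qed
      then have hq: "qnorm X h \<le> ennreal (N powr (1 / \<tau>))" and h: "h \<in> elems X"
        using hm le_less_trans[of "morrey_norm P Q\<^sub>1 v h" "ennreal (N powr (1 / \<tau>))" \<infinity>]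
        by (simp_all add: X_def morrey_def L0_def)
      have "(\<integral>\<^sup>+x. ennreal (G x * \<bar>g x\<bar> powr (1 / \<tau>) * u x) \<partial>lebesgue) = (\<integral>\<^sup>+x. ennreal \<bar>h x * G x\<bar> \<partial>lebesgue)"
        using h0 G0 by (intro nn_integral_cong) (simp add: abs_mult, simp add: h_def mult.commute mult.left_commute)
      also have "\<dots> \<le> qnorm X h * qnorm (kothe_dual X) G" by (rule dual_X_holder[OF h G])
      also have "\<dots> \<le> ennreal (N powr (1 / \<tau>)) * ennreal y" unfolding y(2) by (intro mult_right_mono hq) simp
      finally show "(\<integral>\<^sup>+x. ennreal (G x * \<bar>g x\<bar> powr (1 / \<tau>) * u x) \<partial>lebesgue) \<le> ennreal (y * N powr (1 / \<tau>))"
        using y by (simp add: ennreal_mult mult.commute)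
    qed (use G0 y in auto)
    moreover have "(G x * \<bar>g x\<bar> powr (1 / \<tau>)) powr \<tau> = \<bar>f x * g x\<bar>" for x
      using Ppos by (simp add: G_def powr_mult powr_powr abs_mult)
    moreover have "ennreal ((y * N powr (1 / \<tau>)) powr \<tau>) = qnorm S f * morrey_norm a b w g"
      using Ppos N y by (simp add: qf epowr_ennreal powr_mult powr_powr ennreal_mult)
    ultimately show ?thesis by simp
  qed
qed

lemma dual_S_eq_morrey:
  "elems (kothe_dual S) = elems (morrey a b w)"
  "\<And>g. g \<in> elems (morrey a b w) \<Longrightarrow> qnorm (kothe_dual S) g = qnorm (morrey a b w) g"
proof -
  show el: "elems (kothe_dual S) = elems (morrey a b w)"
  proof (intro equalityI subsetI)
    fix g assume g: "g \<in> elems (kothe_dual S)"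
    then have "g \<in> L0" by (simp add: kothe_dual_def)
    then show "g \<in> elems (morrey a b w)"
      using le_less_trans[OF morrey_norm_le_dual[OF g]] by (simp add: morrey_def)
  next
    fix g assume g: "g \<in> elems (morrey a b w)"
    then have gm[measurable]: "g \<in> borel_measurable lebesgue" by (simp add: morrey_def L0_def)
    have "integrable lebesgue (\<lambda>x. f x * g x)" if f: "f \<in> elems S" for f
    proof (rule integrableI_bounded)
      note elems_S(1)[OF f, measurable]
      show "(\<lambda>x. f x * g x) \<in> borel_measurable lebesgue" by measurable
      have "qnorm S f < \<infinity>" using homogeneous_S f by (simp add: homogeneous_def)
      then have "qnorm S f * morrey_norm a b w g < \<infinity>" using g by (simp add: morrey_def ennreal_mult_less_top)
      then show "(\<integral>\<^sup>+x. ennreal (norm (f x * g x)) \<partial>lebesgue) < \<infinity>"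
        using le_less_trans[OF dual_le_morrey_norm[OF g f]] by simp
    qed
    then show "g \<in> elems (kothe_dual S)" using gm by (simp add: kothe_dual_def L0_def)
  qed
  fix g assume g: "g \<in> elems (morrey a b w)"
  have "(\<integral>\<^sup>+x. ennreal \<bar>f x * g x\<bar> \<partial>lebesgue) \<le> morrey_norm a b w g" if "f \<in> elems S" "qnorm S f = 1" for f
    using dual_le_morrey_norm[OF g that(1)] that(2) by simp
  then have "qnorm (kothe_dual S) g \<le> morrey_norm a b w g"
    unfolding kothe_dual_def by (auto intro!: SUP_least)
  moreover have "morrey_norm a b w g \<le> qnorm (kothe_dual S) g"
    using g el by (intro morrey_norm_le_dual) simp
  ultimately show "qnorm (kothe_dual S) g = qnorm (morrey a b w) g" by (simp add: morrey_def)
qed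

end

text \<open>The norms of \<open>kothe_dual S\<close> and of the Morrey space are compared on
  elements only; values elsewhere influence neither the dual nor the boundedness of the maximal
  operator.\<close>

lemma kothe_dual_cong:
  assumes "elems X = elems Y" "\<And>f. f \<in> elems Y \<Longrightarrow> qnorm X f = qnorm Y f"
  shows "kothe_dual X = kothe_dual Y"
proof -
  have "{f \<in> elems X. qnorm X f = 1} = {f \<in> elems Y. qnorm Y f = 1}" using assms by auto
  then show ?thesis unfolding kothe_dual_def using assms(1) by simp
qed

lemma maximal_bounded_cong:
  assumes "elems X = elems Y" "\<And>f. f \<in> elems Y \<Longrightarrow> qnorm X f = qnorm Y f"
  shows "maximal_bounded X \<longleftrightarrow> maximal_bounded Y"
proof -
  have "((AE x in lebesgue. maximal f x < \<infinity>) \<and> (\<lambda>x. enn2real (maximal f x)) \<in> elems X \<and>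
       qnorm X (\<lambda>x. enn2real (maximal f x)) \<le> ennreal C * qnorm X f) \<longleftrightarrow>
     ((AE x in lebesgue. maximal f x < \<infinity>) \<and> (\<lambda>x. enn2real (maximal f x)) \<in> elems Y \<and>
       qnorm Y (\<lambda>x. enn2real (maximal f x)) \<le> ennreal C * qnorm Y f)"
    if "f \<in> elems Y" for f and C :: real
    unfolding assms(1) assms(2)[OF that] by (intro conj_cong refl) (simp only: assms(2))
  then show ?thesis unfolding maximal_bounded_def assms(1) by (intro ex_cong1 ball_cong refl) (simp only: assms(1))
qed

section \<open>The weight condition and power weights\<close>

lemma reciprocal_ereal:
  fixes s :: ereal
  assumes "0 < q" "ereal q < s"
  shows "0 \<le> real_of_ereal (1 / s)" "real_of_ereal (1 / s) < 1 / q"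
  using assms by (cases s; simp add: divide_ereal_def frac_less2 inverse_eq_divide)+

lemma conj_quot_eq:
  fixes s :: ereal
  assumes "0 < s"
  shows "conj_quot s r = 1 / (1 - r * real_of_ereal (1 / s))"
  using assms by (cases s) (auto simp: conj_quot_def divide_ereal_def divide_inverse)

lemma maximal_bounded_rs_space:
  fixes r p q :: real and s :: ereal and v :: "'a::euclidean_space \<Rightarrow> real"
  defines "\<rho> \<equiv> real_of_ereal (1 / s)"
  defines "t\<^sub>1 \<equiv> 1 / (1 / q - \<rho>)" and "t\<^sub>2 \<equiv> 1 / (1 / r - 1 / p)"
  assumes r: "0 < r" "r < p" "p \<le> q" and s: "0 < s" "ereal q < s" and v: "weight v"
    and cond: "\<And>Q. 0 < snd Q \<Longrightarrow> nint (\<lambda>x. \<bar>v x\<bar> powr t\<^sub>1) Q < \<infinity>"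
      "\<And>Q. 0 < snd Q \<Longrightarrow> nint (\<lambda>x. \<bar>v x\<bar> powr - t\<^sub>2) Q < \<infinity>"
      "\<And>Q. 0 < snd Q \<Longrightarrow> mass (\<lambda>x. \<bar>v x\<bar> powr t\<^sub>1) Q powr (1 / t\<^sub>1) * mass (\<lambda>x. \<bar>v x\<bar> powr - t\<^sub>2) Q powr (1 / t\<^sub>2)
        \<le> K * vol Q powr (1 / t\<^sub>1 + 1 / t\<^sub>2)"
  shows "maximal_bounded (rs_space (morrey p q v) r s) \<and> maximal_bounded (kothe_dual (rs_space (morrey p q v) r s))"
proof -
  have vm[measurable]: "v \<in> borel_measurable lebesgue" and vpos: "AE x in lebesgue. 0 < v x"
    using v by (auto simp: weight_def L0_def)
  have q: "0 < q" "0 < p" using r by auto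
  have \<rho>: "0 \<le> \<rho>" "\<rho> < 1 / q" using reciprocal_ereal[OF q(1) s(2)] by (simp_all add: \<rho>_def)
  have qp: "1 / q \<le> 1 / p" "1 / p < 1 / r" using r q by (auto intro: frac_le frac_less2)
  have "r * \<rho> < r * (1 / r)" using \<rho> qp r by (intro mult_strict_left_mono) linarith+
  then have r\<rho>: "r * \<rho> < 1" using r by simp
  define \<tau> where "\<tau> = 1 / (1 - r * \<rho>)"
  define T where "T = r * \<tau>"
  have \<tau>pos: "0 < \<tau>" using r\<rho> by (simp add: \<tau>_def)
  have T: "0 < T" using \<tau>pos r by (simp add: T_def)
  \<comment> \<open>\<open>T\<close> is the reciprocal of \<open>1/r - 1/s\<close>. This identity is
    what matches \<open>a\<close> with its equation in \<open>rs_morrey\<close>.\<close>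
  have T\<rho>: "T * \<rho> = \<tau> - 1" using r\<rho> by (simp add: T_def \<tau>_def field_simps)
  define a where "a = 1 / (T * (1 / p - \<rho>))"
  define b where "b = 1 / (T * (1 / q - \<rho>))"
  have t1: "0 < t\<^sub>1" using \<rho> by (simp add: t\<^sub>1_def)
  have t2: "0 < t\<^sub>2" using qp by (simp add: t\<^sub>2_def)
  have Ta: "0 < T * (1 / p - \<rho>)" "0 < T * (1 / q - \<rho>)" using T \<rho> qp by (auto intro!: mult_pos_pos)
  have "T * (1 / p - \<rho>) < T * (1 / r - \<rho>)" using T qp by (intro mult_strict_left_mono) auto
  also have "\<dots> = 1" using r by (simp add: right_diff_distrib T\<rho>) (simp add: T_def)
  finally have a1: "1 < a" using Ta by (simp add: a_def)
  interpret R: rs_morrey "p / r" "q / r" \<tau> a b "\<lambda>x. \<bar>v x\<bar> powr r"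
  proof
    show "1 < p / r" "p / r \<le> q / r" using r by (simp_all add: divide_right_mono)
    show "1 \<le> \<tau>" using r\<rho> r \<rho> by (simp add: \<tau>_def)
    show "1 / a = 1 - \<tau> * (1 - 1 / (p / r))"
      using T\<rho> by (simp add: a_def right_diff_distrib) (simp add: T_def)
    show "0 < b" using Ta by (simp add: b_def)
    have "1 / a - 1 / b = T * (1 / p - 1 / q)" by (simp add: a_def b_def right_diff_distrib)
    also have "\<dots> = \<tau> * (1 / (p / r) - 1 / (q / r))" by (simp add: T_def right_diff_distrib mult.commute)
    finally show "1 / a - 1 / b = \<tau> * (1 / (p / r) - 1 / (q / r))" .
    show "AE x in lebesgue. 0 < \<bar>v x\<bar> powr r" using vpos by (auto elim!: eventually_mono)
  qed (use a1 in auto)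
  have cq: "conj_quot s r = \<tau>" by (simp add: \<tau>_def \<rho>_def conj_quot_eq[OF s(1)])
  have R_S: "rs_space (morrey p q v) r s = kothe_dual R.S"
    unfolding rs_space_def cq R.S_def R.X_def using r q by (subst power_space_morrey) auto
  have a': "R.a' = 1 / (T * (1 / r - 1 / p))"
  proof -
    have "1 - 1 / (p / r) = r * (1 / r - 1 / p)" using r by (simp add: right_diff_distrib)
    then show ?thesis by (simp add: R.a'_def R.P'_def T_def mult.commute mult.left_commute)
  qed
  have Tb: "T * b = t\<^sub>1" "T * R.a' = t\<^sub>2" using T by (simp_all add: b_def a' t\<^sub>1_def t\<^sub>2_def)
  have bT: "1 / b = T * (1 / t\<^sub>1)" "1 / R.a' = T * (1 / t\<^sub>2)" using T t1 t2 by (simp_all add: Tb[symmetric])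
  have w: "R.w x = \<bar>v x\<bar> powr T" for x by (simp add: R.w_def powr_powr T_def)
  have wb: "(\<lambda>x. R.w x powr b) = (\<lambda>x. \<bar>v x\<bar> powr t\<^sub>1)" "(\<lambda>x. R.w x powr - R.a') = (\<lambda>x. \<bar>v x\<bar> powr - t\<^sub>2)"
    by (simp_all add: w powr_powr Tb)
  \<comment> \<open>The maximum with 1 makes the constant positive whatever the sign of
    \<open>K\<close>; the power \<open>T\<close> is the one that carries the hypothesis on
    \<open>v\<close> to the condition on \<open>R.w\<close>.\<close>
  define K' where "K' = max K 1 powr T"
  interpret W: morrey_weight a R.a' b K' R.w
  proof
    show "1 < a" by (rule a1)
    show "1 / a + 1 / R.a' = 1" by (rule R.P')
    show "a \<le> b" unfolding a_def b_def using Ta qp T by (intro frac_le mult_left_mono) auto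
    show "0 < K'" by (simp add: K'_def)
    show "AE x in lebesgue. 0 < R.w x" using vpos by (auto simp: w elim!: eventually_mono)
    fix Q :: "'a \<times> real" assume Q: "0 < snd Q"
    show "nint (\<lambda>x. R.w x powr b) Q < \<infinity>" "nint (\<lambda>x. R.w x powr - R.a') Q < \<infinity>"
      unfolding wb by (intro cond Q)+
    have "mass (\<lambda>x. \<bar>v x\<bar> powr t\<^sub>1) Q powr (1 / b) * mass (\<lambda>x. \<bar>v x\<bar> powr - t\<^sub>2) Q powr (1 / R.a')
       = (mass (\<lambda>x. \<bar>v x\<bar> powr t\<^sub>1) Q powr (1 / t\<^sub>1) * mass (\<lambda>x. \<bar>v x\<bar> powr - t\<^sub>2) Q powr (1 / t\<^sub>2)) powr T"
      unfolding bT powr_mult powr_powr by (simp add: mult.commute)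
    also have "\<dots> \<le> (max K 1 * vol Q powr (1 / t\<^sub>1 + 1 / t\<^sub>2)) powr T"
      using T by (intro powr_mono2 order_trans[OF cond(3)[OF Q]] mult_right_mono) auto
    also have "\<dots> = K' * vol Q powr (1 / R.a' + 1 / b)"
      unfolding bT powr_mult powr_powr K'_def by (simp add: distrib_left mult.commute add.commute)
    finally show "mass (\<lambda>x. R.w x powr b) Q powr (1 / b) * mass (\<lambda>x. R.w x powr - R.a') Q powr (1 / R.a')
        \<le> K' * vol Q powr (1 / R.a' + 1 / b)" unfolding wb .
  qed (auto simp: w)
  have "maximal_bounded (kothe_dual R.S)"
    by (subst maximal_bounded_cong[where Y="morrey a b R.w"])
       (simp_all add: R.dual_S_eq_morrey W.maximal_bounded_morrey)
  moreover have "kothe_dual (kothe_dual R.S) = kothe_dual (morrey a b R.w)"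
    by (rule kothe_dual_cong) (simp_all add: R.dual_S_eq_morrey)
  ultimately show ?thesis unfolding R_S by (simp add: W.maximal_bounded_kothe_dual)
qed

text \<open>A finite product bounds its factors only if none of them is 0, because
  \<open>0 * \<infinity> = 0\<close>. Both norms are positive since \<open>v\<close> is positive
  almost everywhere and real-valued, so the finite supremum also forces local integrability of the
  two powers of \<open>v\<close>.\<close>

lemma weight_condition:
  fixes v :: "'a::euclidean_space \<Rightarrow> real"
  assumes v: "weight v" and t: "0 < t\<^sub>1" "0 < t\<^sub>2" and \<gamma>: "\<gamma> = 1 / t\<^sub>1 + 1 / t\<^sub>2"
    and sup: "(SUP Q\<in>cubes. ennreal (measure lebesgue Q powr - \<gamma>) * Lp_norm t\<^sub>1 (\<lambda>x. v x * indicator Q x)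
       * Lp_norm t\<^sub>2 (\<lambda>x. inverse (v x) * indicator Q x)) < \<infinity>"
  obtains K where "\<And>Q. 0 < snd Q \<Longrightarrow> nint (\<lambda>x. \<bar>v x\<bar> powr t\<^sub>1) Q < \<infinity>"
      "\<And>Q. 0 < snd Q \<Longrightarrow> nint (\<lambda>x. \<bar>v x\<bar> powr - t\<^sub>2) Q < \<infinity>"
      "\<And>Q. 0 < snd Q \<Longrightarrow> mass (\<lambda>x. \<bar>v x\<bar> powr t\<^sub>1) Q powr (1 / t\<^sub>1) * mass (\<lambda>x. \<bar>v x\<bar> powr - t\<^sub>2) Q powr (1 / t\<^sub>2)
        \<le> K * vol Q powr (1 / t\<^sub>1 + 1 / t\<^sub>2)"
proof -
  have vm[measurable]: "v \<in> borel_measurable lebesgue" and vpos: "AE x in lebesgue. 0 < v x"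
    using v by (auto simp: weight_def L0_def)
  define Z where "Z = (SUP Q\<in>cubes. ennreal (measure lebesgue Q powr - \<gamma>) * Lp_norm t\<^sub>1 (\<lambda>x. v x * indicator Q x)
       * Lp_norm t\<^sub>2 (\<lambda>x. inverse (v x) * indicator Q x))"
  define K where "K = enn2real Z"
  have K: "Z = ennreal K" "0 \<le> K" using sup[folded Z_def] by (simp_all add: K_def)
  have main: "nint (\<lambda>x. \<bar>v x\<bar> powr t\<^sub>1) Q < \<infinity> \<and> nint (\<lambda>x. \<bar>v x\<bar> powr - t\<^sub>2) Q < \<infinity> \<and>
      mass (\<lambda>x. \<bar>v x\<bar> powr t\<^sub>1) Q powr (1 / t\<^sub>1) * mass (\<lambda>x. \<bar>v x\<bar> powr - t\<^sub>2) Q powr (1 / t\<^sub>2)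
        \<le> K * vol Q powr (1 / t\<^sub>1 + 1 / t\<^sub>2)" if Q: "0 < snd Q" for Q
  proof -
    define A where "A = nint (\<lambda>x. \<bar>v x\<bar> powr t\<^sub>1) Q"
    define B where "B = nint (\<lambda>x. \<bar>v x\<bar> powr - t\<^sub>2) Q"
    have "0 < A" unfolding A_def by (rule nint_pos[OF _ _ Q]) (use vpos in \<open>auto elim!: eventually_mono\<close>)
    moreover have "0 < B" unfolding B_def by (rule nint_pos[OF _ _ Q]) (use vpos in \<open>auto elim!: eventually_mono\<close>)
    ultimately have AB: "epowr A (1 / t\<^sub>1) \<noteq> 0" "epowr B (1 / t\<^sub>2) \<noteq> 0" using epowr_eq_0 by force+
    have V: "0 < vol Q" by (rule vol_pos[OF Q])
    have m: "measure lebesgue (cube Q) = vol Q" using emeasure_cube[OF Q] V by (simp add: measure_def)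
    have inv: "\<bar>inverse y\<bar> powr t\<^sub>2 = \<bar>y\<bar> powr - t\<^sub>2" for y :: real
      by (cases "y = 0") (simp_all add: powr_minus inverse_powr)
    have LA: "Lp_norm t\<^sub>1 (\<lambda>x. v x * indicator (cube Q) x) = epowr A (1 / t\<^sub>1)"
      unfolding Lp_norm_def A_def nint_def
      by (intro arg_cong[where f="\<lambda>x. epowr x (1 / t\<^sub>1)"] nn_integral_cong) (auto simp: indicator_def)
    have LB: "Lp_norm t\<^sub>2 (\<lambda>x. inverse (v x) * indicator (cube Q) x) = epowr B (1 / t\<^sub>2)"
      unfolding Lp_norm_def B_def nint_def
      by (intro arg_cong[where f="\<lambda>x. epowr x (1 / t\<^sub>2)"] nn_integral_cong)
         (auto simp: indicator_def inv[unfolded abs_inverse] abs_inverse)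
    have "ennreal (vol Q powr - \<gamma>) * epowr A (1 / t\<^sub>1) * epowr B (1 / t\<^sub>2) \<le> ennreal K"
    proof -
      have "cube Q \<in> cubes" using Q by (auto simp: cubes_eq)
      from SUP_upper[OF this, of "\<lambda>Q. ennreal (measure lebesgue Q powr - \<gamma>) * Lp_norm t\<^sub>1 (\<lambda>x. v x * indicator Q x)
       * Lp_norm t\<^sub>2 (\<lambda>x. inverse (v x) * indicator Q x)"]
      show ?thesis unfolding Z_def[symmetric] K(1) m LA LB .
    qed
    then have fin: "ennreal (vol Q powr - \<gamma>) * epowr A (1 / t\<^sub>1) * epowr B (1 / t\<^sub>2) < top"
      and le: "ennreal (vol Q powr - \<gamma>) * epowr A (1 / t\<^sub>1) * epowr B (1 / t\<^sub>2) \<le> ennreal K"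
      by (auto intro: le_less_trans)
    have V0: "ennreal (vol Q powr - \<gamma>) \<noteq> 0" using V by (simp add: ennreal_eq_0_iff)
    have "A \<noteq> top"
    proof
      assume "A = top"
      then show False using fin AB V0 by (simp add: ennreal_mult_top ennreal_top_mult)
    qed
    moreover have "B \<noteq> top"
    proof
      assume "B = top"
      then show False using fin AB V0 by (simp add: ennreal_mult_top ennreal_top_mult)
    qed
    ultimately have AB': "A = ennreal (mass (\<lambda>x. \<bar>v x\<bar> powr t\<^sub>1) Q)" "B = ennreal (mass (\<lambda>x. \<bar>v x\<bar> powr - t\<^sub>2) Q)"
      by (simp_all add: A_def B_def mass_def less_top)
    have "vol Q powr - \<gamma> * mass (\<lambda>x. \<bar>v x\<bar> powr t\<^sub>1) Q powr (1 / t\<^sub>1) * mass (\<lambda>x. \<bar>v x\<bar> powr - t\<^sub>2) Q powr (1 / t\<^sub>2) \<le> K"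
      using le K(2) unfolding AB' by (simp add: epowr_ennreal ennreal_mult[symmetric])
    then have "vol Q powr \<gamma> * (vol Q powr - \<gamma> * (mass (\<lambda>x. \<bar>v x\<bar> powr t\<^sub>1) Q powr (1 / t\<^sub>1) * mass (\<lambda>x. \<bar>v x\<bar> powr - t\<^sub>2) Q powr (1 / t\<^sub>2)))
       \<le> vol Q powr \<gamma> * K"
      by (intro mult_left_mono) (auto simp: mult.assoc)
    moreover have "vol Q powr \<gamma> * vol Q powr - \<gamma> = 1" unfolding powr_add[symmetric] using V by simp
    ultimately have "mass (\<lambda>x. \<bar>v x\<bar> powr t\<^sub>1) Q powr (1 / t\<^sub>1) * mass (\<lambda>x. \<bar>v x\<bar> powr - t\<^sub>2) Q powr (1 / t\<^sub>2) \<le> K * vol Q powr \<gamma>"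
      by (simp add: mult.assoc[symmetric] mult.commute[of K])
    moreover have "A < \<infinity>" "B < \<infinity>" unfolding AB' by simp_all
    ultimately show ?thesis unfolding A_def B_def \<gamma> by blast
  qed
  show thesis by (rule that[of K]) (use main in blast)+
qed

section \<open>Power weights\<close>

lemma nint_norm_powr_origin:
  fixes g :: real
  assumes g: "- real DIM('a::euclidean_space) < g"
  obtains C where "0 \<le> C" "\<And>R. 0 < R \<Longrightarrow> nint (\<lambda>x::'a. norm x powr g) (- R *\<^sub>R One, 2 * R) \<le> ennreal (C * R powr (g + DIM('a)))"
proof -
  let ?d = "DIM('a)"
  have mem: "x \<in> cube (- R *\<^sub>R One, 2 * R) \<longleftrightarrow> (\<forall>i\<in>Basis. \<bar>x \<bullet> i\<bar> \<le> R)" for x :: 'a and R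
    by (auto simp: mem_cube abs_le_iff)
  have em: "emeasure lebesgue (cube (- R *\<^sub>R One :: 'a, 2 * R)) = ennreal (2 ^ ?d * R ^ ?d)" if "0 < R" for R
    using emeasure_cube[of "(- R *\<^sub>R One :: 'a, 2 * R)"] that by (simp add: vol_def power_mult_distrib)
  show thesis
  proof (cases "0 \<le> g")
    case True
    show thesis
    proof (rule that)
      show "0 \<le> ?d powr g * 2 ^ ?d" by simp
      fix R :: real assume R: "0 < R"
      have "nint (\<lambda>x::'a. norm x powr g) (- R *\<^sub>R One, 2 * R) \<le> (\<integral>\<^sup>+x\<in>cube (- R *\<^sub>R One :: 'a, 2 * R). ennreal ((?d * R) powr g) \<partial>lebesgue)"
        unfolding nint_def
      proof (intro nn_integral_mono)
        fix x :: 'a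
        show "ennreal (norm x powr g) * indicator (cube (- R *\<^sub>R One, 2 * R)) x \<le> ennreal ((?d * R) powr g) * indicator (cube (- R *\<^sub>R One, 2 * R)) x"
        proof (cases "x \<in> cube (- R *\<^sub>R One, 2 * R)")
          case x: True
          have "norm x \<le> (\<Sum>i\<in>Basis. \<bar>x \<bullet> i\<bar>)" by (rule norm_le_l1)
          also have "\<dots> \<le> (\<Sum>i\<in>(Basis :: 'a set). R)" using x unfolding mem by (intro sum_mono) blast
          also have "\<dots> = ?d * R" by simp
          finally show ?thesis using True x by (simp add: ennreal_leI powr_mono2)
        qed simp
      qed
      also have "\<dots> = ennreal ((?d * R) powr g) * ennreal (2 ^ ?d * R ^ ?d)"
        by (simp only: nn_integral_cmult_indicator[OF cube_sets(1)] em[OF R])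
      also have "\<dots> = ennreal (?d powr g * 2 ^ ?d * R powr (g + ?d))"
        using R by (simp add: ennreal_mult[symmetric] powr_mult powr_add powr_realpow mult.commute mult.left_commute)
      finally show "nint (\<lambda>x::'a. norm x powr g) (- R *\<^sub>R One, 2 * R) \<le> ennreal (?d powr g * 2 ^ ?d * R powr (g + ?d))" .
    qed
  next
    case False
    \<comment> \<open>For negative \<open>g\<close> the cube is split into dyadic shells,
      \<open>B k\<close> without \<open>B (Suc k)\<close>, on which the integrand is at most
      \<open>(R / 2 ^ Suc k) powr g\<close>. Enlarging each shell to \<open>B k\<close> gives terms
      that decay like powers of \<open>\<kappa>\<close>, and \<open>\<kappa> < 1\<close> is the
      hypothesis on \<open>g\<close>.\<close>
    define \<kappa> where "\<kappa> = 2 powr - (g + ?d)"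
    have "2 powr - (g + ?d) < 2 powr (0 :: real)" using g by (intro powr_less_mono) auto
    then have \<kappa>: "0 < \<kappa>" "\<kappa> < 1" by (simp_all add: \<kappa>_def)
    show thesis
    proof (rule that)
      show "0 \<le> 2 powr - g * 2 ^ ?d * (1 / (1 - \<kappa>))" using \<kappa> by simp
      fix R :: real assume R: "0 < R"
      define B :: "nat \<Rightarrow> 'a set" where "B k = cube (- (R / 2 ^ k) *\<^sub>R One, 2 * (R / 2 ^ k))" for k
      have Bs[measurable]: "B k \<in> sets lebesgue" for k by (simp add: B_def)
      have memB: "x \<in> B k \<longleftrightarrow> (\<forall>i\<in>Basis. \<bar>x \<bullet> i\<bar> \<le> R / 2 ^ k)" for x k unfolding B_def mem ..
      have "nint (\<lambda>x::'a. norm x powr g) (- R *\<^sub>R One, 2 * R) \<le> (\<integral>\<^sup>+x. (\<Sum>k. ennreal ((R / 2 ^ Suc k) powr g) * indicator (B k) x) \<partial>lebesgue)"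
        unfolding nint_def
      proof (intro nn_integral_mono)
        fix x :: 'a
        show "ennreal (norm x powr g) * indicator (cube (- R *\<^sub>R One, 2 * R)) x \<le> (\<Sum>k. ennreal ((R / 2 ^ Suc k) powr g) * indicator (B k) x)"
        \<comment> \<open>The origin lies in every \<open>B k\<close> and in no shell, but there
          \<open>norm x powr g\<close> is 0 by the convention for \<open>powr\<close>.\<close>
        proof (cases "x \<in> cube (- R *\<^sub>R One, 2 * R) \<and> x \<noteq> 0")
          case True
          then have x0: "x \<in> B 0" by (simp add: B_def)
          obtain i where i: "i \<in> Basis" "x \<bullet> i \<noteq> 0" using True by (metis euclidean_all_zero_iff)
          obtain n :: nat where "R / \<bar>x \<bullet> i\<bar> < 2 ^ n" using real_arch_pow[of 2 "R / \<bar>x \<bullet> i\<bar>"] by auto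
          then have "R / 2 ^ n < \<bar>x \<bullet> i\<bar>" using i by (simp add: field_simps)
          then have n: "x \<notin> B n" using i unfolding memB by (auto simp: not_le)
          have "\<exists>k. x \<in> B k \<and> x \<notin> B (Suc k)"
          proof (rule ccontr)
            assume "\<nexists>k. x \<in> B k \<and> x \<notin> B (Suc k)"
            then have "x \<in> B k" for k by (induction k) (use x0 in auto)
            then show False using n by blast
          qed
          then obtain k where k: "x \<in> B k" "x \<notin> B (Suc k)" by blast
          then obtain j where j: "j \<in> Basis" "R / 2 ^ Suc k < \<bar>x \<bullet> j\<bar>" unfolding memB by (auto simp: not_le)
          have "R / 2 ^ Suc k \<le> norm x" using Basis_le_norm[OF j(1), of x] j(2) by linarith
          then have "norm x powr g \<le> (R / 2 ^ Suc k) powr g" using False R by (intro powr_mono2') auto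
          then have "ennreal (norm x powr g) \<le> sum (\<lambda>k. ennreal ((R / 2 ^ Suc k) powr g) * indicator (B k) x) {k}"
            using k by (simp add: ennreal_leI)
          also have "\<dots> \<le> (\<Sum>k. ennreal ((R / 2 ^ Suc k) powr g) * indicator (B k) x)"
            by (rule sum_le_suminf) auto
          finally show ?thesis using True by simp
        qed auto
      qed
      also have "\<dots> = (\<Sum>k. \<integral>\<^sup>+x. ennreal ((R / 2 ^ Suc k) powr g) * indicator (B k) x \<partial>lebesgue)"
        by (rule nn_integral_suminf) measurable
      also have "\<dots> = (\<Sum>k. ennreal (2 powr - g * 2 ^ ?d * R powr (g + ?d) * \<kappa> ^ k))"
      proof (intro suminf_cong)
        fix k
        have "(\<integral>\<^sup>+x. ennreal ((R / 2 ^ Suc k) powr g) * indicator (B k) x \<partial>lebesgue) = ennreal ((R / 2 ^ Suc k) powr g) * ennreal (2 ^ ?d * (R / 2 ^ k) ^ ?d)"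
          using em[of "R / 2 ^ k"] R by (simp only: nn_integral_cmult_indicator[OF Bs]) (simp add: B_def)
        also have "\<dots> = ennreal ((R / 2 ^ Suc k) powr g * (2 ^ ?d * (R / 2 ^ k) ^ ?d))"
          using R by (simp add: ennreal_mult)
        also have "(R / 2 ^ Suc k) powr g * (2 ^ ?d * (R / 2 ^ k) ^ ?d) = 2 powr - g * 2 ^ ?d * R powr (g + ?d) * \<kappa> ^ k"
        proof -
          define D where "D = R / 2 ^ k"
          have D: "0 < D" using R by (simp add: D_def)
          have "(R / 2 ^ Suc k) powr g = (D / 2) powr g" by (simp add: D_def mult.commute)
          also have "\<dots> = D powr g / 2 powr g" by (rule powr_divide)
          also have "\<dots> = 2 powr - g * D powr g" by (simp add: powr_minus divide_inverse mult.commute)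
          finally have "(R / 2 ^ Suc k) powr g * (2 ^ ?d * D ^ ?d) = 2 powr - g * 2 ^ ?d * (D powr g * D powr ?d)"
            using D by (simp add: powr_realpow)
          also have "D powr g * D powr ?d = D powr (g + ?d)" by (simp add: powr_add)
          also have "\<dots> = R powr (g + ?d) / (2 ^ k) powr (g + ?d)" unfolding D_def by (rule powr_divide)
          also have "(2 ^ k) powr (g + ?d) = (2 powr (g + ?d)) ^ k"
            by (simp add: powr_realpow[symmetric] powr_powr mult.commute)
          also have "R powr (g + ?d) / (2 powr (g + ?d)) ^ k = R powr (g + ?d) * \<kappa> ^ k"
            by (simp only: \<kappa>_def powr_minus power_inverse divide_inverse)
          finally show ?thesis by (simp add: D_def mult.assoc)
        qed
        finally show "(\<integral>\<^sup>+x. ennreal ((R / 2 ^ Suc k) powr g) * indicator (B k) x \<partial>lebesgue)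
          = ennreal (2 powr - g * 2 ^ ?d * R powr (g + ?d) * \<kappa> ^ k)" .
      qed
      also have "\<dots> = ennreal (2 powr - g * 2 ^ ?d * R powr (g + ?d) * (1 / (1 - \<kappa>)))"
        using \<kappa> by (intro suminf_ennreal_eq sums_mult geometric_sums) auto
      finally show "nint (\<lambda>x::'a. norm x powr g) (- R *\<^sub>R One, 2 * R) \<le> ennreal (2 powr - g * 2 ^ ?d * (1 / (1 - \<kappa>)) * R powr (g + ?d))"
        by (simp add: mult.commute mult.left_commute)
    qed
  qed
qed

lemma powr_comparable:
  fixes x y m g :: real
  assumes "0 < y" "1 \<le> m" "y / m \<le> x" "x \<le> m * y"
  shows "x powr g \<le> m powr \<bar>g\<bar> * y powr g"
proof (cases "0 \<le> g")
  case True
  have "0 < y / m" using assms by simp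
  then have "x powr g \<le> (m * y) powr g" using assms True by (intro powr_mono2) linarith+
  then show ?thesis using True by (simp add: powr_mult)
next
  case False
  have "x powr g \<le> (y / m) powr g" using assms False by (intro powr_mono2') auto
  also have "(y / m) powr g = y powr g / m powr g" by (rule powr_divide)
  finally show ?thesis using False by (simp add: powr_minus divide_inverse mult.commute)
qed

text \<open>The maximum of the norm of the corner and the side \<open>l\<close> is the typical size
  of points of \<open>Q\<close>. If the corner is within \<open>2 * d * l\<close> of the origin,
  with \<open>d\<close> the dimension, \<open>Q\<close> lies in a centred cube of comparable side;
  otherwise its points differ from the corner by at most half the norm of the corner, and the
  integrand is constant up to a factor.\<close>

lemma nint_norm_powr_cube:
  fixes g :: real
  assumes g: "- real DIM('a::euclidean_space) < g"
  obtains C where "0 \<le> C" "\<And>Q :: 'a \<times> real. 0 < snd Q \<Longrightarrow>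
    nint (\<lambda>x. norm x powr g) Q \<le> ennreal (C * max (norm (fst Q)) (snd Q) powr g * vol Q)"
proof (rule nint_norm_powr_origin[OF g])
  let ?d = "DIM('a)"
  fix C assume C: "0 \<le> C" "\<And>R. 0 < R \<Longrightarrow> nint (\<lambda>x::'a. norm x powr g) (- R *\<^sub>R One, 2 * R) \<le> ennreal (C * R powr (g + DIM('a)))"
  have d: "1 \<le> real ?d" "1 \<le> 2 * real ?d" using DIM_positive[where 'a='a] by linarith+
  define C1 where "C1 = C * (3 * ?d) powr (g + ?d) * (2 * ?d) powr \<bar>g\<bar>"
  define C2 where "C2 = 2 powr \<bar>g\<bar>"
  have C12: "0 \<le> C1" "0 \<le> C2" using C by (auto simp: C1_def C2_def)
  show thesis
  proof (rule that)
    show "0 \<le> C1 + C2" using C12 by simp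
    fix Q :: "'a \<times> real" assume Q: "0 < snd Q"
    define c where "c = fst Q"
    define l where "l = snd Q"
    define M where "M = max (norm c) l"
    have l: "0 < l" using Q by (simp add: l_def)
    have M: "0 < M" using l by (simp add: M_def)
    have V: "0 < vol Q" by (rule vol_pos[OF Q])
    have near: "norm (x - c) \<le> ?d * l" if x: "x \<in> cube Q" for x
    proof -
      have "norm (x - c) \<le> (\<Sum>i\<in>Basis. \<bar>(x - c) \<bullet> i\<bar>)" by (rule norm_le_l1)
      also have "\<dots> \<le> (\<Sum>i\<in>(Basis :: 'a set). l)"
      proof (rule sum_mono)
        fix i :: 'a assume "i \<in> Basis"
        from bspec[OF x[unfolded mem_cube] this] show "\<bar>(x - c) \<bullet> i\<bar> \<le> l"
          by (simp add: inner_diff_left c_def l_def abs_le_iff)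
      qed
      finally show ?thesis by simp
    qed
    have "nint (\<lambda>x. norm x powr g) Q \<le> ennreal (C1 * M powr g * vol Q) \<or> nint (\<lambda>x. norm x powr g) Q \<le> ennreal (C2 * M powr g * vol Q)"
    proof (cases "norm c \<le> 2 * ?d * l")
      case True
      define R where "R = 3 * ?d * l"
      have R: "0 < R" using l d by (simp add: R_def)
      have "cube Q \<subseteq> cube (- R *\<^sub>R One, 2 * R)"
      proof
        fix x assume x: "x \<in> cube Q"
        have "norm x \<le> norm c + norm (x - c)" by (metis add_diff_cancel_left' diff_add_cancel norm_triangle_ineq add.commute)
        then have nx: "norm x \<le> R" using near[OF x] True by (simp add: R_def)
        show "x \<in> cube (- R *\<^sub>R One, 2 * R)"
          unfolding mem_cube
        proof
          fix i :: 'a assume i: "i \<in> Basis"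
          show "fst (- R *\<^sub>R One, 2 * R) \<bullet> i \<le> x \<bullet> i \<and> x \<bullet> i \<le> fst (- R *\<^sub>R One, 2 * R) \<bullet> i + snd (- R *\<^sub>R One, 2 * R)"
            using Basis_le_norm[OF i, of x] nx i by (simp add: abs_le_iff)
        qed
      qed
      then have "nint (\<lambda>x. norm x powr g) Q \<le> ennreal (C * R powr (g + ?d))"
        by (rule order_trans[OF nint_mono_cube C(2)[OF R]])
      also have "C * R powr (g + ?d) = C * (3 * ?d) powr (g + ?d) * (l powr g * vol Q)"
        using l by (simp add: R_def powr_mult powr_add powr_realpow vol_def l_def)
      also have "ennreal \<dots> \<le> ennreal (C * (3 * ?d) powr (g + ?d) * (((2 * ?d) powr \<bar>g\<bar> * M powr g) * vol Q))"
      proof (intro ennreal_leI mult_left_mono mult_right_mono powr_comparable)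
        have "l \<le> 2 * ?d * l" using mult_right_mono[OF d(2), of l] l by simp
        then have "M \<le> 2 * ?d * l" using True by (simp add: M_def)
        then show "M / (2 * ?d) \<le> l" using d by (simp add: field_simps)
        have "M \<le> 2 * ?d * M" using mult_right_mono[OF d(2), of M] M by simp
        moreover have "l \<le> M" by (simp add: M_def)
        ultimately show "l \<le> 2 * ?d * M" by simp
      qed (use C M V d in auto)
      finally have "nint (\<lambda>x. norm x powr g) Q \<le> ennreal (C1 * M powr g * vol Q)" by (simp add: C1_def mult.assoc)
      then show ?thesis ..
    next
      case False
      have "l \<le> 2 * ?d * l" using mult_right_mono[OF d(2), of l] l by simp
      then have Mc: "M = norm c" using False by (simp add: M_def)
      have "nint (\<lambda>x. norm x powr g) Q \<le> (\<integral>\<^sup>+x\<in>cube Q. ennreal (C2 * M powr g) \<partial>lebesgue)"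
        unfolding nint_def
      proof (intro nn_integral_mono)
        fix x
        show "ennreal (norm x powr g) * indicator (cube Q) x \<le> ennreal (C2 * M powr g) * indicator (cube Q) x"
        proof (cases "x \<in> cube Q")
          case x: True
          have "norm (x - c) \<le> norm c / 2" using near[OF x] False by linarith
          moreover have "norm x \<le> norm c + norm (x - c)" by (metis add_diff_cancel_left' diff_add_cancel norm_triangle_ineq add.commute)
          moreover have "norm c \<le> norm x + norm (x - c)" by (metis norm_minus_commute norm_triangle_sub)
          ultimately have "norm x powr g \<le> C2 * M powr g"
            unfolding C2_def using M by (intro powr_comparable) (auto simp: Mc)
          then show ?thesis using x by (simp add: ennreal_leI)
        qed simp
      qed
      also have "\<dots> = ennreal (C2 * M powr g) * ennreal (vol Q)"
        by (simp only: nn_integral_cmult_indicator[OF cube_sets(1)] emeasure_cube[OF Q])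
      also have "\<dots> = ennreal (C2 * M powr g * vol Q)" using C12 V by (simp add: ennreal_mult)
      finally show ?thesis ..
    qed
    moreover have "C1 * M powr g * vol Q \<le> (C1 + C2) * M powr g * vol Q" "C2 * M powr g * vol Q \<le> (C1 + C2) * M powr g * vol Q"
      using C12 V by (auto intro!: mult_right_mono)
    ultimately have "nint (\<lambda>x. norm x powr g) Q \<le> ennreal ((C1 + C2) * M powr g * vol Q)"
      by (meson ennreal_leI order_trans)
    then show "nint (\<lambda>x. norm x powr g) Q \<le> ennreal ((C1 + C2) * max (norm (fst Q)) (snd Q) powr g * vol Q)"
      by (simp add: M_def c_def l_def)
  qed
qed

text \<open>The size \<open>M\<close> of the cube enters the two norms as \<open>M powr e\<close>
  and \<open>M powr - e\<close>; these cancel in the product and leave only powers of the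
  volume.\<close>

lemma power_weight_condition:
  fixes e t\<^sub>1 t\<^sub>2 :: real
  assumes t: "0 < t\<^sub>1" "0 < t\<^sub>2" and e: "- real DIM('a::euclidean_space) < e * t\<^sub>1" "- real DIM('a) < e * - t\<^sub>2"
  obtains K where "\<And>Q :: 'a \<times> real. 0 < snd Q \<Longrightarrow> nint (\<lambda>x. \<bar>norm x powr e\<bar> powr t\<^sub>1) Q < \<infinity>"
      "\<And>Q :: 'a \<times> real. 0 < snd Q \<Longrightarrow> nint (\<lambda>x. \<bar>norm x powr e\<bar> powr - t\<^sub>2) Q < \<infinity>"
      "\<And>Q :: 'a \<times> real. 0 < snd Q \<Longrightarrow> mass (\<lambda>x. \<bar>norm x powr e\<bar> powr t\<^sub>1) Q powr (1 / t\<^sub>1) * mass (\<lambda>x. \<bar>norm x powr e\<bar> powr - t\<^sub>2) Q powr (1 / t\<^sub>2)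
        \<le> K * vol Q powr (1 / t\<^sub>1 + 1 / t\<^sub>2)"
proof (rule nint_norm_powr_cube[OF e(1)], rule nint_norm_powr_cube[OF e(2)])
  fix C D :: real
  assume C: "0 \<le> C" "\<And>Q :: 'a \<times> real. 0 < snd Q \<Longrightarrow>
      nint (\<lambda>x. norm x powr (e * t\<^sub>1)) Q \<le> ennreal (C * max (norm (fst Q)) (snd Q) powr (e * t\<^sub>1) * vol Q)"
    and D: "0 \<le> D" "\<And>Q :: 'a \<times> real. 0 < snd Q \<Longrightarrow>
      nint (\<lambda>x. norm x powr (e * - t\<^sub>2)) Q \<le> ennreal (D * max (norm (fst Q)) (snd Q) powr (e * - t\<^sub>2) * vol Q)"
  have eq: "\<bar>norm x powr e\<bar> powr c = norm x powr (e * c)" for x :: 'a and c by (simp add: powr_powr)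
  show thesis
  proof (rule that[of "C powr (1 / t\<^sub>1) * D powr (1 / t\<^sub>2)"])
    fix Q :: "'a \<times> real" assume Q: "0 < snd Q"
    define M where "M = max (norm (fst Q)) (snd Q)"
    have M: "0 < M" using Q by (simp add: M_def)
    have V: "0 < vol Q" by (rule vol_pos[OF Q])
    show 1: "nint (\<lambda>x. \<bar>norm x powr e\<bar> powr t\<^sub>1) Q < \<infinity>" unfolding eq using le_less_trans[OF C(2)[OF Q]] by simp
    show 2: "nint (\<lambda>x. \<bar>norm x powr e\<bar> powr - t\<^sub>2) Q < \<infinity>" unfolding eq using le_less_trans[OF D(2)[OF Q]] by simp
    have "mass (\<lambda>x. \<bar>norm x powr e\<bar> powr t\<^sub>1) Q \<le> C * M powr (e * t\<^sub>1) * vol Q"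
      using C(2)[OF Q] 1 C(1) V unfolding eq M_def[symmetric] by (simp add: nint_mass)
    moreover have "mass (\<lambda>x. \<bar>norm x powr e\<bar> powr - t\<^sub>2) Q \<le> D * M powr (e * - t\<^sub>2) * vol Q"
      using D(2)[OF Q] 2 D(1) V unfolding eq M_def[symmetric] by (simp add: nint_mass)
    ultimately have "mass (\<lambda>x. \<bar>norm x powr e\<bar> powr t\<^sub>1) Q powr (1 / t\<^sub>1) * mass (\<lambda>x. \<bar>norm x powr e\<bar> powr - t\<^sub>2) Q powr (1 / t\<^sub>2)
      \<le> (C * M powr (e * t\<^sub>1) * vol Q) powr (1 / t\<^sub>1) * (D * M powr (e * - t\<^sub>2) * vol Q) powr (1 / t\<^sub>2)"
      using t by (intro mult_mono powr_mono2) auto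
    also have "\<dots> = C powr (1 / t\<^sub>1) * M powr e * vol Q powr (1 / t\<^sub>1) * (D powr (1 / t\<^sub>2) * M powr - e * vol Q powr (1 / t\<^sub>2))"
      using t by (simp add: powr_mult powr_powr)
    also have "\<dots> = C powr (1 / t\<^sub>1) * D powr (1 / t\<^sub>2) * (M powr e * M powr - e) * (vol Q powr (1 / t\<^sub>1) * vol Q powr (1 / t\<^sub>2))"
      by (simp only: mult.assoc mult.commute mult.left_commute)
    also have "M powr e * M powr - e = 1" unfolding powr_add[symmetric] using M by simp
    finally show "mass (\<lambda>x. \<bar>norm x powr e\<bar> powr t\<^sub>1) Q powr (1 / t\<^sub>1) * mass (\<lambda>x. \<bar>norm x powr e\<bar> powr - t\<^sub>2) Q powr (1 / t\<^sub>2)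
        \<le> C powr (1 / t\<^sub>1) * D powr (1 / t\<^sub>2) * vol Q powr (1 / t\<^sub>1 + 1 / t\<^sub>2)"
      by (simp add: powr_add)
  qed
qed

lemma weight_norm_powr: "weight (\<lambda>x::'a::euclidean_space. norm x powr e)"
proof -
  have "(\<lambda>x::'a. norm x powr e) \<in> borel_measurable borel" by measurable
  then have "(\<lambda>x::'a. norm x powr e) \<in> L0" unfolding L0_def by (auto intro: measurable_completion)
  moreover have "AE x in lebesgue. x \<noteq> (0::'a)" by (rule AE_completion) (rule AE_lborel_singleton)
  then have "AE x in lebesgue. 0 < norm (x::'a) powr e" by (auto elim!: eventually_mono)
  ultimately show ?thesis by (simp add: weight_def)
qed

theorem theorem3p10:
  fixes r p q :: real and s :: ereal
  assumes "0 < r" and "0 < s" and "ereal r < s"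
    and "r < p" and "ereal p < s" and "p \<le> q" and "ereal q < s"
  shows "(\<forall>v::real ^ 'n \<Rightarrow> real.
            weight v \<longrightarrow>
            (SUP Q\<in>cubes.
               ennreal (measure lebesgue Q powr (- (1 / r - real_of_ereal (1 / s) - 1 / p + 1 / q))) *
               Lp_norm (1 / (1 / q - real_of_ereal (1 / s))) (\<lambda>x. v x * indicator Q x) *
               Lp_norm (1 / (1 / r - 1 / p)) (\<lambda>x. inverse (v x) * indicator Q x)) < \<infinity> \<longrightarrow>
            maximal_bounded (rs_space (morrey p q v) r s) \<and>
            maximal_bounded (kothe_dual (rs_space (morrey p q v) r s)))
       \<and> (\<forall>\<beta>::real.
            - (1 / q - real_of_ereal (1 / s)) < \<beta> \<and> \<beta> < 1 / r - 1 / p \<longrightarrow>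
            (let v = (\<lambda>x::real ^ 'n. norm x powr (\<beta> * real CARD('n)))
             in maximal_bounded (rs_space (morrey p q v) r s) \<and>
                maximal_bounded (kothe_dual (rs_space (morrey p q v) r s))))"
proof -
  define \<rho> where "\<rho> = real_of_ereal (1 / s)"
  define t\<^sub>1 where "t\<^sub>1 = 1 / (1 / q - \<rho>)"
  define t\<^sub>2 where "t\<^sub>2 = 1 / (1 / r - 1 / p)"
  have q: "0 < q" using assms by linarith
  have t: "0 < t\<^sub>1" "0 < t\<^sub>2"
    using reciprocal_ereal(2)[OF q assms(7)] frac_less2[of 1 1 r p] assms by (simp_all add: t\<^sub>1_def t\<^sub>2_def \<rho>_def)
  note main = maximal_bounded_rs_space[OF assms(1,4,6,2,7), folded \<rho>_def, folded t\<^sub>1_def t\<^sub>2_def]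
  show ?thesis
    unfolding \<rho>_def[symmetric] t\<^sub>1_def[symmetric] t\<^sub>2_def[symmetric]
  proof (intro conjI[of "All _"] allI impI)
    fix v :: "real ^ 'n \<Rightarrow> real"
    assume v: "weight v" and sup: "(SUP Q\<in>cubes. ennreal (measure lebesgue Q powr - (1 / r - \<rho> - 1 / p + 1 / q)) *
               Lp_norm t\<^sub>1 (\<lambda>x. v x * indicator Q x) * Lp_norm t\<^sub>2 (\<lambda>x. inverse (v x) * indicator Q x)) < \<infinity>"
    have \<gamma>: "1 / r - \<rho> - 1 / p + 1 / q = 1 / t\<^sub>1 + 1 / t\<^sub>2" by (simp add: t\<^sub>1_def t\<^sub>2_def)
    show "maximal_bounded (rs_space (morrey p q v) r s) \<and> maximal_bounded (kothe_dual (rs_space (morrey p q v) r s))"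
      by (rule weight_condition[OF v t \<gamma> sup]) (rule main[OF v])
  next
    fix \<beta> :: real
    assume "- (1 / q - \<rho>) < \<beta> \<and> \<beta> < 1 / r - 1 / p"
    then have \<beta>: "- (1 / t\<^sub>1) < \<beta>" "\<beta> < 1 / t\<^sub>2" by (simp_all add: t\<^sub>1_def t\<^sub>2_def)
    \<comment> \<open>Multiplied by \<open>t\<^sub>1\<close>, \<open>t\<^sub>2\<close> and the
      dimension, the range of \<open>\<beta>\<close> becomes the condition that both powers of the
      weight be integrable at the origin.\<close>
    have "- 1 < \<beta> * t\<^sub>1" "- 1 < \<beta> * - t\<^sub>2" using \<beta> t by (simp_all add: field_simps)
    then have "real CARD('n) * (- 1) < real CARD('n) * (\<beta> * t\<^sub>1)"
      "real CARD('n) * (- 1) < real CARD('n) * (\<beta> * - t\<^sub>2)"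
      by (intro mult_strict_left_mono; simp)+
    then have e: "- real DIM(real ^ 'n) < \<beta> * CARD('n) * t\<^sub>1" "- real DIM(real ^ 'n) < \<beta> * CARD('n) * - t\<^sub>2"
      by (simp_all add: mult.commute mult.left_commute)
    show "let v = (\<lambda>x::real ^ 'n. norm x powr (\<beta> * real CARD('n)))
             in maximal_bounded (rs_space (morrey p q v) r s) \<and>
                maximal_bounded (kothe_dual (rs_space (morrey p q v) r s))"
      unfolding Let_def by (rule power_weight_condition[OF t e]) (rule main[OF weight_norm_powr])
  qed
qed

end
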